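(* Let $X_1,X_2$ be complex Banach spaces and let $\mathcal{A}_1\subseteq\mathcal{B}(X_1)$, $\mathcal{A}_2\subseteq\mathcal{B}(X_2)$ be standard operator algebras. Let $r,s$ be nonnegative integers with $r+s\geq1$ and set $m=r+s+1$. Let $\Phi:\mathcal{A}_1\to\mathcal{A}_2$ be a map whose range contains every operator in $\mathcal{B}(X_2)$ of rank at most two. Then $$\sigma_\pi(B^rAB^s)=\sigma_\pi(\Phi(B)^r\Phi(A)\Phi(B)^s)\quad\text{for all }A,B\in\mathcal{A}_1$$ if and only if one of the following holds: (1) there exist $\lambda\in\mathbb{C}$ with $\lambda^m=1$ and an invertible $T\in\mathcal{B}(X_1,X_2)$ such that $\Phi(A)=\lambda TAT^{-1}$ for all $A\in\mathcal{A}_1$; (2) $X_1,X_2$ are reflexive and there exist $\lambda\in\mathbb{C}$ with $\lambda^m=1$ and an invertible $T\in\mathcal{B}(X_1^*,X_2)$ such that $\Phi(A)=\lambda TA^*T^{-1}$ for all $A\in\mathcal{A}_1$ (where $A^*$ is the Banach-space adjoint of $A$).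
   Context: A standard operator algebra on a complex Banach space $X$ is a subalgebra of $\mathcal{B}(X)$ containing all finite rank operators; it need not be closed or unital. The peripheral spectrum of $T\in\mathcal{B}(X)$ is $\sigma_\pi(T)=\{z\in\sigma(T):|z|=r(T)\}$, where $\sigma(T)$ is the spectrum and $r(T)$ the spectral radius. *)

theory Defs
  imports "HOL-Analysis.Analysis"
begin

class scaleC =
  fixes scaleC :: "complex \<Rightarrow> 'a \<Rightarrow> 'a" (infixr \<open>*\<^sub>C\<close> 75)

class complex_vector = scaleC + real_vector +
  assumes scaleC_add_right: "a *\<^sub>C (x + y) = a *\<^sub>C x + a *\<^sub>C y"
    and scaleC_add_left: "(a + b) *\<^sub>C x = a *\<^sub>C x + b *\<^sub>C x"
    and scaleC_scaleC: "a *\<^sub>C (b *\<^sub>C x) = (a * b) *\<^sub>C x"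
    and scaleC_one: "1 *\<^sub>C x = x"
    and scaleR_scaleC: "scaleR r x = (complex_of_real r) *\<^sub>C x"

class complex_normed_vector = complex_vector + real_normed_vector +
  assumes norm_scaleC: "norm (a *\<^sub>C x) = cmod a * norm x"

instantiation complex :: complex_normed_vector
begin
definition scaleC_complex_def: "a *\<^sub>C (z::complex) = a * z"
instance
  by standard (auto simp: scaleC_complex_def algebra_simps norm_mult scaleR_conv_of_real)
end

interpretation cvs: vector_space "scaleC :: complex \<Rightarrow> 'a::complex_vector \<Rightarrow> 'a"
  by unfold_locales (fact scaleC_add_right scaleC_add_left scaleC_scaleC scaleC_one)+

abbreviation cspan :: "'a::complex_vector set \<Rightarrow> 'a set" where
  "cspan \<equiv> cvs.span"

definition clinear :: "('a::complex_vector \<Rightarrow> 'b::complex_vector) \<Rightarrow> bool" where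
  "clinear f \<longleftrightarrow> (\<forall>x y. f (x + y) = f x + f y) \<and> (\<forall>c x. f (c *\<^sub>C x) = c *\<^sub>C f x)"

definition bounded_clinear :: "('a::complex_normed_vector \<Rightarrow> 'b::complex_normed_vector) \<Rightarrow> bool" where
  "bounded_clinear f \<longleftrightarrow> clinear f \<and> (\<exists>K. \<forall>x. norm (f x) \<le> norm x * K)"

definition invertible_op :: "('a::complex_normed_vector \<Rightarrow> 'b::complex_normed_vector) \<Rightarrow> bool" where
  "invertible_op T \<longleftrightarrow> bounded_clinear T \<and>
     (\<exists>S. bounded_clinear S \<and> (\<forall>x. S (T x) = x) \<and> (\<forall>y. T (S y) = y))"

definition finite_rank :: "('a::complex_vector \<Rightarrow> 'b::complex_vector) \<Rightarrow> bool" where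
  "finite_rank T \<longleftrightarrow> (\<exists>B. finite B \<and> range T \<subseteq> cspan B)"

definition rank_le :: "('a::complex_vector \<Rightarrow> 'b::complex_vector) \<Rightarrow> nat \<Rightarrow> bool" where
  "rank_le T n \<longleftrightarrow> (\<exists>B. finite B \<and> card B \<le> n \<and> range T \<subseteq> cspan B)"

definition op_spectrum :: "('a::complex_normed_vector \<Rightarrow> 'a) \<Rightarrow> complex set" where
  "op_spectrum T = {z. \<not> invertible_op (\<lambda>x. T x - z *\<^sub>C x)}"

definition op_spectral_radius :: "('a::complex_normed_vector \<Rightarrow> 'a) \<Rightarrow> real" where
  "op_spectral_radius T = Sup (cmod ` op_spectrum T)"

definition peripheral_spectrum :: "('a::complex_normed_vector \<Rightarrow> 'a) \<Rightarrow> complex set" where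
  "peripheral_spectrum T = {z \<in> op_spectrum T. cmod z = op_spectral_radius T}"

definition standard_operator_algebra :: "('a::complex_normed_vector \<Rightarrow> 'a) set \<Rightarrow> bool" where
  "standard_operator_algebra \<A> \<longleftrightarrow>
     (\<forall>A\<in>\<A>. bounded_clinear A) \<and>
     (\<forall>A\<in>\<A>. \<forall>B\<in>\<A>. (\<lambda>x. A x + B x) \<in> \<A>) \<and>
     (\<forall>c. \<forall>A\<in>\<A>. (\<lambda>x. c *\<^sub>C A x) \<in> \<A>) \<and>
     (\<forall>A\<in>\<A>. \<forall>B\<in>\<A>. A \<circ> B \<in> \<A>) \<and>
     (\<forall>F. bounded_clinear F \<and> finite_rank F \<longrightarrow> F \<in> \<A>)"

text \<open>The dual space X* is represented as the set of bounded complex-linear functionals,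
  normed by the operator norm.\<close>
definition dual_space :: "'a::complex_normed_vector itself \<Rightarrow> ('a \<Rightarrow> complex) set" where
  "dual_space _ = {f. bounded_clinear f}"

definition dual_bounded_clinear ::
  "'a::complex_normed_vector itself \<Rightarrow> (('a \<Rightarrow> complex) \<Rightarrow> 'b::complex_normed_vector) \<Rightarrow> bool" where
  "dual_bounded_clinear X T \<longleftrightarrow>
     (\<forall>f\<in>dual_space X. \<forall>g\<in>dual_space X. T (\<lambda>x. f x + g x) = T f + T g) \<and>
     (\<forall>c. \<forall>f\<in>dual_space X. T (\<lambda>x. c * f x) = c *\<^sub>C T f) \<and>
     (\<exists>K. \<forall>f\<in>dual_space X. norm (T f) \<le> onorm f * K)"

definition dual_invertible_op ::
  "'a::complex_normed_vector itself \<Rightarrow> (('a \<Rightarrow> complex) \<Rightarrow> 'b::complex_normed_vector) \<Rightarrow> bool" where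
  "dual_invertible_op X T \<longleftrightarrow> dual_bounded_clinear X T \<and> bij_betw T (dual_space X) UNIV \<and>
     (\<exists>K. \<forall>y. onorm (inv_into (dual_space X) T y) \<le> norm y * K)"

definition adjoint_op :: "('a \<Rightarrow> 'a) \<Rightarrow> ('a \<Rightarrow> complex) \<Rightarrow> ('a \<Rightarrow> complex)" where
  "adjoint_op A f = f \<circ> A"

definition reflexive_space :: "'a::complex_normed_vector itself \<Rightarrow> bool" where
  "reflexive_space X \<longleftrightarrow>
     (\<forall>\<phi> :: ('a \<Rightarrow> complex) \<Rightarrow> complex. dual_bounded_clinear X \<phi> \<longrightarrow>
        (\<exists>x. \<forall>f\<in>dual_space X. \<phi> f = f x))"

end

theory Submission
  imports Defs "HOL-Complex_Analysis.Cauchy_Integral_Formula"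
begin

text \<open>Since \<open>\<sigma>(CD)\<close> and \<open>\<sigma>(DC)\<close> agree off zero, \<open>B\<^sup>rAB\<^sup>s\<close> may be replaced by \<open>AB\<^sup>n\<close> with
  \<open>n = r + s\<close>. An operator \<open>A\<close> has rank at most one iff no \<open>F\<close> of rank at most two puts both
  \<open>1\<close> and \<open>- 1\<close> into the peripheral spectrum of \<open>AF\<^sup>n\<close>, so \<open>\<Phi>\<close> preserves rank one in both directions.
  For \<open>B = x \<otimes> f\<close> the peripheral spectrum of \<open>AB\<^sup>n\<close> is the singleton of \<open>f(x)\<^sup>n\<^sup>-\<^sup>1 f(Ax)\<close>; hence \<open>\<Phi>\<close> is linear, and
  after division by an \<open>m\<close>-th root of unity it preserves the form \<open>tr(AB)\<close> for \<open>B\<close> of rank one.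
  Operators of rank one are adjacent when they share their range or their kernel. Adjacency to a fixed
  idempotent is preserved, which gives \<open>x \<otimes> f \<mapsto> Tx \<otimes> Sf\<close> or \<open>x \<otimes> f \<mapsto> Sf \<otimes> Tx\<close>, and the trace form
  then determines \<open>\<Phi>\<close> on the whole algebra. Boundedness comes from the uniform boundedness principle
  and reflexivity in the second case from the surjectivity of \<open>S\<close> and \<open>T\<close>.\<close>

section \<open>Hahn--Banach and uniform boundedness\<close>

text \<open>The range is only known to contain operators of rank at most two, so every test operator
  on the target side must have rank two or less. The points \<open>1\<close> and \<open>- 1\<close>
  serve as witnesses because they are distinct and of equal modulus, while a rank-one operator has a
  one-point peripheral spectrum. The root of unity arises by putting \<open>A = B\<close> of rank
  one: the trace of the image has the same \<open>m\<close>-th power as the original trace, and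
  linearity makes the ratio a constant \<open>c\<close>. If \<open>x \<otimes> f\<close> is sent to
  \<open>y \<otimes> g\<close>, then \<open>f(x)^(n-1) f(Ax) = g(y)^(n-1) g(\<Phi>(A)y)\<close> with
  \<open>g(y) = c f(x)\<close>, whence \<open>g(\<Phi>(A)y) = c^2 f(Ax)\<close>; dividing
  \<open>\<Phi>\<close> by \<open>c\<close> removes one \<open>c\<close> from each factor of the
  product. The recurring obstacle is \<open>f(x) = 0\<close>, where this identity says nothing as
  soon as \<open>n > 1\<close>. Such pairs are reached by additivity, or avoided by functionals that
  are nonzero at two vectors at once. No continuity of \<open>\<Phi>\<close> is given, so the bounds
  on the intertwiner are weak ones first: the pairing represents every functional on the target by
  an object of the source.\<close>

definition sublinear :: "('a::real_vector \<Rightarrow> real) \<Rightarrow> bool" where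
  "sublinear p \<longleftrightarrow> (\<forall>x y. p (x + y) \<le> p x + p y) \<and> (\<forall>t\<ge>0. \<forall>x. p (t *\<^sub>R x) = t * p x)"

lemma sublinearD:
  assumes "sublinear p"
  shows "p (x + y) \<le> p x + p y" "t \<ge> 0 \<Longrightarrow> p (t *\<^sub>R x) = t * p x" "p 0 = 0" "- p (- x) \<le> p x"
proof -
  show *: "p (x + y) \<le> p x + p y" for x y using assms by (auto simp: sublinear_def)
  show "t \<ge> 0 \<Longrightarrow> p (t *\<^sub>R x) = t * p x" for t x using assms by (auto simp: sublinear_def)
  from this[of 0 0] show 0: "p 0 = 0" by simp
  from *[of x "-x"] 0 show "- p (- x) \<le> p x" by simp
qed

lemma sublinear_norm: "sublinear norm"
  by (auto simp: sublinear_def norm_triangle_ineq)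

text \<open>The infimum along the ray through \<open>y\<close> forces
  \<open>q (- y) \<le> - p y\<close>, so every linear functional below \<open>q\<close> attains
  \<open>p\<close> at \<open>y\<close>. The two bounds on \<open>q\<close> are the parameters
  \<open>t = 0\<close> and \<open>t = 1\<close>.\<close>

lemma sublinear_shrink:
  fixes p :: "'a::real_vector \<Rightarrow> real"
  assumes p: "sublinear p"
  obtains q where "sublinear q" "\<And>x. q x \<le> p x" "\<And>x. q x \<le> p (x + y) - p y"
proof -
  define a where "a x t = p (x + t *\<^sub>R y) - t * p y" for x t
  define q where "q x = (INF t\<in>{0..}. a x t)" for x
  \<comment> \<open>This lower bound does not depend on \<open>t\<close>, so the infimum is
    finite.\<close>
  have a_ge: "- p (- x) \<le> a x t" if "t \<ge> 0" for x t
    using sublinearD(1)[OF p, of "x + t *\<^sub>R y" "-x"] sublinearD(2)[OF p that, of y]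
    by (simp add: a_def)
  have bdd: "bdd_below (a x ` {0..})" for x
    using a_ge by (auto intro!: bdd_belowI)
  have q_le: "q x \<le> a x t" if "t \<ge> 0" for x t
    unfolding q_def using bdd that by (intro cINF_lower) auto
  have q_ge: "c \<le> q x" if "\<And>t. t \<ge> 0 \<Longrightarrow> c \<le> a x t" for c x
    unfolding q_def using that by (intro cINF_greatest) auto
  have add: "q (x + x') \<le> q x + q x'" for x x'
  proof -
    have "q (x + x') \<le> a x t + a x' t'" if "t \<ge> 0" "t' \<ge> 0" for t t'
    proof -
      have "q (x + x') \<le> a (x + x') (t + t')" using that by (intro q_le) auto
      also have "\<dots> \<le> a x t + a x' t'"
        using sublinearD(1)[OF p, of "x + t *\<^sub>R y" "x' + t' *\<^sub>R y"]
        by (simp add: a_def algebra_simps)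
      finally show ?thesis .
    qed
    then have "q (x + x') - a x' t' \<le> q x" if "t' \<ge> 0" for t'
      using that by (intro q_ge) (simp add: algebra_simps)
    then have "q (x + x') - q x \<le> q x'"
      by (intro q_ge) (simp add: algebra_simps)
    then show ?thesis by simp
  qed
  have scale_ge: "s * q x \<le> q (s *\<^sub>R x)" if "s > 0" for s x
  proof (rule q_ge)
    fix t :: real assume "t \<ge> 0"
    have "s * q x \<le> s * a x (t / s)" using that \<open>t \<ge> 0\<close> by (intro mult_left_mono q_le) auto
    also have "\<dots> = a (s *\<^sub>R x) t"
      using sublinearD(2)[OF p, of s "x + (t / s) *\<^sub>R y"] that
      by (simp add: a_def algebra_simps)
    finally show "s * q x \<le> a (s *\<^sub>R x) t" .
  qed
  have scale: "q (s *\<^sub>R x) = s * q x" if "s \<ge> 0" for s x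
  proof (cases "s = 0")
    case True
    have "a 0 t = 0" if "t \<ge> 0" for t using sublinearD(2)[OF p that] by (simp add: a_def)
    then have "q 0 = 0" using q_le[of 0 0] q_ge[of 0 0] by (intro antisym) auto
    with True show ?thesis by simp
  next
    case False
    with that have s: "s > 0" by simp
    from scale_ge[of "1 / s" "s *\<^sub>R x"] s have "q (s *\<^sub>R x) \<le> s * q x"
      by (simp add: field_simps)
    with scale_ge[OF s, of x] show ?thesis by simp
  qed
  have "sublinear q" using add scale by (simp add: sublinear_def)
  moreover have "q x \<le> p x" for x using q_le[of 0 x] by (simp add: a_def)
  moreover have "q x \<le> p (x + y) - p y" for x using q_le[of 1 x] by (simp add: a_def)
  ultimately show thesis by (rule that)
qed

text \<open>A minimal sublinear functional is additive, because shrinking it in any direction by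
  \<open>sublinear_shrink\<close> changes nothing.\<close>

lemma linear_below_sublinear:
  fixes p :: "'a::real_vector \<Rightarrow> real"
  assumes p: "sublinear p"
  obtains u where "linear u" "\<And>x. u x \<le> p x"
proof -
  define S where "S = {q. sublinear q \<and> (\<forall>x. q x \<le> p x)}"
  \<comment> \<open>The order is reversed: the maximal element that Zorn's lemma supplies is a
    minimal sublinear functional.\<close>
  define P where "P = (\<lambda>q q' :: 'a \<Rightarrow> real. \<forall>x. q' x \<le> q x)"
  have "\<exists>u\<in>S. \<forall>q\<in>S. P u q \<longrightarrow> q = u"
  proof (rule predicate_Zorn)
    show "partial_order_on S (relation_of P S)"
      by (auto simp: partial_order_on_def preorder_on_def refl_on_def trans_def antisym_def
          relation_of_def P_def intro: order_trans) (blast intro: ext antisym)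
  next
    fix C assume C: "C \<in> Chains (relation_of P S)"
    show "\<exists>u\<in>S. \<forall>q\<in>C. P q u"
    proof (cases "C = {}")
      case True
      have "p \<in> S" using p by (simp add: S_def)
      with True show ?thesis by blast
    next
      case False
      have CS: "q \<in> S" if "q \<in> C" for q
        using C that by (auto simp: Chains_def relation_of_def)
      have tot: "(\<forall>x. q x \<le> q' x) \<or> (\<forall>x. q' x \<le> q x)" if "q \<in> C" "q' \<in> C" for q q'
        using C that by (fastforce simp: Chains_def relation_of_def P_def)
      define u where "u x = (INF q\<in>C. q x)" for x
      \<comment> \<open>Each member satisfies \<open>q x \<ge> - q (- x)\<close>, and
        \<open>q (- x) \<le> p (- x)\<close> makes the bound common to the chain.\<close>
      have bdd: "bdd_below ((\<lambda>q. q x) ` C)" for x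
      proof (rule bdd_belowI)
        fix r assume "r \<in> (\<lambda>q. q x) ` C"
        then obtain q where q: "q \<in> C" "r = q x" by auto
        with CS have "sublinear q" "q (-x) \<le> p (-x)" by (auto simp: S_def)
        then show "- p (- x) \<le> r" using sublinearD(4)[of q x] q by auto
      qed
      have u_le: "u x \<le> q x" if "q \<in> C" for x q
        unfolding u_def using bdd that by (intro cINF_lower) auto
      have u_ge: "c \<le> u x" if "\<And>q. q \<in> C \<Longrightarrow> c \<le> q x" for c x
        unfolding u_def using that False by (intro cINF_greatest) auto
      have add: "u (x + y) \<le> u x + u y" for x y
      proof -
        have "u (x + y) \<le> q x + q' y" if q: "q \<in> C" "q' \<in> C" for q q'
        proof -
          obtain q'' where q'': "q'' \<in> C" "\<forall>x. q'' x \<le> q x" "\<forall>x. q'' x \<le> q' x"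
            using tot[OF q] q by auto
          have "u (x + y) \<le> q'' (x + y)" using q'' by (intro u_le)
          also have "\<dots> \<le> q'' x + q'' y" using CS[OF q''(1)] by (auto simp: S_def sublinear_def)
          also have "\<dots> \<le> q x + q' y" using q'' by (intro add_mono) auto
          finally show ?thesis .
        qed
        then have "u (x + y) - q' y \<le> u x" if "q' \<in> C" for q'
          using that by (intro u_ge) (simp add: algebra_simps)
        then have "u (x + y) - u x \<le> u y"
          by (intro u_ge) (simp add: algebra_simps)
        then show ?thesis by simp
      qed
      have scale: "u (t *\<^sub>R x) = t * u x" if "t \<ge> 0" for t x
      proof -
        have q: "q (t *\<^sub>R x) = t * q x" if "q \<in> C" for q
          using CS[OF that] \<open>t \<ge> 0\<close> by (auto simp: S_def sublinear_def)
        show ?thesis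
        proof (cases "t = 0")
          case True
          have "(\<lambda>q. q 0) ` C = {0}"
            using CS False sublinearD(3) by (fastforce simp: S_def)
          with True show ?thesis by (simp add: u_def)
        next
          case nz: False
          have "t * u x \<le> u (t *\<^sub>R x)"
            using that by (intro u_ge) (simp add: q u_le mult_left_mono)
          moreover have "u (t *\<^sub>R x) / t \<le> u x"
            using that nz q u_le[of _ "t *\<^sub>R x"] by (intro u_ge) (simp add: divide_le_eq mult.commute)
          ultimately show ?thesis using that nz by (simp add: field_simps)
        qed
      qed
      have "u x \<le> p x" for x
      proof -
        obtain q where "q \<in> C" using False by auto
        with u_le[OF this, of x] CS[OF this] show ?thesis by (auto simp: S_def intro: order_trans)
      qed
      with add scale have "u \<in> S" by (simp add: S_def sublinear_def)
      with u_le show ?thesis by (auto simp: P_def)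
    qed
  qed
  then obtain u where u: "u \<in> S" "\<And>q. q \<in> S \<Longrightarrow> (\<And>x. q x \<le> u x) \<Longrightarrow> q = u"
    by (auto simp: P_def)
  have sub: "sublinear u" and up: "\<And>x. u x \<le> p x" using u(1) by (auto simp: S_def)
  have add: "u (x + y) = u x + u y" for x y
  proof -
    obtain q where q: "sublinear q" "\<And>x. q x \<le> u x" "\<And>x. q x \<le> u (x + y) - u y"
      using sublinear_shrink[OF sub] by metis
    have "q \<in> S" using q up by (auto simp: S_def intro: order_trans)
    with u(2) q have "q = u" by blast
    with q(3)[of x] sublinearD(1)[OF sub, of x y] show ?thesis by simp
  qed
  have neg: "u (- x) = - u x" for x using add[of x "-x"] sublinearD(3)[OF sub] by simp
  have "linear u"
  proof (rule linearI)
    show "u (r *\<^sub>R x) = r *\<^sub>R u x" for r x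
    proof (cases "r \<ge> 0")
      case True then show ?thesis using sublinearD(2)[OF sub] by simp
    next
      case False
      then have "u ((- r) *\<^sub>R x) = (- r) * u x" using sublinearD(2)[OF sub, of "-r" x] by simp
      with neg[of "r *\<^sub>R x"] show ?thesis by simp
    qed
  qed (rule add)
  with up show thesis by (rule that[rotated])
qed

text \<open>Nothing is extended from a subspace: shrinking the norm in the direction
  \<open>x0\<close> pushes every linear minorant down to \<open>- norm x0\<close> at
  \<open>- x0\<close>, hence up to the norm at \<open>x0\<close>.\<close>

lemma real_norming_functional:
  fixes x0 :: "'a::real_normed_vector"
  obtains u :: "'a \<Rightarrow> real" where "linear u" "\<And>x. u x \<le> norm x" "u x0 = norm x0"
proof -
  obtain q where q: "sublinear q" "\<And>x. q x \<le> norm x" "\<And>x. q x \<le> norm (x + x0) - norm x0"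
    using sublinear_shrink[OF sublinear_norm] by metis
  obtain u where u: "linear u" "\<And>x. u x \<le> q x" using linear_below_sublinear[OF q(1)] by blast
  have "u (- x0) \<le> - norm x0" using u(2)[of "-x0"] q(3)[of "-x0"] by simp
  moreover have "u (- x0) = - u x0" using u(1) by (simp add: linear_neg)
  moreover have "u x \<le> norm x" for x using u(2) q(2) order_trans by blast
  ultimately show thesis using that[OF u(1)] by (metis antisym minus_le_iff minus_minus)
qed

section \<open>Bounded complex-linear maps and complex functionals\<close>

lemma clinear_add: "clinear f \<Longrightarrow> f (x + y) = f x + f y"
  and clinear_scale: "clinear f \<Longrightarrow> f (c *\<^sub>C x) = c *\<^sub>C f x"
  by (auto simp: clinear_def)

lemma bounded_clinear_clinear: "bounded_clinear f \<Longrightarrow> clinear f"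
  by (auto simp: bounded_clinear_def)

lemma bounded_clinear_bounded_linear:
  assumes "bounded_clinear f"
  shows "bounded_linear f"
  using assms by (auto simp: bounded_clinear_def clinear_def scaleR_scaleC intro!: bounded_linear.intro
      linearI bounded_linear_axioms.intro)

lemma bounded_clinearI:
  assumes "\<And>x y. f (x + y) = f x + f y" "\<And>c x. f (c *\<^sub>C x) = c *\<^sub>C f x"
    "\<And>x. norm (f x) \<le> norm x * K"
  shows "bounded_clinear f"
  using assms by (auto simp: bounded_clinear_def clinear_def)

lemma bounded_clinear_bound:
  assumes "bounded_clinear f"
  obtains K where "K > 0" "\<And>x. norm (f x) \<le> norm x * K"
  using bounded_linear.pos_bounded[OF bounded_clinear_bounded_linear[OF assms]] by blast

lemma
  assumes "bounded_clinear f"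
  shows bounded_clinear_add: "f (x + y) = f x + f y"
    and bounded_clinear_scale: "f (c *\<^sub>C x) = c *\<^sub>C f x"
    and bounded_clinear_zero: "f 0 = 0"
    and bounded_clinear_diff: "f (x - y) = f x - f y"
  using bounded_clinear_bounded_linear[OF assms] assms
  by (auto simp: bounded_clinear_def clinear_def linear_simps)

lemma scaleC_minus_left: "(- a) *\<^sub>C (x :: 'a::complex_vector) = - (a *\<^sub>C x)"
  by (rule cvs.scale_minus_left)

lemma scaleC_complex: "a *\<^sub>C (z::complex) = a * z"
  by (fact scaleC_complex_def)

text \<open>A complex-linear \<open>f\<close> satisfies
  \<open>Im (f x) = - Re (f (\<i> *\<^sub>C x))\<close>, so the formula for \<open>f\<close> is the
  only one with real part \<open>u\<close>.\<close>

lemma complex_extension: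
  fixes u :: "'a::complex_normed_vector \<Rightarrow> real"
  assumes u: "linear u" and K: "\<And>x. u x \<le> norm x * K"
  defines "f \<equiv> \<lambda>x. Complex (u x) (- u (\<i> *\<^sub>C x))"
  shows "bounded_clinear f" "cmod (f x) \<le> norm x * K" "Re (f x) = u x"
proof -
  have add: "f (x + y) = f x + f y" for x y
    by (simp add: f_def scaleC_add_right linear_add[OF u] complex_eq_iff)
  have re: "f (complex_of_real r *\<^sub>C x) = complex_of_real r * f x" for r x
  proof -
    have "u (complex_of_real r *\<^sub>C x) = r * u x"
      using linear_scale[OF u, of r x] by (simp add: scaleR_scaleC)
    moreover have "u (\<i> *\<^sub>C complex_of_real r *\<^sub>C x) = r * u (\<i> *\<^sub>C x)"
      using linear_scale[OF u, of r "\<i> *\<^sub>C x"]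
      by (simp add: scaleR_scaleC scaleC_scaleC mult.commute)
    ultimately show ?thesis by (simp add: f_def complex_eq_iff)
  qed
  have im: "f (\<i> *\<^sub>C x) = \<i> * f x" for x
    using linear_neg[OF u, of x]
    by (simp add: f_def complex_eq_iff scaleC_scaleC scaleC_minus_left scaleC_one)
  have scale: "f (c *\<^sub>C x) = c * f x" for c x
  proof -
    have "c *\<^sub>C x = complex_of_real (Re c) *\<^sub>C x + \<i> *\<^sub>C (complex_of_real (Im c) *\<^sub>C x)"
      by (simp add: scaleC_scaleC flip: scaleC_add_left complex_eq)
    then have "f (c *\<^sub>C x) = (complex_of_real (Re c) + \<i> * complex_of_real (Im c)) * f x"
      by (simp only: add re im) (simp add: algebra_simps)
    then show ?thesis by (simp flip: complex_eq)
  qed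
  show bound: "cmod (f x) \<le> norm x * K" for x
  proof (cases "f x = 0")
    case True
    have "u x \<le> norm x * K" "u (-x) \<le> norm x * K" using K[of x] K[of "-x"] by auto
    then show ?thesis using True linear_neg[OF u, of x] by simp
  next
    case False
    \<comment> \<open>This unimodular factor rotates \<open>f x\<close> onto the positive real axis,
      where the bound on the real part \<open>u\<close> bounds the modulus.\<close>
    define w where "w = cnj (sgn (f x))"
    have "f (w *\<^sub>C x) = complex_of_real (cmod (f x))"
      using False complex_norm_square[of "f x"]
      by (simp add: scale w_def sgn_eq field_simps power2_eq_square)
    then have "cmod (f x) = u (w *\<^sub>C x)"
      by (metis Re_complex_of_real complex.sel(1) f_def)
    also have "\<dots> \<le> norm (w *\<^sub>C x) * K" by (rule K)
    also have "norm (w *\<^sub>C x) = norm x" using False by (simp add: norm_scaleC w_def norm_sgn)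
    finally show ?thesis .
  qed
  show "bounded_clinear f"
    by (rule bounded_clinearI[where K = K]) (simp_all add: add scale bound scaleC_complex)
  show "Re (f x) = u x" by (simp add: f_def)
qed

lemma norming_functional:
  fixes x0 :: "'a::complex_normed_vector"
  obtains f :: "'a \<Rightarrow> complex" where "bounded_clinear f" "\<And>x. cmod (f x) \<le> norm x"
    "f x0 = complex_of_real (norm x0)"
proof -
  obtain u :: "'a \<Rightarrow> real" where u: "linear u" "\<And>x. u x \<le> norm x" "u x0 = norm x0"
    using real_norming_functional by blast
  define f where "f = (\<lambda>x. Complex (u x) (- u (\<i> *\<^sub>C x)))"
  have f: "bounded_clinear f" "\<And>x. cmod (f x) \<le> norm x" "Re (f x0) = u x0"
    using complex_extension[OF u(1), of 1] u(2) by (auto simp: f_def)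
  \<comment> \<open>The real part already exhausts the bound \<open>norm x0\<close> on the modulus,
    which leaves no room for an imaginary part.\<close>
  have "(Re (f x0))\<^sup>2 + (Im (f x0))\<^sup>2 \<le> (norm x0)\<^sup>2"
    using f(2)[of x0] by (simp add: cmod_def real_le_lsqrt sqrt_le_D)
  then have "Im (f x0) = 0" using f(3) u(3) by simp
  then have "f x0 = complex_of_real (norm x0)" using f(3) u(3) by (simp add: complex_eq_iff)
  with f show thesis by (intro that)
qed

lemma separating_functional:
  fixes x :: "'a::complex_normed_vector"
  assumes "x \<noteq> 0"
  obtains f :: "'a \<Rightarrow> complex" where "bounded_clinear f" "f x = 1"
proof -
  obtain f :: "'a \<Rightarrow> complex" where f: "bounded_clinear f" "f x = complex_of_real (norm x)"
    using norming_functional by blast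
  obtain K where K: "\<And>x. norm (f x) \<le> norm x * K" using bounded_clinear_bound[OF f(1)] by blast
  define h where "h v = f v / complex_of_real (norm x)" for v
  have "bounded_clinear h"
  proof (rule bounded_clinearI[where K = "K / norm x"])
    show "norm (h v) \<le> norm v * (K / norm x)" for v
      using K[of v] assms by (simp add: h_def norm_divide divide_simps)
  qed (simp_all add: h_def bounded_clinear_add[OF f(1)] bounded_clinear_scale[OF f(1)]
      scaleC_complex add_divide_distrib)
  moreover have "h x = 1" using assms f by (simp add: h_def)
  ultimately show thesis by (rule that)
qed

lemma functionals_separate:
  fixes x y :: "'a::complex_normed_vector"
  assumes "\<And>f :: 'a \<Rightarrow> complex. bounded_clinear f \<Longrightarrow> f x = f y"
  shows "x = y"
proof (rule ccontr)
  assume "x \<noteq> y"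
  then obtain f :: "'a \<Rightarrow> complex" where f: "bounded_clinear f" "f (x - y) = 1" using separating_functional[of "x - y"] by auto
  with assms[OF f(1)] show False by (simp add: bounded_clinear_diff)
qed

lemma bounded_clinear_0: "bounded_clinear (\<lambda>x. 0)"
  by (rule bounded_clinearI[where K = 0]) auto

lemma bounded_clinear_id: "bounded_clinear (\<lambda>x. x)"
  by (rule bounded_clinearI[where K = 1]) auto

lemma bounded_clinear_plus:
  assumes "bounded_clinear f" "bounded_clinear g"
  shows "bounded_clinear (\<lambda>x. f x + g x)"
proof -
  obtain K L where "\<And>x. norm (f x) \<le> norm x * K" "\<And>x. norm (g x) \<le> norm x * L"
    using assms by (meson bounded_clinear_bound)
  then have "norm (f x + g x) \<le> norm x * (K + L)" for x
    by (metis add_mono distrib_left norm_triangle_le)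
  then show ?thesis
    by (intro bounded_clinearI[where K = "K + L"])
      (auto simp: assms bounded_clinear_add bounded_clinear_scale scaleC_add_right)
qed

lemma bounded_clinear_compose:
  assumes "bounded_clinear f" "bounded_clinear g"
  shows "bounded_clinear (\<lambda>x. f (g x))"
proof -
  obtain K L where K: "K > 0" "\<And>x. norm (f x) \<le> norm x * K" and L: "\<And>x. norm (g x) \<le> norm x * L"
    using assms by (meson bounded_clinear_bound)
  have "norm (f (g x)) \<le> norm x * (L * K)" for x
    using order_trans[OF K(2)[of "g x"] mult_right_mono[OF L[of x], of K]] K(1)
    by (simp add: mult.assoc)
  then show ?thesis
    by (intro bounded_clinearI[where K = "L * K"])
      (auto simp: assms bounded_clinear_add bounded_clinear_scale)
qed

lemma bounded_clinear_scaleC: "bounded_clinear (\<lambda>x. c *\<^sub>C x)"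
  by (rule bounded_clinearI[where K = "cmod c"])
    (auto simp: scaleC_add_right scaleC_scaleC mult.commute norm_scaleC)

lemma bounded_clinear_scaled:
  assumes "bounded_clinear f"
  shows "bounded_clinear (\<lambda>x. c *\<^sub>C f x)"
  using bounded_clinear_compose[OF bounded_clinear_scaleC assms] .

lemma bounded_clinear_sub:
  assumes "bounded_clinear f" "bounded_clinear g"
  shows "bounded_clinear (\<lambda>x. f x - g x)"
  using bounded_clinear_plus[OF assms(1) bounded_clinear_scaled[OF assms(2), of "-1"]]
  by (simp add: scaleC_minus_left scaleC_one)

lemma bounded_clinear_mult:
  fixes f :: "'a::complex_normed_vector \<Rightarrow> complex"
  assumes "bounded_clinear f"
  shows "bounded_clinear (\<lambda>x. c * f x)"
  using bounded_clinear_scaled[OF assms, of c] by (simp add: scaleC_complex)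

text \<open>If neither of two separating functionals works for both vectors, each vanishes at the
  other's vector and their sum works.\<close>

lemma functional_nonzero_both:
  fixes x y :: "'a::complex_normed_vector"
  assumes "x \<noteq> 0" "y \<noteq> 0"
  obtains f :: "'a \<Rightarrow> complex" where "bounded_clinear f" "f x \<noteq> 0" "f y \<noteq> 0"
proof -
  obtain f g :: "'a \<Rightarrow> complex" where f: "bounded_clinear f" "f x = 1" and g: "bounded_clinear g" "g y = 1"
    using assms separating_functional by metis
  consider "f y \<noteq> 0" | "g x \<noteq> 0" | "f y = 0" "g x = 0" by blast
  then show thesis
  proof cases
    case 3
    then have "f x + g x \<noteq> 0" "f y + g y \<noteq> 0" using f g by auto
    then show thesis using that[OF bounded_clinear_plus[OF f(1) g(1)]] by blast
  qed (use that f g in auto)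
qed

text \<open>By Baire's theorem one of the closed sets \<open>D n\<close>, which exhaust the space,
  contains a ball; subtracting the value at its centre bounds all of \<open>F\<close> on vectors of
  norm \<open>e\<close>.\<close>

lemma uniform_boundedness:
  fixes F :: "('a::banach \<Rightarrow> 'b::real_normed_vector) set"
  assumes lin: "\<And>f. f \<in> F \<Longrightarrow> bounded_linear f"
    and pw: "\<And>x. \<exists>K. \<forall>f\<in>F. norm (f x) \<le> K"
  obtains K where "K \<ge> 0" "\<And>f x. f \<in> F \<Longrightarrow> norm (f x) \<le> K * norm x"
proof -
  define D where "D n = {x. \<forall>f\<in>F. norm (f x) \<le> real n}" for n
  have closed_D: "closed (D n)" for n
  proof -
    have "closed {x. norm (f x) \<le> real n}" if "f \<in> F" for f
      using lin[OF that]
      by (intro closed_Collect_le continuous_intros linear_continuous_on)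
    moreover have "D n = (\<Inter>f\<in>F. {x. norm (f x) \<le> real n})" by (auto simp: D_def)
    ultimately show ?thesis by (simp add: closed_INT)
  qed
  have "(\<Union>n. D n) = UNIV"
  proof -
    have "\<exists>n. x \<in> D n" for x
    proof -
      obtain K where K: "\<forall>f\<in>F. norm (f x) \<le> K" using pw by blast
      obtain n where "K \<le> real n" using real_arch_simple by blast
      with K show ?thesis by (auto simp: D_def intro: order_trans)
    qed
    then show ?thesis by blast
  qed
  then have ne: "interior (\<Union>(range D)) \<noteq> {}" by simp
  have "\<exists>n. interior (D n) \<noteq> {}"
  proof (rule ccontr)
    assume "\<nexists>n. interior (D n) \<noteq> {}"
    then have "Met_TC.mtopology interior_of \<Union>(range D) = {}"
      using closed_D
      by (intro Met_TC.metric_Baire_category_alt)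
        (auto simp: mcomplete_iff_complete complete_UNIV)
    with ne show False by simp
  qed
  then obtain n x0 e where e: "e > 0" "cball x0 e \<subseteq> D n"
    by (metis all_not_in_conv mem_interior_cball)
  show thesis
  proof
    show "0 \<le> 2 * real n / e" using e by simp
    fix f x assume f: "f \<in> F"
    interpret bounded_linear f using lin f .
    show "norm (f x) \<le> (2 * real n / e) * norm x"
    proof (cases "x = 0")
      case False
      define y where "y = (e / norm x) *\<^sub>R x"
      have "norm y = e" using e False by (simp add: y_def)
      then have "x0 + y \<in> D n" "x0 \<in> D n" using e by (auto simp: subset_iff dist_norm)
      then have "norm (f (x0 + y)) \<le> n" "norm (f x0) \<le> n" using f by (auto simp: D_def)
      then have "norm (f (x0 + y) - f x0) \<le> 2 * real n"
        using norm_triangle_ineq4[of "f (x0 + y)" "f x0"] by linarith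
      then have "e / norm x * norm (f x) \<le> 2 * real n" using e by (simp add: add y_def scaleR)
      with False e show ?thesis by (simp add: field_simps)
    qed (simp add: zero)
  qed
qed

text \<open>The vectors of \<open>Y\<close> act by evaluation on the real dual, which is always
  complete, and uniform boundedness is applied there. \<open>complex_extension\<close> carries the
  assumption over from complex to real functionals.\<close>

lemma weakly_bounded_imp_bounded:
  fixes Y :: "'a::complex_normed_vector set"
  assumes pw: "\<And>g :: 'a \<Rightarrow> complex. bounded_clinear g \<Longrightarrow> \<exists>K. \<forall>y\<in>Y. cmod (g y) \<le> K"
  obtains K where "K \<ge> 0" "\<And>y. y \<in> Y \<Longrightarrow> norm y \<le> K"
proof -
  define F where "F = (\<lambda>y (b :: 'a \<Rightarrow>\<^sub>L real). blinfun_apply b y) ` Y"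
  have "bounded_linear f" if "f \<in> F" for f
    using that by (auto simp: F_def intro: bounded_linear_intros)
  moreover have "\<exists>K. \<forall>f\<in>F. norm (f b) \<le> K" for b
  proof -
    define g where "g = (\<lambda>x. Complex (b x) (- b (\<i> *\<^sub>C x)))"
    have lin: "linear (blinfun_apply b)"
      using bounded_linear.linear[OF blinfun.bounded_linear_right] .
    have bd: "b x \<le> norm x * norm b" for x
      using norm_blinfun[of b x] by (simp add: mult.commute)
    have "bounded_clinear g" "\<And>x. Re (g x) = b x"
      unfolding g_def using complex_extension[OF lin bd] by auto
    moreover obtain K where "\<forall>y\<in>Y. cmod (g y) \<le> K" using pw calculation(1) by blast
    ultimately have "\<forall>y\<in>Y. norm (b y) \<le> K"
      by (metis abs_Re_le_cmod order_trans real_norm_def)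
    then show ?thesis by (auto simp: F_def)
  qed
  ultimately obtain K where K: "K \<ge> 0" "\<And>f x. f \<in> F \<Longrightarrow> norm (f x) \<le> K * norm x"
    using uniform_boundedness[of F] by metis
  show thesis
  proof
    fix y assume y: "y \<in> Y"
    \<comment> \<open>Testing on a functional of norm at most one that attains \<open>norm y\<close>
      turns the bound on evaluations into a bound on \<open>y\<close>.\<close>
    obtain u :: "'a \<Rightarrow> real" where u: "linear u" "\<And>x. u x \<le> norm x" "u y = norm y"
      using real_norming_functional by blast
    have ab: "\<bar>u x\<bar> \<le> norm x * 1" for x
      using u(2)[of x] u(2)[of "-x"] linear_neg[OF u(1), of x] by simp
    then have bl: "bounded_linear u"
      using u(1) by (intro bounded_linear_intro[where K = 1]) (auto simp: linear_add linear_scale)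
    define b where "b = Blinfun u"
    have b: "blinfun_apply b = u" using bl by (simp add: b_def bounded_linear_Blinfun_apply)
    have "norm b \<le> 1" using ab by (intro norm_blinfun_bound) (auto simp: b)
    moreover have "norm (b y) \<le> K * norm b" using K(2) y by (auto simp: F_def)
    ultimately show "norm y \<le> K" using u(3) K(1) b
      by (metis abs_norm_cancel mult.right_neutral mult_left_mono order_trans real_norm_def)
  qed (rule K(1))
qed

section \<open>Spectra of bounded operators\<close>

lemma invertible_opI:
  assumes "bounded_clinear T" "bounded_clinear S" "\<And>x. S (T x) = x" "\<And>y. T (S y) = y"
  shows "invertible_op T"
  using assms by (auto simp: invertible_op_def)

lemma not_in_spectrumE:
  assumes "z \<notin> op_spectrum T"
  obtains Q where "bounded_clinear Q" "\<And>x. Q (T x - z *\<^sub>C x) = x" "\<And>x. T (Q x) - z *\<^sub>C Q x = x"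
  using assms by (auto simp: op_spectrum_def invertible_op_def)

lemma not_in_spectrumI:
  assumes "bounded_clinear T" "bounded_clinear Q"
    "\<And>x. Q (T x - z *\<^sub>C x) = x" "\<And>x. T (Q x) - z *\<^sub>C Q x = x"
  shows "z \<notin> op_spectrum T"
  using assms(3,4) bounded_clinear_sub[OF assms(1) bounded_clinear_scaleC] assms(2)
  by (auto simp: op_spectrum_def intro!: invertible_opI)

lemma eigenvalue_in_spectrum:
  assumes "T v = z *\<^sub>C v" "v \<noteq> 0"
  shows "z \<in> op_spectrum T"
proof (rule ccontr)
  assume "z \<notin> op_spectrum T"
  then obtain Q where "bounded_clinear Q" "\<And>x. Q (T x - z *\<^sub>C x) = x"
    by (rule not_in_spectrumE) blast
  with assms show False by (metis bounded_clinear_zero cancel_comm_monoid_add_class.diff_cancel)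
qed

text \<open>Jacobson's identity: with \<open>Q\<close> the inverse of \<open>CD - z\<close>, the
  inverse of \<open>DC - z\<close> is \<open>(DQC - 1) / z\<close>.\<close>

lemma spectrum_commute_aux:
  assumes C: "bounded_clinear C" and D: "bounded_clinear D" and z: "z \<noteq> 0" "z \<notin> op_spectrum (C \<circ> D)"
  shows "z \<notin> op_spectrum (D \<circ> C)"
proof -
  obtain Q where Q: "bounded_clinear Q" and q1: "\<And>x. Q (C (D x) - z *\<^sub>C x) = x"
    and q2: "\<And>x. C (D (Q x)) - z *\<^sub>C Q x = x"
    using z(2) by (rule not_in_spectrumE) auto
  define R where "R x = inverse z *\<^sub>C (D (Q (C x)) - x)" for x
  have R: "bounded_clinear R"
    unfolding R_def
    by (intro bounded_clinear_scaled bounded_clinear_sub bounded_clinear_id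
        bounded_clinear_compose[OF D] bounded_clinear_compose[OF Q] C)
  have DC: "bounded_clinear (D \<circ> C)" unfolding o_def by (rule bounded_clinear_compose[OF D C])
  note lin = bounded_clinear_diff[OF C] bounded_clinear_diff[OF D] bounded_clinear_diff[OF Q]
    bounded_clinear_scale[OF C] bounded_clinear_scale[OF D] bounded_clinear_scale[OF Q]
  show ?thesis
  proof (rule not_in_spectrumI[OF DC R])
    fix x
    have 1: "D (C x) - z *\<^sub>C D (Q (C x)) = D (C x) - D (z *\<^sub>C Q (C x))" by (simp add: lin)
    have q1': "Q (C (D y)) - z *\<^sub>C Q y = y" for y using q1[of y] by (simp add: lin)
    have "D (Q (C (D (C x)))) = D (C x) + z *\<^sub>C D (Q (C x))"
      using arg_cong[OF q1'[of "C x"], of D] by (simp add: lin algebra_simps)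
    then have "D (Q (C (D (C x) - z *\<^sub>C x))) - (D (C x) - z *\<^sub>C x) = z *\<^sub>C x"
      by (simp add: lin)
    then show "R ((D \<circ> C) x - z *\<^sub>C x) = x" using z(1)
      by (simp add: R_def scaleC_scaleC scaleC_one)
    have "D (C (D (Q (C x)))) = D (C x) + z *\<^sub>C D (Q (C x))"
      using arg_cong[OF q2[of "C x"], of D] by (simp add: lin algebra_simps)
    then show "(D \<circ> C) (R x) - z *\<^sub>C R x = x" using z(1)
      by (simp add: R_def scaleC_scaleC scaleC_one lin flip: cvs.scale_right_diff_distrib)
  qed
qed

lemma spectrum_commute:
  assumes "bounded_clinear C" "bounded_clinear D"
  shows "op_spectrum (C \<circ> D) - {0} = op_spectrum (D \<circ> C) - {0}"
  using spectrum_commute_aux[OF assms] spectrum_commute_aux[OF assms(2,1)] by auto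

text \<open>An everywhere defined resolvent would be weakly entire and vanish at infinity, so
  Liouville's theorem makes \<open>R 0 x\<close> zero, although \<open>T\<close> maps it to
  \<open>x\<close>.\<close>

lemma spectrum_nonempty:
  fixes T :: "'a::complex_normed_vector \<Rightarrow> 'a"
  assumes T: "bounded_clinear T" and x: "(x :: 'a) \<noteq> 0"
  shows "op_spectrum T \<noteq> {}"
proof
  assume "op_spectrum T = {}"
  then have "\<forall>z. \<exists>Q. bounded_clinear Q \<and> (\<forall>x. Q (T x - z *\<^sub>C x) = x) \<and> (\<forall>x. T (Q x) - z *\<^sub>C Q x = x)"
    by (metis empty_iff not_in_spectrumE)
  then obtain R where R: "\<And>z. bounded_clinear (R z)" and r1: "\<And>z x. R z (T x - z *\<^sub>C x) = x"
    and r2: "\<And>z x. T (R z x) - z *\<^sub>C R z x = x" by metis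
  note lin = bounded_clinear_diff[OF R] bounded_clinear_scale[OF R]
  have res: "R z v - R w v = (z - w) *\<^sub>C R z (R w v)" for z w v
  proof -
    have "R z v = R z (T (R w v) - w *\<^sub>C R w v)" by (simp add: r2)
    moreover have "R w v = R z (T (R w v) - z *\<^sub>C R w v)" by (simp add: r1)
    ultimately have "R z v - R w v = R z ((T (R w v) - w *\<^sub>C R w v) - (T (R w v) - z *\<^sub>C R w v))"
      by (metis lin(1))
    then show ?thesis by (simp add: lin cvs.scale_left_diff_distrib)
  qed
  have vanish: "f (R 0 x) = 0" if f: "bounded_clinear f" for f :: "'a \<Rightarrow> complex"
  proof -
    define \<phi> where "\<phi> z = f (R z x)" for z
    obtain L where L: "L > 0" "\<And>x. cmod (f x) \<le> norm x * L" using bounded_clinear_bound[OF f] by blast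
    have diff: "(\<phi> has_field_derivative f (R w (R w x))) (at w)" for w
    proof -
      obtain K where K: "K > 0" "\<And>v. norm (R w v) \<le> norm v * K" using bounded_clinear_bound[OF R] by blast
      \<comment> \<open>Near \<open>w\<close> the resolvent identity expresses \<open>R z v\<close>
        through itself with a factor of at most one half, which can be absorbed on the left.\<close>
      have bd: "norm (R z v) \<le> 2 * (norm v * K)" if "cmod (z - w) < 1 / (2 * K)" for z v
      proof -
        have "R z v = R w v + (z - w) *\<^sub>C R w (R z v)"
          using res[of w v z] by (simp add: algebra_simps cvs.scale_left_diff_distrib)
        then have "norm (R z v) \<le> norm (R w v) + cmod (z - w) * norm (R w (R z v))"
          by (metis norm_scaleC norm_triangle_ineq)
        also have "\<dots> \<le> norm v * K + 1 / (2 * K) * (norm (R z v) * K)"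
          using that K by (intro add_mono mult_mono) auto
        also have "1 / (2 * K) * (norm (R z v) * K) = norm (R z v) / 2" using K by simp
        finally show ?thesis by simp
      qed
      \<comment> \<open>By the resolvent identity \<open>\<psi>\<close> is the difference quotient
        of \<open>\<phi>\<close> at \<open>w\<close>, so only its continuity at \<open>w\<close>
        remains to be shown.\<close>
      define \<psi> where "\<psi> z = f (R z (R w x))" for z
      define c where "c = 2 * (norm (R w (R w x)) * K) * L"
      have "((\<lambda>z. \<psi> z - \<psi> w) \<longlongrightarrow> 0) (at w)"
      proof (rule Lim_null_comparison)
        have "eventually (\<lambda>z. cmod (z - w) < 1 / (2 * K)) (at w)"
          using K by (auto simp: eventually_at dist_norm intro!: exI[of _ "1 / (2 * K)"])
        then show "eventually (\<lambda>z. cmod (\<psi> z - \<psi> w) \<le> cmod (z - w) * c) (at w)"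
        proof eventually_elim
          case (elim z)
          have "\<psi> z - \<psi> w = (z - w) * f (R z (R w (R w x)))"
            using res[of z "R w x" w]
            by (simp add: \<psi>_def flip: bounded_clinear_diff[OF f])
              (simp add: bounded_clinear_scale[OF f] scaleC_complex)
          moreover have "cmod (f (R z (R w (R w x)))) \<le> c"
            unfolding c_def using L(2) bd[OF elim] L(1) by (meson mult_right_mono order_trans less_imp_le)
          ultimately show ?case by (simp add: norm_mult mult_left_mono)
        qed
        have "((\<lambda>z. cmod (z - w) * c) \<longlongrightarrow> cmod (w - w) * c) (at w)" by (intro tendsto_intros)
        then show "((\<lambda>z. cmod (z - w) * c) \<longlongrightarrow> 0) (at w)" by simp
      qed
      then have "(\<psi> \<longlongrightarrow> \<psi> w) (at w)" by (simp add: LIM_zero_iff)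
      moreover have "(\<phi> z - \<phi> w) / (z - w) = \<psi> z" if "z \<noteq> w" for z
        using that res[of z x w]
        by (simp add: \<phi>_def \<psi>_def flip: bounded_clinear_diff[OF f])
          (simp add: bounded_clinear_scale[OF f] scaleC_complex)
      then have "eventually (\<lambda>z. \<psi> z = (\<phi> z - \<phi> w) / (z - w)) (at w)"
        by (simp add: eventually_at_filter)
      ultimately have "((\<lambda>z. (\<phi> z - \<phi> w) / (z - w)) \<longlongrightarrow> \<psi> w) (at w)"
        by (rule Lim_transform_eventually)
      then show ?thesis by (simp add: has_field_derivative_iff \<psi>_def)
    qed
    have "\<phi> holomorphic_on UNIV"
      by (meson diff UNIV_I field_differentiable_def field_differentiable_at_within holomorphic_onI)
    moreover have "(\<phi> \<longlongrightarrow> 0) at_infinity"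
    proof (rule Lim_null_comparison)
      obtain K where K: "K > 0" "\<And>v. norm (T v) \<le> norm v * K" using bounded_clinear_bound[OF T] by blast
      have "eventually (\<lambda>z. 2 * K \<le> cmod z) at_infinity"
        by (auto simp: eventually_at_infinity)
      then show "eventually (\<lambda>z. cmod (\<phi> z) \<le> (2 * norm x * L) * cmod (inverse z)) at_infinity"
      proof eventually_elim
        case (elim z)
        have "cmod z * norm (R z x) = norm (T (R z x) - x)"
          using r2[of z x] by (metis norm_scaleC add_diff_cancel_left' diff_add_cancel)
        also have "\<dots> \<le> norm (R z x) * K + norm x"
          using K(2)[of "R z x"] norm_triangle_ineq4[of "T (R z x)" x] by linarith
        also have "norm (R z x) * K \<le> norm (R z x) * (cmod z / 2)"
          using elim by (intro mult_left_mono) auto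
        finally have "cmod z * norm (R z x) \<le> 2 * norm x"
          by (simp add: mult.commute)
        moreover have "cmod z > 0" using elim K(1) by linarith
        ultimately have "norm (R z x) \<le> 2 * norm x / cmod z"
          by (simp add: field_simps del: zero_less_norm_iff)
        then have "norm (R z x) \<le> 2 * norm x * cmod (inverse z)"
          by (simp add: norm_inverse divide_inverse)
        then have "norm (R z x) * L \<le> 2 * norm x * cmod (inverse z) * L"
          using L(1) by simp
        with L(2)[of "R z x"] show ?case by (simp add: \<phi>_def mult_ac)
      qed
      have "((\<lambda>z::complex. (2 * norm x * L) * cmod (inverse z)) \<longlongrightarrow> (2 * norm x * L) * 0) at_infinity"
        by (intro tendsto_intros tendsto_norm_zero tendsto_inverse_0)
      then show "((\<lambda>z::complex. (2 * norm x * L) * cmod (inverse z)) \<longlongrightarrow> 0) at_infinity" by simp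
    qed
    ultimately have "\<phi> 0 = 0" by (rule Liouville_weak_0)
    then show ?thesis by (simp add: \<phi>_def)
  qed
  have "R 0 x = 0"
    by (rule functionals_separate) (simp add: vanish bounded_clinear_zero)
  with r2[of 0 x] bounded_clinear_zero[OF T] x show False by simp
qed

text \<open>For large \<open>z\<close> the equation \<open>T v - z v = w\<close> is a contraction fixed point problem in \<open>v\<close>.\<close>

lemma spectrum_bounded:
  fixes T :: "'a::{complex_normed_vector, banach} \<Rightarrow> 'a"
  assumes T: "bounded_clinear T"
  obtains K where "\<And>z. z \<in> op_spectrum T \<Longrightarrow> cmod z \<le> K"
proof -
  obtain K where K: "K > 0" "\<And>v. norm (T v) \<le> norm v * K" using bounded_clinear_bound[OF T] by blast
  note lin = bounded_clinear_add[OF T] bounded_clinear_diff[OF T] bounded_clinear_scale[OF T]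
  have "z \<notin> op_spectrum T" if z: "cmod z > K" for z
  proof -
    have z0: "z \<noteq> 0" using z K(1) by auto
    have eq: "T v - z *\<^sub>C v = w \<longleftrightarrow> inverse z *\<^sub>C (T v - w) = v" for v w
    proof
      assume "T v - z *\<^sub>C v = w"
      then have "T v - w = z *\<^sub>C v" by (simp add: algebra_simps)
      then show "inverse z *\<^sub>C (T v - w) = v" using z0 by (simp add: scaleC_scaleC scaleC_one)
    next
      assume "inverse z *\<^sub>C (T v - w) = v"
      then have "z *\<^sub>C v = z *\<^sub>C inverse z *\<^sub>C (T v - w)" by simp
      also have "\<dots> = T v - w" using z0 by (simp add: scaleC_scaleC scaleC_one)
      finally show "T v - z *\<^sub>C v = w" by simp
    qed
    have ex: "\<exists>!v. T v - z *\<^sub>C v = w" for w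
      unfolding eq
    proof (rule banach_fix_type[of "K / cmod z"])
      show "\<forall>v v'. dist (inverse z *\<^sub>C (T v - w)) (inverse z *\<^sub>C (T v' - w)) \<le> K / cmod z * dist v v'"
      proof (intro allI)
        fix v v'
        have "inverse z *\<^sub>C (T v - w) - inverse z *\<^sub>C (T v' - w) = inverse z *\<^sub>C T (v - v')"
          by (simp add: lin cvs.scale_right_diff_distrib)
        then have "dist (inverse z *\<^sub>C (T v - w)) (inverse z *\<^sub>C (T v' - w)) = norm (T (v - v')) / cmod z"
          by (simp add: dist_norm norm_scaleC norm_inverse divide_inverse mult.commute)
        also have "\<dots> \<le> norm (v - v') * K / cmod z" by (intro divide_right_mono K) auto
        finally show "dist (inverse z *\<^sub>C (T v - w)) (inverse z *\<^sub>C (T v' - w)) \<le> K / cmod z * dist v v'"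
          by (simp add: dist_norm mult.commute)
      qed
    qed (use z K(1) in \<open>auto simp: divide_less_eq\<close>)
    define Q where "Q w = (THE v. T v - z *\<^sub>C v = w)" for w
    have q2: "T (Q w) - z *\<^sub>C Q w = w" for w unfolding Q_def by (rule theI'[OF ex])
    have uniq: "v = Q w" if "T v - z *\<^sub>C v = w" for v w using ex[of w] that q2 by blast
    have "bounded_clinear Q"
    proof (rule bounded_clinearI[where K = "1 / (cmod z - K)"])
      show "Q (x + y) = Q x + Q y" for x y
        using q2[of x] q2[of y]
        by (intro uniq[symmetric]) (simp add: lin cvs.scale_right_distrib algebra_simps)
      show "Q (c *\<^sub>C x) = c *\<^sub>C Q x" for c x
      proof (intro uniq[symmetric])
        have "c *\<^sub>C (T (Q x) - z *\<^sub>C Q x) = c *\<^sub>C x" by (simp add: q2)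
        then show "T (c *\<^sub>C Q x) - z *\<^sub>C c *\<^sub>C Q x = c *\<^sub>C x"
          by (simp add: lin cvs.scale_right_diff_distrib scaleC_scaleC mult.commute)
      qed
      show "norm (Q x) \<le> norm x * (1 / (cmod z - K))" for x
      proof -
        have "cmod z * norm (Q x) = norm (T (Q x) - x)"
          using q2[of x] by (metis norm_scaleC add_diff_cancel_left' diff_add_cancel)
        also have "\<dots> \<le> norm (Q x) * K + norm x"
          using K(2)[of "Q x"] norm_triangle_ineq4[of "T (Q x)" x] by linarith
        finally show ?thesis using z by (simp add: field_simps)
      qed
    qed
    then show ?thesis by (rule not_in_spectrumI[OF T]) (simp_all add: q2 uniq[symmetric])
  qed
  then show thesis by (metis not_le_imp_less that)
qed

text \<open>The point zero cannot matter: without nonzero points both spectra, being nonempty, equal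
  \<open>{0}\<close>; otherwise the radius is positive and zero is not peripheral. On the zero space
  the two operators coincide.\<close>

lemma peripheral_spectrum_eqI:
  fixes S T :: "'a::{complex_normed_vector, banach} \<Rightarrow> 'a"
  assumes S: "bounded_clinear S" and T: "bounded_clinear T"
    and eq: "op_spectrum S - {0} = op_spectrum T - {0}"
  shows "peripheral_spectrum S = peripheral_spectrum T"
proof (cases "\<exists>x::'a. x \<noteq> 0")
  case False
  then have "S = T" by (metis ext)
  then show ?thesis by simp
next
  case True
  then have ne: "op_spectrum S \<noteq> {}" "op_spectrum T \<noteq> {}"
    using spectrum_nonempty S T by blast+
  show ?thesis
  proof (cases "op_spectrum S - {0} = {}")
    case True
    then have "op_spectrum S = op_spectrum T" using ne eq by auto
    then show ?thesis by (simp add: peripheral_spectrum_def op_spectral_radius_def)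
  next
    case False
    then obtain w where w: "w \<in> op_spectrum S" "w \<in> op_spectrum T" "w \<noteq> 0" using eq by auto
    have bdd: "bdd_above (cmod ` op_spectrum S)" "bdd_above (cmod ` op_spectrum T)"
      using spectrum_bounded[OF S] spectrum_bounded[OF T] by (metis bdd_aboveI2)+
    have le: "op_spectral_radius U \<le> op_spectral_radius V"
      if UV: "op_spectrum U - {0} = op_spectrum V - {0}" and w: "w \<in> op_spectrum U"
        and bdd: "bdd_above (cmod ` op_spectrum V)" for U V :: "'a \<Rightarrow> 'a"
      unfolding op_spectral_radius_def
    proof (rule cSUP_least)
      fix z assume z: "z \<in> op_spectrum U"
      have "cmod v \<le> Sup (cmod ` op_spectrum V)" if "v \<in> op_spectrum U" "v \<noteq> 0" for v
        using that UV bdd by (intro cSUP_upper) auto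
      from this[OF z] this[OF w \<open>w \<noteq> 0\<close>] show "cmod z \<le> Sup (cmod ` op_spectrum V)"
        by (cases "z = 0") (auto intro: order_trans[OF norm_ge_zero])
    qed (use w in auto)
    have rad: "op_spectral_radius S = op_spectral_radius T"
      using le[OF eq w(1) bdd(2)] le[OF eq[symmetric] w(2) bdd(1)] by simp
    have "cmod w \<le> op_spectral_radius S"
      unfolding op_spectral_radius_def using w bdd by (intro cSUP_upper) auto
    then have "op_spectral_radius S > 0" using w(3) by (meson less_le_trans zero_less_norm_iff)
    then have "(z \<in> op_spectrum S \<and> cmod z = op_spectral_radius S) \<longleftrightarrow>
        (z \<in> op_spectrum T \<and> cmod z = op_spectral_radius S)" for z
      using eq by (cases "z = 0") auto
    with rad show ?thesis by (simp add: peripheral_spectrum_def)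
  qed
qed

lemma peripheral_spectrum_commute:
  fixes C D :: "'a::{complex_normed_vector, banach} \<Rightarrow> 'a"
  assumes "bounded_clinear C" "bounded_clinear D"
  shows "peripheral_spectrum (C \<circ> D) = peripheral_spectrum (D \<circ> C)"
  using assms
  by (intro peripheral_spectrum_eqI spectrum_commute)
    (auto simp: o_def intro: bounded_clinear_compose)

section \<open>Powers and the reduction to a one-sided product\<close>

lemma bounded_clinear_funpow:
  fixes B :: "'a::complex_normed_vector \<Rightarrow> 'a"
  assumes "bounded_clinear B"
  shows "bounded_clinear (B ^^ n)"
proof (induction n)
  case 0
  show ?case by (simp add: bounded_clinear_id id_def)
next
  case (Suc n)
  then show ?case using bounded_clinear_compose[OF assms] by (simp add: o_def)
qed

lemma peripheral_spectrum_product: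
  fixes A B :: "'a::{complex_normed_vector, banach} \<Rightarrow> 'a"
  assumes A: "bounded_clinear A" and B: "bounded_clinear B"
  shows "peripheral_spectrum ((B ^^ r) \<circ> A \<circ> (B ^^ s)) = peripheral_spectrum (A \<circ> (B ^^ (r + s)))"
proof -
  have "peripheral_spectrum ((B ^^ r) \<circ> (A \<circ> (B ^^ s))) = peripheral_spectrum ((A \<circ> (B ^^ s)) \<circ> (B ^^ r))"
    using bounded_clinear_compose[OF A bounded_clinear_funpow[OF B, of s]]
    by (intro peripheral_spectrum_commute bounded_clinear_funpow B) (simp add: o_def)
  then show ?thesis by (simp add: comp_assoc add.commute flip: funpow_add)
qed

section \<open>Peripheral spectra of rank-one operators and of operators equal to their cube\<close>

definition rank_one :: "'a::complex_vector \<Rightarrow> ('a \<Rightarrow> complex) \<Rightarrow> 'a \<Rightarrow> 'a" where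
  "rank_one x f = (\<lambda>v. f v *\<^sub>C x)"

lemma bounded_clinear_functional_scaleC:
  assumes "bounded_clinear f"
  shows "bounded_clinear (\<lambda>v. f v *\<^sub>C x)"
proof -
  obtain K where K: "\<And>v. norm (f v) \<le> norm v * K" using bounded_clinear_bound[OF assms] by blast
  show ?thesis
  proof (rule bounded_clinearI[where K = "K * norm x"])
    show "norm (f v *\<^sub>C x) \<le> norm v * (K * norm x)" for v
      using mult_right_mono[OF K[of v], of "norm x"] by (simp add: norm_scaleC mult.assoc)
  qed (simp_all add: bounded_clinear_add[OF assms] bounded_clinear_scale[OF assms] scaleC_complex
      scaleC_add_left scaleC_scaleC)
qed

lemma bounded_clinear_rank_one: "bounded_clinear f \<Longrightarrow> bounded_clinear (rank_one x f)"
  unfolding rank_one_def by (rule bounded_clinear_functional_scaleC)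

text \<open>Only \<open>0\<close> and \<open>f x\<close> can be spectral. If \<open>f x\<close> is
  nonzero then \<open>x\<close> is an eigenvector for it; if it is zero, nonemptiness of the
  spectrum leaves no other point.\<close>

lemma peripheral_spectrum_rank_one:
  fixes x :: "'a::{complex_normed_vector, banach}"
  assumes f: "bounded_clinear f" and nt: "\<exists>y::'a. y \<noteq> 0"
  shows "peripheral_spectrum (rank_one x f) = {f x}"
proof -
  have sub: "op_spectrum (rank_one x f) \<subseteq> {0, f x}"
  proof (rule ccontr)
    assume "\<not> ?thesis"
    then obtain z where z: "z \<in> op_spectrum (rank_one x f)" "z \<noteq> 0" "z \<noteq> f x" by auto
    \<comment> \<open>The Sherman-Morrison formula for the inverse of a rank-one perturbation of
      \<open>- z\<close>.\<close>
    define Q where "Q w = inverse z *\<^sub>C ((f w / (f x - z)) *\<^sub>C x - w)" for w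
    have d: "f x - z \<noteq> 0" using z by simp
    have "bounded_clinear (\<lambda>w. inverse (f x - z) * f w)" by (rule bounded_clinear_mult[OF f])
    then have "bounded_clinear (\<lambda>w. f w / (f x - z))" by (simp add: divide_inverse mult.commute)
    then have Q: "bounded_clinear Q"
      unfolding Q_def
      by (intro bounded_clinear_scaled bounded_clinear_sub bounded_clinear_id
          bounded_clinear_functional_scaleC)
    have "z \<notin> op_spectrum (rank_one x f)"
    proof (rule not_in_spectrumI[OF bounded_clinear_rank_one[OF f] Q])
      note lin = bounded_clinear_diff[OF f] bounded_clinear_scale[OF f]
      fix w
      have "f (f w *\<^sub>C x - z *\<^sub>C w) / (f x - z) = f w"
        using d by (simp add: lin scaleC_complex field_simps)
      then show "Q (rank_one x f w - z *\<^sub>C w) = w"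
        using z(2) by (simp add: Q_def rank_one_def scaleC_scaleC scaleC_one)
      have "f (Q w) = f w / (f x - z)"
        using d z(2) by (simp add: Q_def lin scaleC_complex field_simps)
      then show "rank_one x f (Q w) - z *\<^sub>C Q w = w"
        using z(2) by (simp add: rank_one_def) (simp add: Q_def scaleC_scaleC scaleC_one)
    qed
    with z(1) show False by simp
  qed
  obtain y :: 'a where y: "y \<noteq> 0" using nt by blast
  have ne: "op_spectrum (rank_one x f) \<noteq> {}"
    using spectrum_nonempty[OF bounded_clinear_rank_one[OF f] y] .
  have fx: "f x \<in> op_spectrum (rank_one x f)"
  proof (cases "f x = 0")
    case True
    then show ?thesis using sub ne by auto
  next
    case False
    then have "x \<noteq> 0" using bounded_clinear_zero[OF f] by auto
    then show ?thesis by (intro eigenvalue_in_spectrum[of _ x]) (auto simp: rank_one_def)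
  qed
  have "op_spectral_radius (rank_one x f) = cmod (f x)"
    unfolding op_spectral_radius_def using fx sub by (intro cSup_eq_maximum) auto
  then show ?thesis using fx sub by (auto simp: peripheral_spectrum_def)
qed

text \<open>An operator with \<open>K^3 = K\<close> has its spectrum in \<open>{0, 1, - 1}\<close>;
  two eigenvectors make both unimodular points occur.\<close>

lemma peripheral_spectrum_cube_eq:
  assumes K: "bounded_clinear K" and cube: "\<And>v. K (K (K v)) = K v"
    and ev: "K v = v" "v \<noteq> 0" "K w = - w" "w \<noteq> 0"
  shows "1 \<in> peripheral_spectrum K" "- 1 \<in> peripheral_spectrum K"
proof -
  have "z \<notin> op_spectrum K" if z: "z \<noteq> 0" "z \<noteq> 1" "z \<noteq> - 1" for z
  proof -
    have "z\<^sup>2 \<noteq> 1" using z by (simp add: power2_eq_1_iff)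
    then have d: "1 - z\<^sup>2 \<noteq> 0" by simp
    \<comment> \<open>The inverse of \<open>K - z\<close> is sought as a quadratic polynomial in
      \<open>K\<close>. After replacing \<open>K^3\<close> by \<open>K\<close>, the vanishing of the
      coefficient of \<open>K\<close> is the equation \<open>a (1 - z^2) = 1 / z\<close>.\<close>
    define a where "a = 1 / (z * (1 - z\<^sup>2))"
    define Q where "Q x = a *\<^sub>C K (K x) + (z * a) *\<^sub>C K x - inverse z *\<^sub>C x" for x
    have Q: "bounded_clinear Q"
      unfolding Q_def
      by (intro bounded_clinear_sub bounded_clinear_plus bounded_clinear_scaled bounded_clinear_compose[OF K]
          K bounded_clinear_id)
    note lin = bounded_clinear_add[OF K] bounded_clinear_diff[OF K] bounded_clinear_scale[OF K]
    have a: "a - inverse z - z * (z * a) = 0"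
      using z d by (simp add: a_def divide_simps) (simp add: power2_eq_square algebra_simps)
    have key: "(a *\<^sub>C K v + (z * a) *\<^sub>C K (K v) - inverse z *\<^sub>C K v)
        - (z *\<^sub>C (a *\<^sub>C K (K v)) + z *\<^sub>C ((z * a) *\<^sub>C K v) - v) = v" for v
    proof -
      have "(a *\<^sub>C K v + (z * a) *\<^sub>C K (K v) - inverse z *\<^sub>C K v)
        - (z *\<^sub>C (a *\<^sub>C K (K v)) + z *\<^sub>C ((z * a) *\<^sub>C K v) - v)
        = (a - inverse z - z * (z * a)) *\<^sub>C K v + v"
        by (simp add: scaleC_scaleC cvs.scale_left_diff_distrib)
      with a show ?thesis by simp
    qed
    show ?thesis
    proof (rule not_in_spectrumI[OF K Q])
      fix x
      show "Q (K x - z *\<^sub>C x) = x" "K (Q x) - z *\<^sub>C Q x = x"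
        using key[of x] z(1)
        by (simp_all add: Q_def lin cube cvs.scale_right_distrib cvs.scale_right_diff_distrib
            scaleC_scaleC scaleC_one mult_ac) (simp add: algebra_simps)
    qed
  qed
  then have sub: "op_spectrum K \<subseteq> {0, 1, - 1}" by auto
  have one: "1 \<in> op_spectrum K" using ev by (intro eigenvalue_in_spectrum[of K v]) (auto simp: scaleC_one)
  have mone: "- 1 \<in> op_spectrum K"
    using ev by (intro eigenvalue_in_spectrum[of K w]) (auto simp: scaleC_one scaleC_minus_left)
  have "op_spectral_radius K = 1"
    unfolding op_spectral_radius_def
  proof (rule cSup_eq_maximum)
    show "1 \<in> cmod ` op_spectrum K" using one by force
  qed (use sub in auto)
  then show "1 \<in> peripheral_spectrum K" "- 1 \<in> peripheral_spectrum K"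
    using one mone by (auto simp: peripheral_spectrum_def)
qed

section \<open>Operators of rank at least two\<close>

lemma complex_quadratic_root:
  fixes a b c :: complex
  assumes "a \<noteq> 0"
  obtains z where "a * z\<^sup>2 + b * z + c = 0"
proof
  define w where "w = csqrt (b\<^sup>2 - 4 * a * c)"
  have w: "w * w = b * b - 4 * a * c"
    using power2_csqrt[of "b\<^sup>2 - 4 * a * c"] by (simp add: w_def power2_eq_square)
  have "a * ((w - b) / (2 * a))\<^sup>2 + b * ((w - b) / (2 * a)) + c = (w * w - b * b + 4 * a * c) / (4 * a)"
    using assms by (simp add: field_simps power2_eq_square)
  then show "a * ((w - b) / (2 * a))\<^sup>2 + b * ((w - b) / (2 * a)) + c = 0"
    by (simp add: w)
qed

lemma complex_nth_root:
  assumes "n \<ge> 1"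
  obtains w :: complex where "w ^ n = z"
proof (cases "z = 0")
  case True
  with assms that[of 0] show thesis by (simp add: power_0_left)
next
  case False
  have "exp (Ln z / of_nat n) ^ n = exp (of_nat n * (Ln z / of_nat n))"
    by (rule exp_of_nat_mult[symmetric])
  also have "\<dots> = z" using False assms by simp
  finally show thesis by (rule that)
qed

lemma singular_kernel_vector:
  fixes a b c d :: complex
  assumes "a * d = b * c"
  obtains \<alpha> \<beta> where "\<alpha> \<noteq> 0 \<or> \<beta> \<noteq> 0" "a * \<alpha> + b * \<beta> = 0" "c * \<alpha> + d * \<beta> = 0"
proof -
  consider "a = 0" "b = 0" "c = 0" "d = 0" | "a \<noteq> 0 \<or> b \<noteq> 0" | "c \<noteq> 0 \<or> d \<noteq> 0" by blast
  then show thesis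
  proof cases
    case 1 then show thesis using that[of 1 0] by simp
  next
    case 2 then show thesis using that[of b "- a"] assms by (auto simp: algebra_simps)
  next
    case 3 then show thesis using that[of d "- c"] assms by (auto simp: algebra_simps)
  qed
qed

lemma nonsingular_kernel_trivial:
  fixes a b c d :: complex
  assumes "a * d \<noteq> b * c" "a * \<alpha> + b * \<beta> = 0" "c * \<alpha> + d * \<beta> = 0"
  shows "\<alpha> = 0" "\<beta> = 0"
proof -
  have "(a * d - b * c) * \<alpha> = d * (a * \<alpha> + b * \<beta>) - b * (c * \<alpha> + d * \<beta>)"
    "(a * d - b * c) * \<beta> = a * (c * \<alpha> + d * \<beta>) - c * (a * \<alpha> + b * \<beta>)"
    by (simp_all add: algebra_simps)
  then have "(a * d - b * c) * \<alpha> = 0" "(a * d - b * c) * \<beta> = 0" using assms(2,3) by simp_all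
  with assms(1) show "\<alpha> = 0" "\<beta> = 0" by simp_all
qed

text \<open>Compress \<open>A\<close> to a two-dimensional subspace on which it stays invertible and triangularize
  the compression by means of an eigenvector.\<close>

lemma triangular_compression:
  fixes A :: "'a::complex_normed_vector \<Rightarrow> 'a"
  assumes A: "bounded_clinear A"
    and nr: "\<nexists>x f. bounded_clinear f \<and> A = rank_one x f"
  obtains v1 v2 and h1 h2 :: "'a \<Rightarrow> complex" where "bounded_clinear h1" "bounded_clinear h2"
    "h1 v1 = 1" "h1 v2 = 0" "h2 v1 = 0" "h2 v2 = 1"
    "h1 (A v1) \<noteq> 0" "h2 (A v1) = 0" "h2 (A v2) \<noteq> 0"
proof -
  note linA = bounded_clinear_add[OF A] bounded_clinear_diff[OF A] bounded_clinear_scale[OF A]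
    bounded_clinear_zero[OF A]
  have "\<exists>x. A x \<noteq> 0"
  proof (rule ccontr)
    assume "\<nexists>x. A x \<noteq> 0"
    then have "A = rank_one 0 (\<lambda>x. 0)" by (auto simp: rank_one_def)
    with nr bounded_clinear_0 show False by blast
  qed
  then obtain x1 where x1: "A x1 \<noteq> 0" by blast
  then have "x1 \<noteq> 0" using linA by auto
  with x1 obtain f1 :: "'a \<Rightarrow> complex" where f1: "bounded_clinear f1" "f1 x1 \<noteq> 0" "f1 (A x1) \<noteq> 0"
    using functional_nonzero_both by blast
  note lin1 = bounded_clinear_add[OF f1(1)] bounded_clinear_diff[OF f1(1)] bounded_clinear_scale[OF f1(1)]
    scaleC_complex
  have "\<exists>w. A w \<noteq> (f1 (A w) / f1 (A x1)) *\<^sub>C A x1"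
  proof (rule ccontr)
    assume "\<nexists>w. A w \<noteq> (f1 (A w) / f1 (A x1)) *\<^sub>C A x1"
    then have "A = rank_one (A x1) (\<lambda>w. inverse (f1 (A x1)) * f1 (A w))"
      by (auto simp: rank_one_def fun_eq_iff divide_inverse mult.commute)
    moreover have "bounded_clinear (\<lambda>w. inverse (f1 (A x1)) * f1 (A w))"
      by (intro bounded_clinear_mult bounded_clinear_compose[OF f1(1) A])
    ultimately show False using nr by blast
  qed
  then obtain w where w: "A w \<noteq> (f1 (A w) / f1 (A x1)) *\<^sub>C A x1" by blast
  \<comment> \<open>The multiple of \<open>x1\<close> is chosen to get \<open>f1 (A x2) = 0\<close>
    with \<open>A x2\<close> still nonzero, which makes the matrix of the numbers
    \<open>f_i (A x_j)\<close> triangular.\<close>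
  define x2 where "x2 = w - (f1 (A w) / f1 (A x1)) *\<^sub>C x1"
  have x2: "A x2 \<noteq> 0" "f1 (A x2) = 0" using w f1 by (simp_all add: x2_def linA lin1)
  \<comment> \<open>The part of \<open>x2\<close> killed by \<open>f1\<close>. The Gram determinant
    of \<open>f_i (x_j)\<close> is \<open>f1 x1 * f2 x3\<close>, so an \<open>f2\<close> nonzero at
    \<open>x3\<close> and at \<open>A x2\<close> makes the Gram matrix and the matrix of
    \<open>A\<close> nonsingular together.\<close>
  define x3 where "x3 = x2 - (f1 x2 / f1 x1) *\<^sub>C x1"
  have "x3 \<noteq> 0"
  proof
    assume "x3 = 0"
    then have *: "x2 = (f1 x2 / f1 x1) *\<^sub>C x1" by (simp add: x3_def)
    then have "A x2 = (f1 x2 / f1 x1) *\<^sub>C A x1" using linA by metis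
    then show False using x2 f1 by (auto simp: lin1 linA)
  qed
  then obtain f2 :: "'a \<Rightarrow> complex" where f2: "bounded_clinear f2" "f2 x3 \<noteq> 0" "f2 (A x2) \<noteq> 0"
    using functional_nonzero_both x2(1) by blast
  note lin2 = bounded_clinear_add[OF f2(1)] bounded_clinear_diff[OF f2(1)] bounded_clinear_scale[OF f2(1)]
    scaleC_complex
  have "f1 x1 * f2 x3 = f1 x1 * f2 x2 - f1 x2 * f2 x1"
    using f1(2) by (simp add: x3_def lin2 field_simps)
  then have detG: "f1 x1 * f2 x2 \<noteq> f1 x2 * f2 x1" using f1 f2 by (metis eq_iff_diff_eq_0 no_zero_divisors)
  \<comment> \<open>\<open>d\<close> is an eigenvalue of the pencil formed by the matrices of
    \<open>A\<close> and of the identity. The constant term is the determinant for \<open>A\<close>,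
    so \<open>d\<close> is nonzero.\<close>
  obtain d where d: "(f1 x1 * f2 x2 - f1 x2 * f2 x1) * d\<^sup>2
      + (f1 x2 * f2 (A x1) - f1 x1 * f2 (A x2) - f2 x2 * f1 (A x1)) * d + f1 (A x1) * f2 (A x2) = 0"
    using complex_quadratic_root[of "f1 x1 * f2 x2 - f1 x2 * f2 x1"] detG by auto
  have d0: "d \<noteq> 0" using d f1 f2 by auto
  have "(f1 (A x1) - d * f1 x1) * (f2 (A x2) - d * f2 x2)
      = (f1 (A x2) - d * f1 x2) * (f2 (A x1) - d * f2 x1)"
    using d x2(2) by (simp add: power2_eq_square algebra_simps)
  then obtain \<alpha> \<beta> where ab: "\<alpha> \<noteq> 0 \<or> \<beta> \<noteq> 0"
    "(f1 (A x1) - d * f1 x1) * \<alpha> + (f1 (A x2) - d * f1 x2) * \<beta> = 0"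
    "(f2 (A x1) - d * f2 x1) * \<alpha> + (f2 (A x2) - d * f2 x2) * \<beta> = 0"
    by (rule singular_kernel_vector)
  define v1 where "v1 = \<alpha> *\<^sub>C x1 + \<beta> *\<^sub>C x2"
  have ev: "f1 (A v1) = d * f1 v1" "f2 (A v1) = d * f2 v1"
    using ab(2,3) by (simp_all add: v1_def linA lin1 lin2 algebra_simps)
  define u1 u2 where "u1 = f1 v1" and "u2 = f2 v1"
  have u: "u1 \<noteq> 0 \<or> u2 \<noteq> 0"
    using nonsingular_kernel_trivial[OF detG, of \<alpha> \<beta>] ab(1)
    by (auto simp: u1_def u2_def v1_def lin1 lin2 mult_ac)
  define h1 where "h1 v = (if u1 \<noteq> 0 then inverse u1 * f1 v else inverse u2 * f2 v)" for v
  \<comment> \<open>\<open>h2\<close> kills \<open>v1\<close> by construction, and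
    \<open>A v1\<close> because \<open>f1\<close> and \<open>f2\<close> are multiplied by the same
    \<open>d\<close> there.\<close>
  define h2 where "h2 v = u2 * f1 v - u1 * f2 v" for v
  have h1: "bounded_clinear h1"
    unfolding h1_def by (cases "u1 \<noteq> 0") (simp_all add: bounded_clinear_mult f1 f2)
  have h2: "bounded_clinear h2"
    unfolding h2_def by (intro bounded_clinear_sub bounded_clinear_mult f1 f2)
  have v1: "h1 v1 = 1" "h2 v1 = 0" "h1 (A v1) = d" "h2 (A v1) = 0"
    using u by (auto simp: h1_def h2_def ev) (auto simp: u1_def u2_def)
  note linh = bounded_clinear_add[OF h2] bounded_clinear_diff[OF h2] bounded_clinear_scale[OF h2]
    bounded_clinear_diff[OF h1] bounded_clinear_scale[OF h1] scaleC_complex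
  have hA: "h2 (A x1) \<noteq> 0 \<or> h2 (A x2) \<noteq> 0"
    using u f1 f2 x2 by (auto simp: h2_def)
  have hx: "h2 x1 \<noteq> 0 \<or> h2 x2 \<noteq> 0"
  proof (rule ccontr)
    assume "\<not> ?thesis"
    moreover have "f1 x1 * f2 x2 \<noteq> f2 x1 * f1 x2" using detG by (simp add: mult_ac)
    ultimately have "u2 = 0" "- u1 = 0"
      using nonsingular_kernel_trivial[of "f1 x1" "f2 x2" "f2 x1" "f1 x2" u2 "- u1"]
      by (simp_all add: h2_def mult_ac)
    with u show False by simp
  qed
  have e: "\<alpha> * h2 x1 + \<beta> * h2 x2 = 0" "\<alpha> * h2 (A x1) + \<beta> * h2 (A x2) = 0"
    using v1 by (simp_all add: v1_def linA linh)
  \<comment> \<open>The pairs \<open>(h2 x1, h2 x2)\<close> and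
    \<open>(h2 (A x1), h2 (A x2))\<close> are nonzero and satisfy the same linear relation with
    coefficients \<open>\<alpha>\<close>, \<open>\<beta>\<close>; being proportional, they are
    nonzero at a common index.\<close>
  have "\<exists>w. h2 w \<noteq> 0 \<and> h2 (A w) \<noteq> 0"
  proof (cases "h2 x1 = 0")
    case False
    then have "\<beta> \<noteq> 0" using e(1) ab(1) by auto
    then have "h2 (A x1) \<noteq> 0" using e(2) hA by auto
    with False show ?thesis by blast
  next
    case True
    then have "h2 x2 \<noteq> 0" "\<beta> = 0" using hx e(1) by auto
    then have "h2 (A x1) = 0" using e(2) ab(1) by auto
    with hA \<open>h2 x2 \<noteq> 0\<close> show ?thesis by blast
  qed
  then obtain w' where w': "h2 w' \<noteq> 0" "h2 (A w') \<noteq> 0" by blast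
  \<comment> \<open>Removing the component along \<open>v1\<close> does not affect
    \<open>h2 (A v2)\<close>, since \<open>h2 (A v1) = 0\<close>.\<close>
  define v2 where "v2 = inverse (h2 w') *\<^sub>C w' - (inverse (h2 w') * h1 w') *\<^sub>C v1"
  have "h1 v2 = 0" "h2 v2 = 1" "h2 (A v2) \<noteq> 0"
    using w' v1 by (simp_all add: v2_def linA linh)
  with v1 d0 h1 h2 show thesis by (intro that[of h1 h2 v1 v2]) simp_all
qed

text \<open>On \<open>v1\<close>, \<open>v2\<close> the operator \<open>F\<close> is diagonal with
  entries \<open>s\<close>, \<open>t\<close>, tuned so that \<open>A \<circ> (F ^^ n)\<close> has
  eigenvalues \<open>1\<close> and \<open>- 1\<close>. This product maps into the span of
  \<open>A v1\<close>, \<open>A v2\<close> and is triangular with square one there, so it equals its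
  own cube.\<close>

lemma rank_one_characterization:
  fixes A :: "'a::{complex_normed_vector, banach} \<Rightarrow> 'a"
  assumes A: "bounded_clinear A" and n: "n \<ge> 1"
    and nr: "\<nexists>x f. bounded_clinear f \<and> A = rank_one x f"
  obtains F where "bounded_clinear F" "rank_le F 2"
    "1 \<in> peripheral_spectrum (A \<circ> (F ^^ n))" "- 1 \<in> peripheral_spectrum (A \<circ> (F ^^ n))"
proof -
  obtain v1 v2 and h1 h2 :: "'a \<Rightarrow> complex" where h: "bounded_clinear h1" "bounded_clinear h2"
    and v: "h1 v1 = 1" "h1 v2 = 0" "h2 v1 = 0" "h2 v2 = 1"
    and hA: "h1 (A v1) \<noteq> 0" "h2 (A v1) = 0" "h2 (A v2) \<noteq> 0"
    by (rule triangular_compression[OF A nr])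
  obtain s t where s: "s ^ n = inverse (h1 (A v1))" and t: "t ^ n = - inverse (h2 (A v2))"
    by (meson complex_nth_root[OF n])
  define F where "F x = (s * h1 x) *\<^sub>C v1 + (t * h2 x) *\<^sub>C v2" for x
  have F: "bounded_clinear F"
    unfolding F_def
    by (intro bounded_clinear_plus bounded_clinear_functional_scaleC bounded_clinear_mult h)
  note linA = bounded_clinear_add[OF A] bounded_clinear_diff[OF A] bounded_clinear_scale[OF A]
  note linh = bounded_clinear_add[OF h(1)] bounded_clinear_scale[OF h(1)]
    bounded_clinear_add[OF h(2)] bounded_clinear_scale[OF h(2)] scaleC_complex
  have "F x \<in> cspan {v1, v2}" for x
    unfolding F_def by (intro cvs.span_add cvs.span_scale cvs.span_base) auto
  then have rank: "rank_le F 2"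
    unfolding rank_le_def
    by (intro exI[of _ "{v1, v2}"]) (auto simp: card_insert_if)
  have pow: "(F ^^ Suc k) x = (s ^ Suc k * h1 x) *\<^sub>C v1 + (t ^ Suc k * h2 x) *\<^sub>C v2" for k x
  proof (induction k)
    case (Suc k)
    have "(F ^^ Suc (Suc k)) x = F ((F ^^ Suc k) x)" by simp
    also have "\<dots> = F ((s ^ Suc k * h1 x) *\<^sub>C v1 + (t ^ Suc k * h2 x) *\<^sub>C v2)"
      by (simp only: Suc)
    also have "\<dots> = (s ^ Suc (Suc k) * h1 x) *\<^sub>C v1 + (t ^ Suc (Suc k) * h2 x) *\<^sub>C v2"
      by (simp add: F_def linh v mult.assoc)
    finally show ?case .
  qed (simp add: F_def)
  define K where "K = A \<circ> (F ^^ n)"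
  have K: "bounded_clinear K"
    using bounded_clinear_compose[OF A bounded_clinear_funpow[OF F, of n]] by (simp add: K_def o_def)
  note linK = bounded_clinear_add[OF K] bounded_clinear_diff[OF K] bounded_clinear_scale[OF K]
  have Kx: "K x = (s ^ n * h1 x) *\<^sub>C A v1 + (t ^ n * h2 x) *\<^sub>C A v2" for x
    using pow[of "n - 1" x] n by (simp add: K_def linA)
  \<comment> \<open>The off-diagonal entry of the product in the vectors \<open>A v1\<close>,
    \<open>A v2\<close>; it is not controlled and need not be.\<close>
  define q where "q = s ^ n * h1 (A v2)"
  have K1: "K (A v1) = A v1" using hA by (simp add: Kx s scaleC_one)
  have K2: "K (A v2) = q *\<^sub>C A v1 - A v2"
    using hA by (simp add: Kx q_def t scaleC_minus_left scaleC_one)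
  have K3: "K (K (A v2)) = A v2" by (simp add: K2 K1 linK)
  have "K (K (K x)) = K x" for x
    by (simp only: Kx[of x] linK K1 K3)
  moreover have "A v1 \<noteq> 0" using hA(1) bounded_clinear_zero[OF h(1)] by auto
  \<comment> \<open>The correction by \<open>q / 2\<close> solves the triangular eigenvector
    equation for \<open>- 1\<close>; applying \<open>h2\<close> shows that the vector is
    nonzero.\<close>
  moreover have "K (A v2 - (q / 2) *\<^sub>C A v1) = - (A v2 - (q / 2) *\<^sub>C A v1)"
  proof -
    have "q *\<^sub>C A v1 = (q / 2) *\<^sub>C A v1 + (q / 2) *\<^sub>C A v1" by (simp flip: scaleC_add_left)
    then show ?thesis by (simp add: linK K1 K2)
  qed
  moreover have "h2 (A v2 - (q / 2) *\<^sub>C A v1) \<noteq> 0"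
    using hA by (simp add: bounded_clinear_diff[OF h(2)] linh)
  then have "A v2 - (q / 2) *\<^sub>C A v1 \<noteq> 0" using bounded_clinear_zero[OF h(2)] by auto
  ultimately have "1 \<in> peripheral_spectrum K" "- 1 \<in> peripheral_spectrum K"
    using peripheral_spectrum_cube_eq[OF K _ K1] by blast+
  with F rank show thesis by (intro that[of F]) (simp_all add: K_def)
qed

section \<open>Trace preservation\<close>

lemma standard_operator_algebraD:
  assumes "standard_operator_algebra \<A>"
  shows "A \<in> \<A> \<Longrightarrow> bounded_clinear A"
    and "A \<in> \<A> \<Longrightarrow> B \<in> \<A> \<Longrightarrow> (\<lambda>x. A x + B x) \<in> \<A>"
    and "A \<in> \<A> \<Longrightarrow> (\<lambda>x. c *\<^sub>C A x) \<in> \<A>"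
    and "bounded_clinear F \<Longrightarrow> finite_rank F \<Longrightarrow> F \<in> \<A>"
  using assms unfolding standard_operator_algebra_def by blast+

lemma rank_le_imp_finite_rank: "rank_le F n \<Longrightarrow> finite_rank F"
  by (auto simp: rank_le_def finite_rank_def)

text \<open>Both \<open>x\<close> and \<open>f\<close> may be zero, so this means rank at most one
  and is closed under scaling by zero.\<close>

definition rank_one_op :: "('a::complex_normed_vector \<Rightarrow> 'a) \<Rightarrow> bool" where
  "rank_one_op R \<longleftrightarrow> (\<exists>x f. bounded_clinear f \<and> R = rank_one x f)"

text \<open>A junk value unless \<open>R\<close> has rank at most one, where it is the trace.\<close>

definition trace_one :: "('a::{complex_normed_vector, banach} \<Rightarrow> 'a) \<Rightarrow> complex" where
  "trace_one R = the_elem (peripheral_spectrum R)"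

lemma rank_one_opI: "bounded_clinear f \<Longrightarrow> rank_one_op (rank_one x f)"
  by (auto simp: rank_one_op_def)

lemma rank_one_opE:
  assumes "rank_one_op R"
  obtains x f where "bounded_clinear f" "R = rank_one x f"
  using assms by (auto simp: rank_one_op_def)

lemma rank_one_op_bounded: "rank_one_op R \<Longrightarrow> bounded_clinear R"
  by (metis rank_one_opE bounded_clinear_rank_one)

lemma rank_one_op_rank_le: "rank_one_op R \<Longrightarrow> rank_le R 2"
proof (elim rank_one_opE)
  fix x f assume "R = rank_one x f"
  then have "range R \<subseteq> cspan {x}" by (auto simp: rank_one_def intro: cvs.span_scale cvs.span_base)
  then show "rank_le R 2" unfolding rank_le_def by (intro exI[of _ "{x}"]) simp
qed

lemma comp_rank_one: "bounded_clinear A \<Longrightarrow> A \<circ> rank_one x f = rank_one (A x) f"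
  by (simp add: rank_one_def fun_eq_iff bounded_clinear_scale)

lemma rank_one_comp: "rank_one x f \<circ> B = rank_one x (\<lambda>v. f (B v))"
  by (simp add: rank_one_def fun_eq_iff)

lemma rank_one_power:
  assumes "bounded_clinear f"
  shows "rank_one x f ^^ Suc k = rank_one (f x ^ k *\<^sub>C x) f"
proof (induction k)
  case 0
  show ?case by (simp add: rank_one_def scaleC_one)
next
  case (Suc k)
  have "rank_one x f ^^ Suc (Suc k) = rank_one x f \<circ> rank_one x f ^^ Suc k" by simp
  also have "\<dots> = rank_one (rank_one x f (f x ^ k *\<^sub>C x)) f"
    unfolding Suc by (rule comp_rank_one[OF bounded_clinear_rank_one[OF assms]])
  finally show ?case by (simp add: rank_one_def bounded_clinear_scale[OF assms] scaleC_complex mult.commute)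
qed

lemma scaled_rank_one: "(\<lambda>v. c *\<^sub>C rank_one x f v) = rank_one (c *\<^sub>C x) f"
  by (simp add: rank_one_def scaleC_scaleC mult.commute)

lemma scaled_rank_one': "(\<lambda>v. c *\<^sub>C rank_one x f v) = rank_one x (\<lambda>v. c * f v)"
  by (simp add: rank_one_def scaleC_scaleC mult.commute)

lemma add_rank_one: "(\<lambda>v. rank_one x f v + rank_one y f v) = rank_one (x + y) f"
  by (simp add: rank_one_def scaleC_add_right)

lemma add_rank_one': "(\<lambda>v. rank_one x f v + rank_one x g v) = rank_one x (\<lambda>v. f v + g v)"
  by (simp add: rank_one_def scaleC_add_left)

text \<open>If \<open>g'\<close> is not a multiple of \<open>g\<close>, each functional can be
  isolated by a vector that the other one kills; the sum then shows \<open>y\<close> and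
  \<open>y'\<close> to be multiples of the same range vector \<open>y''\<close>.\<close>

lemma rank_one_adjacent:
  assumes g: "bounded_clinear g" and g': "bounded_clinear g'"
    and sum: "rank_one_op (\<lambda>v. rank_one y g v + rank_one y' g' v)"
    and y: "y \<noteq> 0" and v0: "g v0 \<noteq> 0"
  shows "(\<exists>h. bounded_clinear h \<and> rank_one y' g' = rank_one y h) \<or> (\<exists>z. rank_one y' g' = rank_one z g)"
proof -
  obtain y'' g'' where eq: "g v *\<^sub>C y + g' v *\<^sub>C y' = g'' v *\<^sub>C y''" for v
    using sum by (auto simp: rank_one_op_def rank_one_def fun_eq_iff)
  note lin = bounded_clinear_diff[OF g] bounded_clinear_scale[OF g]
    bounded_clinear_diff[OF g'] bounded_clinear_scale[OF g'] scaleC_complex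
  show ?thesis
  proof (cases "\<forall>v. g v = 0 \<longrightarrow> g' v = 0")
    case True
    define k where "k = g' v0 / g v0"
    have "g' v = g v * k" for v
    proof -
      have "g (v - (g v / g v0) *\<^sub>C v0) = 0" using v0 by (simp add: lin)
      then have "g' (v - (g v / g v0) *\<^sub>C v0) = 0" using True by blast
      then show ?thesis by (simp add: lin k_def)
    qed
    then have "rank_one y' g' = rank_one (k *\<^sub>C y') g"
      by (simp add: rank_one_def scaleC_scaleC)
    then show ?thesis by blast
  next
    case False
    then obtain v1 where v1: "g v1 = 0" "g' v1 \<noteq> 0" by blast
    have "y' = inverse (g' v1) *\<^sub>C (g' v1 *\<^sub>C y')" using v1 by (simp add: scaleC_scaleC scaleC_one)
    also have "\<dots> = (inverse (g' v1) * g'' v1) *\<^sub>C y''" using eq[of v1] v1 by (simp add: scaleC_scaleC)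
    finally obtain c where c: "y' = c *\<^sub>C y''" by blast
    \<comment> \<open>\<open>v0\<close> is corrected along \<open>v1\<close> to be killed by
      \<open>g'\<close> without changing the value of \<open>g\<close>.\<close>
    define v3 where "v3 = v0 - (g' v0 / g' v1) *\<^sub>C v1"
    have v3: "g v3 \<noteq> 0" "g' v3 = 0" using v0 v1 by (simp_all add: v3_def lin)
    have "y = inverse (g v3) *\<^sub>C (g v3 *\<^sub>C y)" using v3 by (simp add: scaleC_scaleC scaleC_one)
    also have "\<dots> = (inverse (g v3) * g'' v3) *\<^sub>C y''" using eq[of v3] v3 by (simp add: scaleC_scaleC)
    finally obtain k where k: "y = k *\<^sub>C y''" by blast
    with y have "k \<noteq> 0" by auto
    then have "y' = (c / k) *\<^sub>C y" by (simp add: c k scaleC_scaleC)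
    then have "rank_one y' g' = rank_one y (\<lambda>v. (c / k) * g' v)"
      by (simp add: rank_one_def scaleC_scaleC mult.commute)
    then show ?thesis using bounded_clinear_mult[OF g'] by blast
  qed
qed

section \<open>Traces of rank-one operators on a nonzero space\<close>

locale nontrivial_space =
  fixes X :: "'a::{complex_normed_vector, banach} itself"
  assumes nontrivial: "\<exists>x::'a. x \<noteq> 0"
begin

lemma trace_rank_one:
  fixes x :: 'a
  assumes "bounded_clinear f"
  shows "trace_one (rank_one x f) = f x"
  by (simp add: trace_one_def peripheral_spectrum_rank_one[OF assms nontrivial])

lemma peripheral_spectrum_rank_one_op:
  fixes R :: "'a \<Rightarrow> 'a"
  assumes "rank_one_op R"
  shows "peripheral_spectrum R = {trace_one R}"
  using assms by (elim rank_one_opE) (simp add: trace_rank_one peripheral_spectrum_rank_one[OF _ nontrivial])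

lemma trace_comp_rank_one:
  fixes A :: "'a \<Rightarrow> 'a"
  assumes "bounded_clinear A" "bounded_clinear f"
  shows "trace_one (A \<circ> rank_one x f) = f (A x)"
  by (simp add: comp_rank_one assms trace_rank_one)

lemma trace_rank_one_comp_rank_one:
  fixes x y :: 'a
  assumes "bounded_clinear f" "bounded_clinear g"
  shows "trace_one (rank_one x f \<circ> rank_one y g) = f y * g x"
  unfolding trace_comp_rank_one[OF bounded_clinear_rank_one[OF assms(1)] assms(2)]
  by (simp add: rank_one_def bounded_clinear_scale[OF assms(2)] scaleC_complex)

lemma trace_scale:
  fixes R :: "'a \<Rightarrow> 'a"
  assumes "rank_one_op R"
  shows "trace_one (\<lambda>v. c *\<^sub>C R v) = c * trace_one R"
  using assms
  by (elim rank_one_opE)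
    (simp add: scaled_rank_one trace_rank_one bounded_clinear_scale scaleC_complex)

text \<open>The trace is computed from a factorization, so additivity needs summands with a common
  factor. \<open>rank_one_adjacent\<close> provides one because the sum has rank at most
  one.\<close>

lemma trace_add:
  fixes R R' :: "'a \<Rightarrow> 'a"
  assumes R: "rank_one_op R" and R': "rank_one_op R'" and sum: "rank_one_op (\<lambda>v. R v + R' v)"
  shows "trace_one (\<lambda>v. R v + R' v) = trace_one R + trace_one R'"
proof -
  obtain y g where g: "bounded_clinear g" "R = rank_one y g" using R by (rule rank_one_opE)
  obtain y' g' where g': "bounded_clinear g'" "R' = rank_one y' g'" using R' by (rule rank_one_opE)
  consider "y = 0 \<or> (\<forall>v. g v = 0)" | v0 where "y \<noteq> 0" "g v0 \<noteq> 0" by blast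
  then show ?thesis
  proof cases
    case 1
    then have "g y = 0" "R v = 0" for v
      using bounded_clinear_zero[OF g(1)] by (auto simp: g rank_one_def)
    then show ?thesis using trace_rank_one[OF g(1), of y] g(2) by simp
  next
    case 2
    from rank_one_adjacent[OF g(1) g'(1) sum[unfolded g g'] 2] consider
      h where "bounded_clinear h" "R' = rank_one y h" | z where "R' = rank_one z g"
      using g' by auto
    then show ?thesis
    proof cases
      case 1
      then show ?thesis
        using g(1) by (simp add: g add_rank_one' trace_rank_one bounded_clinear_plus)
    next
      case 2
      then show ?thesis
        using g(1) by (simp add: g add_rank_one trace_rank_one bounded_clinear_add)
    qed
  qed
qed

lemma peripheral_spectrum_comp_rank_one_power:
  fixes A :: "'a \<Rightarrow> 'a"
  assumes A: "bounded_clinear A" and f: "bounded_clinear f" and n: "n \<ge> 1"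
  shows "peripheral_spectrum (A \<circ> (rank_one x f ^^ n)) = {f x ^ (n - 1) * f (A x)}"
proof -
  obtain k where k: "n = Suc k" using n by (cases n) auto
  have "A \<circ> (rank_one x f ^^ n) = rank_one (f x ^ k *\<^sub>C A x) f"
    unfolding k rank_one_power[OF f] by (simp add: comp_rank_one A bounded_clinear_scale)
  then show ?thesis
    using peripheral_spectrum_rank_one[OF f nontrivial]
    by (simp add: k bounded_clinear_scale[OF f] scaleC_complex)
qed

lemma no_two_peripheral_points:
  fixes A B :: "'a \<Rightarrow> 'a"
  assumes A: "rank_one_op A" and B: "bounded_clinear B"
  shows "\<not> (1 \<in> peripheral_spectrum (A \<circ> (B ^^ n)) \<and> - 1 \<in> peripheral_spectrum (A \<circ> (B ^^ n)))"
proof -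
  have "rank_one_op (A \<circ> (B ^^ n))"
    using A by (elim rank_one_opE)
      (simp add: rank_one_comp rank_one_opI bounded_clinear_compose bounded_clinear_funpow B)
  then show ?thesis by (simp add: peripheral_spectrum_rank_one_op)
qed

end

text \<open>Restricting to \<open>f x \<noteq> 0\<close> suits the trace identity, whose factor
  \<open>f(x)^(n-1)\<close> must be cancelled. The restriction is harmless because one functional
  can be nonzero at \<open>x\<close> and at \<open>S x - T x\<close> simultaneously.\<close>

lemma operator_eqI:
  fixes S T :: "'a::complex_normed_vector \<Rightarrow> 'a"
  assumes S: "bounded_clinear S" and T: "bounded_clinear T"
    and eq: "\<And>x f. bounded_clinear f \<Longrightarrow> f x \<noteq> (0::complex) \<Longrightarrow> f (S x) = f (T x)"
  shows "S = T"
proof (rule ext, rule ccontr)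
  fix x assume ne: "S x \<noteq> T x"
  then have "x \<noteq> 0" using bounded_clinear_zero[OF S] bounded_clinear_zero[OF T] by auto
  moreover from ne have "S x - T x \<noteq> 0" by simp
  ultimately obtain f :: "'a \<Rightarrow> complex" where f: "bounded_clinear f" "f x \<noteq> 0" "f (S x - T x) \<noteq> 0"
    using functional_nonzero_both by blast
  with eq[OF f(1,2)] show False by (simp add: bounded_clinear_diff[OF f(1)])
qed

section \<open>Rank preservation, linearity and the trace factor\<close>

locale peripheral_preserver =
  X: nontrivial_space X + Y: nontrivial_space Y
  for X :: "'a::{complex_normed_vector, banach} itself"
    and Y :: "'b::{complex_normed_vector, banach} itself" +
  fixes \<A> :: "('a \<Rightarrow> 'a) set" and \<Phi> :: "('a \<Rightarrow> 'a) \<Rightarrow> ('b \<Rightarrow> 'b)" and n :: nat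
  assumes alg: "standard_operator_algebra \<A>"
    and n: "n \<ge> 1"
    and bounded_image: "A \<in> \<A> \<Longrightarrow> bounded_clinear (\<Phi> A)"
    and range: "bounded_clinear F \<Longrightarrow> rank_le F 2 \<Longrightarrow> F \<in> \<Phi> ` \<A>"
    and preserves: "A \<in> \<A> \<Longrightarrow> B \<in> \<A> \<Longrightarrow>
      peripheral_spectrum (A \<circ> (B ^^ n)) = peripheral_spectrum (\<Phi> A \<circ> (\<Phi> B ^^ n))"
begin

lemmas bounded = standard_operator_algebraD(1)[OF alg]

lemma rank_le_in: "bounded_clinear F \<Longrightarrow> rank_le F k \<Longrightarrow> F \<in> \<A>"
  using standard_operator_algebraD(4)[OF alg] rank_le_imp_finite_rank by blast

lemma rank_one_op_in: "rank_one_op R \<Longrightarrow> R \<in> \<A>"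
  using rank_le_in rank_one_op_bounded rank_one_op_rank_le by blast

text \<open>A test operator of rank two belongs to the algebra on one side and to the range of
  \<open>\<Phi>\<close> on the other, so the rank-one test can be carried across in both
  directions.\<close>

lemma rank_one_op_iff:
  assumes A: "A \<in> \<A>"
  shows "rank_one_op (\<Phi> A) \<longleftrightarrow> rank_one_op A"
proof
  assume R: "rank_one_op (\<Phi> A)"
  show "rank_one_op A"
  proof (rule ccontr)
    assume "\<not> rank_one_op A"
    then obtain F where F: "bounded_clinear F" "rank_le F 2"
      "1 \<in> peripheral_spectrum (A \<circ> (F ^^ n))" "- 1 \<in> peripheral_spectrum (A \<circ> (F ^^ n))"
      using rank_one_characterization[OF bounded[OF A] n] unfolding rank_one_op_def by blast
    then have "F \<in> \<A>" using rank_le_in by blast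
    with F(3,4) Y.no_two_peripheral_points[OF R bounded_image[of F], of n] preserves[OF A]
    show False by simp
  qed
next
  assume R: "rank_one_op A"
  show "rank_one_op (\<Phi> A)"
  proof (rule ccontr)
    assume "\<not> rank_one_op (\<Phi> A)"
    then obtain F where F: "bounded_clinear F" "rank_le F 2"
      "1 \<in> peripheral_spectrum (\<Phi> A \<circ> (F ^^ n))" "- 1 \<in> peripheral_spectrum (\<Phi> A \<circ> (F ^^ n))"
      using rank_one_characterization[OF bounded_image[OF A] n] unfolding rank_one_op_def by blast
    then obtain B where "B \<in> \<A>" "F = \<Phi> B" using range by blast
    with F(3,4) X.no_two_peripheral_points[OF R bounded[of B], of n] preserves[OF A, of B]
    show False by simp
  qed
qed

lemma trace_identity:
  assumes A: "A \<in> \<A>" and f: "bounded_clinear f" and g: "bounded_clinear g"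
    and eq: "\<Phi> (rank_one x f) = rank_one y g"
  shows "f x ^ (n - 1) * f (A x) = g y ^ (n - 1) * g (\<Phi> A y)"
proof -
  have "{f x ^ (n - 1) * f (A x)} = {g y ^ (n - 1) * g (\<Phi> A y)}"
    using preserves[OF A rank_one_op_in[OF rank_one_opI[OF f, of x]]]
    unfolding eq X.peripheral_spectrum_comp_rank_one_power[OF bounded[OF A] f n]
      Y.peripheral_spectrum_comp_rank_one_power[OF bounded_image[OF A] g n] .
  then show ?thesis by simp
qed

text \<open>Taking \<open>A\<close> in \<open>trace_identity\<close> to be the rank-one operator
  itself contributes two more factors, which raises the exponent \<open>n - 1\<close> to
  \<open>n + 1\<close>.\<close>

lemma trace_power:
  assumes f: "bounded_clinear f"
  shows "trace_one (\<Phi> (rank_one x f)) ^ (n + 1) = f x ^ (n + 1)"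
proof -
  have R: "rank_one_op (rank_one x f)" by (rule rank_one_opI[OF f])
  then have "rank_one_op (\<Phi> (rank_one x f))" by (simp add: rank_one_op_iff rank_one_op_in)
  then obtain y g where g: "bounded_clinear g" "\<Phi> (rank_one x f) = rank_one y g" by (rule rank_one_opE)
  obtain k where k: "n = Suc k" using n by (cases n) auto
  have "f x ^ k * (f x * f x) = g y ^ k * (g y * g y)"
    using trace_identity[OF rank_one_op_in[OF R] f g] unfolding g(2) k
    by (simp add: rank_one_def bounded_clinear_scale[OF f] bounded_clinear_scale[OF g(1)] scaleC_complex)
  then show ?thesis by (simp add: g Y.trace_rank_one k mult_ac)
qed

text \<open>Every \<open>y \<otimes> g\<close> is the image of some \<open>x \<otimes> f\<close>,
  through which the trace identity expresses \<open>g (\<Phi> C y)\<close> linearly in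
  \<open>C\<close>. Cancelling the power of \<open>g y\<close> leaves enough functionals to identify
  the operator.\<close>

lemma linear_combination:
  assumes A: "A \<in> \<A>" and B: "B \<in> \<A>"
  shows "\<Phi> (\<lambda>x. a *\<^sub>C A x + b *\<^sub>C B x) = (\<lambda>y. a *\<^sub>C \<Phi> A y + b *\<^sub>C \<Phi> B y)"
proof -
  define C where "C = (\<lambda>x. a *\<^sub>C A x + b *\<^sub>C B x)"
  have C: "C \<in> \<A>"
    unfolding C_def by (intro standard_operator_algebraD(2,3)[OF alg] A B)
  have "\<Phi> C = (\<lambda>y. a *\<^sub>C \<Phi> A y + b *\<^sub>C \<Phi> B y)"
  proof (rule operator_eqI)
    fix y and g :: "'b \<Rightarrow> complex" assume g: "bounded_clinear g" "g y \<noteq> 0"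
    have R: "rank_one_op (rank_one y g)" using g(1) by (rule rank_one_opI)
    then obtain R' where R': "R' \<in> \<A>" "rank_one y g = \<Phi> R'"
      using range rank_one_op_bounded rank_one_op_rank_le by blast
    with R have "rank_one_op R'" using rank_one_op_iff by simp
    then obtain x f where f: "bounded_clinear f" "R' = rank_one x f" by (rule rank_one_opE)
    note id = trace_identity[OF _ f(1) g(1), of _ x y, unfolded f(2)[symmetric], OF _ R'(2)[symmetric]]
    have "g y ^ (n - 1) * g (\<Phi> C y) = f x ^ (n - 1) * f (C x)" using id[OF C] by simp
    also have "\<dots> = a * (f x ^ (n - 1) * f (A x)) + b * (f x ^ (n - 1) * f (B x))"
      by (simp add: C_def bounded_clinear_add[OF f(1)] bounded_clinear_scale[OF f(1)] scaleC_complex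
          algebra_simps)
    also have "\<dots> = g y ^ (n - 1) * (a * g (\<Phi> A y) + b * g (\<Phi> B y))"
      unfolding id[OF A] id[OF B] by (simp add: algebra_simps)
    finally show "g (\<Phi> C y) = g (a *\<^sub>C \<Phi> A y + b *\<^sub>C \<Phi> B y)"
      using g(2) by (simp add: bounded_clinear_add[OF g(1)] bounded_clinear_scale[OF g(1)] scaleC_complex)
  qed (auto intro!: bounded_clinear_plus bounded_clinear_scaled bounded_image A B C)
  then show ?thesis by (simp add: C_def)
qed

lemma image_add: "A \<in> \<A> \<Longrightarrow> B \<in> \<A> \<Longrightarrow> \<Phi> (\<lambda>x. A x + B x) = (\<lambda>y. \<Phi> A y + \<Phi> B y)"
  using linear_combination[of A B 1 1] by (simp add: scaleC_one)

lemma image_scale: "A \<in> \<A> \<Longrightarrow> \<Phi> (\<lambda>x. c *\<^sub>C A x) = (\<lambda>y. c *\<^sub>C \<Phi> A y)"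
  using linear_combination[of A A c 0] by simp

lemma image_rank_one_op: "rank_one_op R \<Longrightarrow> rank_one_op (\<Phi> R)"
  by (simp add: rank_one_op_iff rank_one_op_in)

text \<open>As a function of \<open>f\<close> the trace of \<open>\<Phi> (rank_one x f)\<close> is linear with the same kernel as
  evaluation at \<open>x\<close>, and symmetrically in \<open>x\<close>; hence the factor of proportionality is a constant.\<close>

lemma trace_factor:
  obtains c where "c ^ (n + 1) = 1"
    "\<And>R. rank_one_op R \<Longrightarrow> trace_one (\<Phi> R) = c * trace_one R"
proof -
  define t where "t x f = trace_one (\<Phi> (rank_one x f))" for x f
  have t0: "t x f = 0 \<longleftrightarrow> f x = 0" if "bounded_clinear f" for x f
  proof -
    have "t x f ^ (n + 1) = 0 \<longleftrightarrow> f x ^ (n + 1) = 0"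
      unfolding t_def trace_power[OF that] ..
    then show ?thesis by auto
  qed
  have scale1: "t (a *\<^sub>C x) f = a * t x f" if "bounded_clinear f" for a x f
    unfolding t_def scaled_rank_one[symmetric] image_scale[OF rank_one_op_in[OF rank_one_opI[OF that]]]
    by (rule Y.trace_scale[OF image_rank_one_op[OF rank_one_opI[OF that]]])
  have scale2: "t x (\<lambda>v. a * f v) = a * t x f" if "bounded_clinear f" for a x f
    using scale1[OF that, of a x] unfolding t_def scaled_rank_one[symmetric] scaled_rank_one' .
  have add1: "t (x + y) f = t x f + t y f" if f: "bounded_clinear f" for x y f
  proof -
    note R = rank_one_opI[OF f, of x] rank_one_opI[OF f, of y] rank_one_opI[OF f, of "x + y"]
    have "\<Phi> (rank_one (x + y) f) = (\<lambda>v. \<Phi> (rank_one x f) v + \<Phi> (rank_one y f) v)"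
      using image_add[OF R(1,2)[THEN rank_one_op_in]] by (simp add: add_rank_one)
    with R[THEN image_rank_one_op] show ?thesis by (simp add: t_def Y.trace_add)
  qed
  have add2: "t x (\<lambda>v. f v + g v) = t x f + t x g" if f: "bounded_clinear f" and g: "bounded_clinear g" for x f g
  proof -
    note R = rank_one_opI[OF f, of x] rank_one_opI[OF g, of x] rank_one_opI[OF bounded_clinear_plus[OF f g], of x]
    have "\<Phi> (rank_one x (\<lambda>v. f v + g v)) = (\<lambda>v. \<Phi> (rank_one x f) v + \<Phi> (rank_one x g) v)"
      using image_add[OF R(1,2)[THEN rank_one_op_in]] by (simp add: add_rank_one')
    with R[THEN image_rank_one_op] show ?thesis by (simp add: t_def Y.trace_add)
  qed
  \<comment> \<open>The functional \<open>h(x) f - f(x) h\<close> vanishes at \<open>x\<close>, so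
    \<open>t\<close> vanishes on it; bilinearity gives the proportion.\<close>
  have vary_f: "t x f * h x = t x h * f x" if f: "bounded_clinear f" and h: "bounded_clinear h" for x f h
  proof -
    have "t x (\<lambda>v. h x * f v + (- f x) * h v) = 0"
      by (subst t0) (intro bounded_clinear_plus bounded_clinear_mult f h, simp)
    moreover have "t x (\<lambda>v. h x * f v + (- f x) * h v) = h x * t x f + (- f x) * t x h"
      by (simp only: add2[OF bounded_clinear_mult[OF f] bounded_clinear_mult[OF h]] scale2[OF f] scale2[OF h])
    ultimately show ?thesis by (simp add: mult.commute)
  qed
  have vary_x: "t x f * f y = t y f * f x" if f: "bounded_clinear f" for x y f
  proof -
    have "t (f y *\<^sub>C x + (- f x) *\<^sub>C y) f = 0"
      by (simp only: t0[OF f] bounded_clinear_add[OF f] bounded_clinear_scale[OF f] scaleC_complex)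
        simp
    then have "f y * t x f + (- f x) * t y f = 0" by (simp only: add1[OF f] scale1[OF f])
    then show ?thesis by (simp add: mult.commute)
  qed
  obtain x0 :: 'a where x0: "x0 \<noteq> 0" using X.nontrivial by blast
  then obtain f0 :: "'a \<Rightarrow> complex" where f0: "bounded_clinear f0" "f0 x0 = 1" by (rule separating_functional)
  define c where "c = t x0 f0"
  have tc: "t x f = c * f x" if f: "bounded_clinear f" for x f
  proof (cases "x = 0")
    case True
    then show ?thesis using t0[OF f, of x] bounded_clinear_zero[OF f] by simp
  next
    case False
    \<comment> \<open>An \<open>h\<close> nonzero at both points links the pairs
      \<open>(x0, f0)\<close>, \<open>(x0, h)\<close>, \<open>(x, h)\<close>, \<open>(x, f)\<close>,
      changing one entry at a time.\<close>
    then obtain h :: "'a \<Rightarrow> complex" where h: "bounded_clinear h" "h x \<noteq> 0" "h x0 \<noteq> 0"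
      using functional_nonzero_both x0 by blast
    have "t x0 h = c * h x0" using vary_f[OF h(1) f0(1), of x0] f0(2) by (simp add: c_def)
    then have "t x h = c * h x" using vary_x[OF h(1), of x x0] h by simp
    then show ?thesis using vary_f[OF f h(1), of x] h by simp
  qed
  have "c ^ (n + 1) = 1" using trace_power[OF f0(1), of x0] f0(2) by (simp add: c_def t_def)
  moreover have "trace_one (\<Phi> R) = c * trace_one R" if "rank_one_op R" for R
    using that tc by (elim rank_one_opE) (simp add: X.trace_rank_one t_def)
  ultimately show thesis by (rule that)
qed

end

section \<open>Images of rank-one operators\<close>

text \<open>The properties shared by \<open>\<Phi>\<close> after division by its trace factor. The
  exponent has disappeared: the bilinear trace form now carries the spectral information.\<close>

locale trace_form_preserver =
  X: nontrivial_space X + Y: nontrivial_space Y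
  for X :: "'a::{complex_normed_vector, banach} itself"
    and Y :: "'b::{complex_normed_vector, banach} itself" +
  fixes \<A> :: "('a \<Rightarrow> 'a) set" and \<Psi> :: "('a \<Rightarrow> 'a) \<Rightarrow> ('b \<Rightarrow> 'b)"
  assumes alg: "standard_operator_algebra \<A>"
    and bounded_image: "A \<in> \<A> \<Longrightarrow> bounded_clinear (\<Psi> A)"
    and image_add: "A \<in> \<A> \<Longrightarrow> B \<in> \<A> \<Longrightarrow> \<Psi> (\<lambda>x. A x + B x) = (\<lambda>y. \<Psi> A y + \<Psi> B y)"
    and image_scale: "A \<in> \<A> \<Longrightarrow> \<Psi> (\<lambda>x. c *\<^sub>C A x) = (\<lambda>y. c *\<^sub>C \<Psi> A y)"
    and image_rank_one_op: "rank_one_op R \<Longrightarrow> rank_one_op (\<Psi> R)"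
    and rank_one_op_preimage: "rank_one_op S \<Longrightarrow> \<exists>R. rank_one_op R \<and> \<Psi> R = S"
    and trace_image: "rank_one_op R \<Longrightarrow> trace_one (\<Psi> R) = trace_one R"
    and trace_form: "A \<in> \<A> \<Longrightarrow> rank_one_op R \<Longrightarrow> trace_one (\<Psi> A \<circ> \<Psi> R) = trace_one (A \<circ> R)"
begin

lemmas bounded = standard_operator_algebraD(1)[OF alg]

lemma rank_one_op_in: "rank_one_op R \<Longrightarrow> R \<in> \<A>"
  using standard_operator_algebraD(4)[OF alg] rank_le_imp_finite_rank rank_one_op_bounded
    rank_one_op_rank_le by blast

definition image_rank_one :: "'a \<Rightarrow> ('a \<Rightarrow> complex) \<Rightarrow> 'b \<Rightarrow> 'b" where
  "image_rank_one x f = \<Psi> (rank_one x f)"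

lemma rank_one_op_image_rank_one: "bounded_clinear f \<Longrightarrow> rank_one_op (image_rank_one x f)"
  unfolding image_rank_one_def by (intro image_rank_one_op rank_one_opI)

lemma
  assumes f: "bounded_clinear f"
  shows image_rank_one_add_left: "image_rank_one (x + y) f = (\<lambda>v. image_rank_one x f v + image_rank_one y f v)"
    and image_rank_one_scale_left: "image_rank_one (c *\<^sub>C x) f = (\<lambda>v. c *\<^sub>C image_rank_one x f v)"
    and image_rank_one_scale_right: "image_rank_one x (\<lambda>v. c * f v) = (\<lambda>v. c *\<^sub>C image_rank_one x f v)"
proof -
  note R = rank_one_op_in[OF rank_one_opI[OF f]]
  show "image_rank_one (x + y) f = (\<lambda>v. image_rank_one x f v + image_rank_one y f v)"
    unfolding image_rank_one_def add_rank_one[symmetric] by (rule image_add[OF R R])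
  show "image_rank_one (c *\<^sub>C x) f = (\<lambda>v. c *\<^sub>C image_rank_one x f v)"
    unfolding image_rank_one_def scaled_rank_one[symmetric] by (rule image_scale[OF R])
  show "image_rank_one x (\<lambda>v. c * f v) = (\<lambda>v. c *\<^sub>C image_rank_one x f v)"
    unfolding image_rank_one_def scaled_rank_one'[symmetric] by (rule image_scale[OF R])
qed

lemma image_rank_one_add_right:
  assumes "bounded_clinear f" "bounded_clinear g"
  shows "image_rank_one x (\<lambda>v. f v + g v) = (\<lambda>v. image_rank_one x f v + image_rank_one x g v)"
  unfolding image_rank_one_def add_rank_one'[symmetric]
  by (rule image_add[OF assms[THEN rank_one_opI, THEN rank_one_op_in]])

lemma trace_image_rank_one:
  assumes "bounded_clinear f" "bounded_clinear g"
  shows "trace_one (image_rank_one x f \<circ> image_rank_one y g) = f y * g x"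
proof -
  note R = assms[THEN rank_one_opI]
  show ?thesis
    unfolding image_rank_one_def trace_form[OF rank_one_op_in[OF R(1)] R(2)]
    by (rule X.trace_rank_one_comp_rank_one[OF assms])
qed

lemma trace_image_comp:
  assumes "A \<in> \<A>" "bounded_clinear f"
  shows "trace_one (\<Psi> A \<circ> image_rank_one x f) = f (A x)"
  unfolding image_rank_one_def trace_form[OF assms(1) rank_one_opI[OF assms(2)]]
  by (rule X.trace_comp_rank_one[OF bounded[OF assms(1)] assms(2)])

text \<open>The trace form against rank-one operators is nondegenerate, and \<open>\<Psi>\<close>
  preserves it.\<close>

lemma image_inj:
  assumes A: "A \<in> \<A>" and B: "B \<in> \<A>" and eq: "\<Psi> A = \<Psi> B"
  shows "A = B"
proof (rule operator_eqI[OF bounded[OF A] bounded[OF B]])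
  fix x and f :: "'a \<Rightarrow> complex" assume f: "bounded_clinear f"
  show "f (A x) = f (B x)"
    unfolding trace_image_comp[OF A f, symmetric] trace_image_comp[OF B f, symmetric] eq ..
qed

end

section \<open>Operators adjacent to a fixed idempotent and their images\<close>

locale based_trace_form_preserver = trace_form_preserver X Y \<A> \<Psi>
  for X :: "'a::{complex_normed_vector, banach} itself"
    and Y :: "'b::{complex_normed_vector, banach} itself"
    and \<A> :: "('a \<Rightarrow> 'a) set" and \<Psi> :: "('a \<Rightarrow> 'a) \<Rightarrow> ('b \<Rightarrow> 'b)" +
  fixes x0 :: 'a and f0 :: "'a \<Rightarrow> complex" and y0 :: 'b and g0 :: "'b \<Rightarrow> complex"
  assumes f0: "bounded_clinear f0" "f0 x0 = 1" and g0: "bounded_clinear g0"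
    and base: "image_rank_one x0 f0 = rank_one y0 g0"
begin

text \<open>Trace preservation makes the image of the base idempotent an idempotent. This
  normalization lets evaluation at \<open>y0\<close> and application of \<open>g0\<close> read off
  the factors of adjacent operators.\<close>

lemma g0_y0: "g0 y0 = 1"
  using trace_image[OF rank_one_opI[OF f0(1), of x0]] base f0 g0
  by (simp add: image_rank_one_def Y.trace_rank_one X.trace_rank_one)

lemma y0_nonzero: "y0 \<noteq> 0"
  using g0_y0 bounded_clinear_zero[OF g0] by auto

text \<open>Adding the base operator gives \<open>(x0 + x) \<otimes> f0\<close>, again of rank at
  most one, so the image stays adjacent to \<open>y0 \<otimes> g0\<close>.\<close>

lemma adjacent_image1:
  "(\<exists>h. bounded_clinear h \<and> image_rank_one x f0 = rank_one y0 h) \<or> (\<exists>z. image_rank_one x f0 = rank_one z g0)"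
proof -
  obtain z h where h: "bounded_clinear h" "image_rank_one x f0 = rank_one z h"
    using rank_one_op_image_rank_one[OF f0(1)] by (rule rank_one_opE)
  have "rank_one_op (\<lambda>v. rank_one y0 g0 v + rank_one z h v)"
    using rank_one_op_image_rank_one[OF f0(1), of "x0 + x"] by (simp add: image_rank_one_add_left f0 base h)
  from rank_one_adjacent[OF g0 h(1) this y0_nonzero, of y0] show ?thesis
    by (simp add: g0_y0 h)
qed

lemma adjacent_image2:
  assumes f: "bounded_clinear f"
  shows "(\<exists>h. bounded_clinear h \<and> image_rank_one x0 f = rank_one y0 h) \<or> (\<exists>z. image_rank_one x0 f = rank_one z g0)"
proof -
  obtain z h where h: "bounded_clinear h" "image_rank_one x0 f = rank_one z h"
    using rank_one_op_image_rank_one[OF f] by (rule rank_one_opE)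
  have "rank_one_op (\<lambda>v. rank_one y0 g0 v + rank_one z h v)"
    using rank_one_op_image_rank_one[OF bounded_clinear_plus[OF f0(1) f], of x0] by (simp add: image_rank_one_add_right f0 f base h)
  from rank_one_adjacent[OF g0 h(1) this y0_nonzero, of y0] show ?thesis
    by (simp add: g0_y0 h)
qed

text \<open>Preimages of \<open>S\<close> and of the sum are chosen independently; injectivity
  identifies the second with the base operator plus the first, which is therefore adjacent to the
  base.\<close>

lemma adjacent_preimage:
  assumes S: "rank_one_op S" and sum: "rank_one_op (\<lambda>v. rank_one y0 g0 v + S v)"
  shows "(\<exists>x. S = image_rank_one x f0) \<or> (\<exists>f. bounded_clinear f \<and> S = image_rank_one x0 f)"
proof -
  obtain R where R: "rank_one_op R" "\<Psi> R = S" using rank_one_op_preimage[OF S] by blast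
  obtain R' where R': "rank_one_op R'" "\<Psi> R' = (\<lambda>v. rank_one y0 g0 v + S v)"
    using rank_one_op_preimage[OF sum] by blast
  have P: "rank_one x0 f0 \<in> \<A>" by (intro rank_one_op_in rank_one_opI f0)
  have "R' = (\<lambda>v. rank_one x0 f0 v + R v)"
  proof (rule image_inj)
    show "R' \<in> \<A>" "(\<lambda>v. rank_one x0 f0 v + R v) \<in> \<A>"
      using R' R standard_operator_algebraD(2)[OF alg P] by (auto intro: rank_one_op_in)
    show "\<Psi> R' = \<Psi> (\<lambda>v. rank_one x0 f0 v + R v)"
      using base by (simp add: image_add P rank_one_op_in R R' image_rank_one_def)
  qed
  then have sum': "rank_one_op (\<lambda>v. rank_one x0 f0 v + R v)" using R' by simp
  obtain x f where f: "bounded_clinear f" "R = rank_one x f" using R(1) by (rule rank_one_opE)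
  have "x0 \<noteq> 0" using f0 bounded_clinear_zero[OF f0(1)] by auto
  from rank_one_adjacent[OF f0(1) f(1) sum'[unfolded f(2)] this, of x0] show ?thesis
    using R(2) by (auto simp: f0 f image_rank_one_def)
qed

text \<open>The vectors whose image shares the range \<open>y0\<close>, and those whose image shares
  the functional \<open>g0\<close>, form two subspaces. They cover the space, so one of them is
  everything.\<close>

lemma dichotomy1:
  "(\<forall>x. \<exists>h. bounded_clinear h \<and> image_rank_one x f0 = rank_one y0 h) \<or> (\<forall>x. \<exists>z. image_rank_one x f0 = rank_one z g0)"
proof (rule ccontr)
  assume "\<not> ?thesis"
  then obtain x1 x2 where
    x1: "\<nexists>h. bounded_clinear h \<and> image_rank_one x1 f0 = rank_one y0 h" and x2: "\<nexists>z. image_rank_one x2 f0 = rank_one z g0"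
    by blast
  obtain z1 where z1: "image_rank_one x1 f0 = rank_one z1 g0" using adjacent_image1 x1 by blast
  obtain h2 where h2: "bounded_clinear h2" "image_rank_one x2 f0 = rank_one y0 h2" using adjacent_image1 x2 by blast
  have sum: "image_rank_one (x1 + x2) f0 v = image_rank_one x1 f0 v + image_rank_one x2 f0 v" for v by (simp add: image_rank_one_add_left f0)
  from adjacent_image1[of "x1 + x2"] show False
  proof (elim disjE exE conjE)
    fix h assume h: "bounded_clinear h" "image_rank_one (x1 + x2) f0 = rank_one y0 h"
    have "image_rank_one x1 f0 v = rank_one y0 (\<lambda>v. h v - h2 v) v" for v
      using sum[of v] by (simp add: h h2 rank_one_def cvs.scale_left_diff_distrib algebra_simps)
    then have "image_rank_one x1 f0 = rank_one y0 (\<lambda>v. h v - h2 v)" by (rule ext)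
    with x1 bounded_clinear_sub[OF h(1) h2(1)] show False by blast
  next
    fix z assume z: "image_rank_one (x1 + x2) f0 = rank_one z g0"
    have "image_rank_one x2 f0 v = rank_one (z - z1) g0 v" for v
      using sum[of v] by (simp add: z z1 rank_one_def cvs.scale_right_diff_distrib algebra_simps)
    then have "image_rank_one x2 f0 = rank_one (z - z1) g0" by (rule ext)
    with x2 show False by blast
  qed
qed

lemma dichotomy2:
  "(\<forall>f. bounded_clinear f \<longrightarrow> (\<exists>h. bounded_clinear h \<and> image_rank_one x0 f = rank_one y0 h)) \<or>
   (\<forall>f. bounded_clinear f \<longrightarrow> (\<exists>z. image_rank_one x0 f = rank_one z g0))"
proof (rule ccontr)
  assume "\<not> ?thesis"
  then obtain f1 f2 where f: "bounded_clinear f1" "bounded_clinear f2" and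
    f1: "\<nexists>h. bounded_clinear h \<and> image_rank_one x0 f1 = rank_one y0 h" and f2: "\<nexists>z. image_rank_one x0 f2 = rank_one z g0"
    by blast
  obtain z1 where z1: "image_rank_one x0 f1 = rank_one z1 g0" using adjacent_image2 f f1 by blast
  obtain h2 where h2: "bounded_clinear h2" "image_rank_one x0 f2 = rank_one y0 h2" using adjacent_image2 f f2 by blast
  define f3 where "f3 v = f1 v + f2 v" for v
  have f3: "bounded_clinear f3" unfolding f3_def by (rule bounded_clinear_plus[OF f])
  have sum: "image_rank_one x0 f3 v = image_rank_one x0 f1 v + image_rank_one x0 f2 v" for v
    unfolding f3_def by (simp add: image_rank_one_add_right f)
  from adjacent_image2[OF f3] show False
  proof (elim disjE exE conjE)
    fix h assume h: "bounded_clinear h" "image_rank_one x0 f3 = rank_one y0 h"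
    have "image_rank_one x0 f1 v = rank_one y0 (\<lambda>v. h v - h2 v) v" for v
      using sum[of v] by (simp add: h h2 rank_one_def cvs.scale_left_diff_distrib algebra_simps)
    then have "image_rank_one x0 f1 = rank_one y0 (\<lambda>v. h v - h2 v)" by (rule ext)
    with f1 bounded_clinear_sub[OF h(1) h2(1)] show False by blast
  next
    fix z assume z: "image_rank_one x0 f3 = rank_one z g0"
    have "image_rank_one x0 f2 v = rank_one (z - z1) g0 v" for v
      using sum[of v] by (simp add: z z1 rank_one_def cvs.scale_right_diff_distrib algebra_simps)
    then have "image_rank_one x0 f2 = rank_one (z - z1) g0" by (rule ext)
    with f2 show False by blast
  qed
qed

lemma column_preimage:
  "(\<exists>x. rank_one y g0 = image_rank_one x f0) \<or> (\<exists>f. bounded_clinear f \<and> rank_one y g0 = image_rank_one x0 f)"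
  by (rule adjacent_preimage) (simp_all add: rank_one_opI g0 add_rank_one)

lemma row_preimage:
  assumes "bounded_clinear g"
  shows "(\<exists>x. rank_one y0 g = image_rank_one x f0) \<or> (\<exists>f. bounded_clinear f \<and> rank_one y0 g = image_rank_one x0 f)"
  by (rule adjacent_preimage) (simp_all add: rank_one_opI assms g0 add_rank_one' bounded_clinear_plus)

text \<open>This alternative leads to the similarity; \<open>twisted\<close>, with the two shapes
  exchanged, leads to the adjoint.\<close>

definition straight :: bool where
  "straight \<longleftrightarrow> (\<forall>x. \<exists>z. image_rank_one x f0 = rank_one z g0) \<and>
    (\<forall>f. bounded_clinear f \<longrightarrow> (\<exists>h. bounded_clinear h \<and> image_rank_one x0 f = rank_one y0 h))"

definition twisted :: bool where
  "twisted \<longleftrightarrow> (\<forall>x. \<exists>h. bounded_clinear h \<and> image_rank_one x f0 = rank_one y0 h) \<and>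
    (\<forall>f. bounded_clinear f \<longrightarrow> (\<exists>z. image_rank_one x0 f = rank_one z g0))"

text \<open>The two mixed alternatives force the target space to be one-dimensional.\<close>

lemma straight_or_twisted: "straight \<or> twisted"
proof -
  consider "straight" | "twisted"
    | (cols) "\<forall>x. \<exists>z. image_rank_one x f0 = rank_one z g0" "\<forall>f. bounded_clinear f \<longrightarrow> (\<exists>z. image_rank_one x0 f = rank_one z g0)"
    | (rows) "\<forall>x. \<exists>h. bounded_clinear h \<and> image_rank_one x f0 = rank_one y0 h"
        "\<forall>f. bounded_clinear f \<longrightarrow> (\<exists>h. bounded_clinear h \<and> image_rank_one x0 f = rank_one y0 h)"
    using dichotomy1 dichotomy2 unfolding straight_def twisted_def by argo
  then show ?thesis
  proof cases
    case cols
    have "\<exists>h. bounded_clinear h \<and> image_rank_one x0 f = rank_one y0 h" if f: "bounded_clinear f" for f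
    proof -
      obtain z where z: "image_rank_one x0 f = rank_one z g0" using cols(2) f by blast
      \<comment> \<open>Here every preimage of a row \<open>y0 \<otimes> g\<close> has a column as
        image, so every \<open>g\<close> is a multiple of \<open>g0\<close>, and functionals cannot
        tell \<open>z\<close> from its multiple of \<open>y0\<close>.\<close>
      have "z = g0 z *\<^sub>C y0"
      proof (rule functionals_separate)
        fix g :: "'b \<Rightarrow> complex" assume g: "bounded_clinear g"
        obtain z' where z': "rank_one y0 g = rank_one z' g0" using row_preimage[OF g] cols by metis
        have gv: "g v = g0 v * g0 z'" for v
          using arg_cong[OF fun_cong[OF z', of v], of g0] g0_y0
          by (simp add: rank_one_def bounded_clinear_scale[OF g0] scaleC_complex)
        show "g z = g (g0 z *\<^sub>C y0)"
          by (simp only: bounded_clinear_scale[OF g] scaleC_complex gv[of z] gv[of y0] g0_y0)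
            simp
      qed
      then have "rank_one z g0 v = rank_one y0 (\<lambda>v. g0 z * g0 v) v" for v
        by (metis rank_one_def scaleC_scaleC mult.commute)
      then have "image_rank_one x0 f = rank_one y0 (\<lambda>v. g0 z * g0 v)" using z by auto
      then show ?thesis using bounded_clinear_mult[OF g0] by blast
    qed
    with cols(1) show ?thesis by (simp add: straight_def)
  next
    case rows
    \<comment> \<open>Dually, every column \<open>v \<otimes> g0\<close> is also a row, so every
      vector is a multiple of \<open>y0\<close>.\<close>
    have y: "v = g0 v *\<^sub>C y0" for v
    proof -
      obtain h where h: "rank_one v g0 = rank_one y0 h" using column_preimage[of v] rows by metis
      have *: "v = h y0 *\<^sub>C y0"
        using fun_cong[OF h, of y0] g0_y0 by (simp add: rank_one_def scaleC_one)
      have "g0 v = h y0" by (subst *) (simp add: bounded_clinear_scale[OF g0] g0_y0 scaleC_complex)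
      with * show ?thesis by simp
    qed
    have "\<exists>z. image_rank_one x f0 = rank_one z g0" for x
    proof -
      obtain h where h: "bounded_clinear h" "image_rank_one x f0 = rank_one y0 h" using rows(1) by blast
      have "h v = g0 v * h y0" for v
        using arg_cong[OF y[of v], of h] by (simp add: bounded_clinear_scale[OF h(1)] scaleC_complex)
      then have "rank_one y0 h v = rank_one (h y0 *\<^sub>C y0) g0 v" for v
        by (metis rank_one_def scaleC_scaleC)
      then show ?thesis using h(2) by auto
    qed
    with rows(2) show ?thesis by (simp add: straight_def)
  qed auto
qed

text \<open>A pair \<open>(x, f)\<close> with \<open>f0 x = 0\<close> or \<open>f x0 = 0\<close> is a difference of pairs in general position.\<close>

lemma image_rank_one_eqI:
  assumes generic: "\<And>x f. bounded_clinear f \<Longrightarrow> f x0 \<noteq> 0 \<Longrightarrow> f0 x \<noteq> 0 \<Longrightarrow> image_rank_one x f = N x f"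
    and add1: "\<And>x y f v. bounded_clinear f \<Longrightarrow> N (x + y) f v = N x f v + N y f v"
    and add2: "\<And>x f g v. bounded_clinear f \<Longrightarrow> bounded_clinear g \<Longrightarrow>
      N x (\<lambda>v. f v + g v) v = N x f v + N x g v"
    and f: "bounded_clinear f"
  shows "image_rank_one x f = N x f"
proof -
  have *: "image_rank_one x f = N x f" if f: "bounded_clinear f" "f x0 \<noteq> 0" for x f
  proof (cases "f0 x = 0")
    case True
    have "f0 (x + x0) \<noteq> 0" using True f0 by (simp add: bounded_clinear_add)
    then have "image_rank_one x f v + image_rank_one x0 f v = N x f v + N x0 f v" for v
      using generic[OF f, of "x + x0"] by (simp add: image_rank_one_add_left f fun_eq_iff add1)
    moreover have "image_rank_one x0 f = N x0 f" using generic[OF f, of x0] f0 by simp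
    ultimately show ?thesis by (simp add: fun_eq_iff)
  qed (use generic f in simp)
  show ?thesis
  proof (cases "f x0 = 0")
    case True
    then have "image_rank_one x (\<lambda>v. f v + f0 v) = N x (\<lambda>v. f v + f0 v)"
      using f0 by (intro * bounded_clinear_plus f) auto
    then have "image_rank_one x f v + image_rank_one x f0 v = N x f v + N x f0 v" for v
      by (simp add: image_rank_one_add_right f f0 fun_eq_iff add2)
    moreover have "image_rank_one x f0 = N x f0" using *[OF f0(1)] f0 by simp
    ultimately show ?thesis by (simp add: fun_eq_iff)
  qed (use * f in simp)
qed

end

section \<open>Reconstruction of the intertwiner\<close>

text \<open>The image under \<open>q\<close> of the set where \<open>norm (p x) \<le> 1\<close> is
  weakly bounded, hence bounded, and homogeneity gives \<open>K\<close>. With the identity as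
  \<open>p\<close> or as \<open>q\<close> this bounds the intertwiner or its inverse.\<close>

lemma weak_bound:
  fixes p :: "'a::complex_normed_vector \<Rightarrow> 'b::complex_normed_vector"
    and q :: "'a \<Rightarrow> 'c::complex_normed_vector"
  assumes p: "clinear p" and q: "clinear q" and inj: "\<And>x. p x = 0 \<Longrightarrow> x = 0"
    and weak: "\<And>g :: 'c \<Rightarrow> complex. bounded_clinear g \<Longrightarrow> \<exists>C. \<forall>x. cmod (g (q x)) \<le> norm (p x) * C"
  obtains K where "\<And>x. norm (q x) \<le> norm (p x) * K"
proof -
  have "\<exists>C. \<forall>y\<in>q ` {x. norm (p x) \<le> 1}. cmod (g y) \<le> C" if g: "bounded_clinear g" for g :: "'c \<Rightarrow> complex"
  proof -
    obtain C where C: "\<forall>x. cmod (g (q x)) \<le> norm (p x) * C" using weak[OF g] by blast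
    have "cmod (g (q x)) \<le> \<bar>C\<bar>" if "norm (p x) \<le> 1" for x
    proof -
      have "cmod (g (q x)) \<le> norm (p x) * C" using C by blast
      also have "\<dots> \<le> norm (p x) * \<bar>C\<bar>" by (intro mult_left_mono) auto
      also have "\<dots> \<le> \<bar>C\<bar>" using that by (intro mult_left_le_one_le) auto
      finally show ?thesis .
    qed
    then show ?thesis by blast
  qed
  then obtain K where K: "\<And>y. y \<in> q ` {x. norm (p x) \<le> 1} \<Longrightarrow> norm y \<le> K"
    using weakly_bounded_imp_bounded by metis
  have "norm (q x) \<le> norm (p x) * K" for x
  proof (cases "p x = 0")
    case True
    then have "x = 0" by (rule inj)
    moreover have "q 0 = 0" using clinear_scale[OF q, of 0 0] by simp
    ultimately show ?thesis using True by simp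
  next
    case False
    define c where "c = complex_of_real (inverse (norm (p x)))"
    have "norm (p (c *\<^sub>C x)) = 1" using False by (simp add: c_def clinear_scale[OF p] norm_scaleC norm_inverse)
    then have "norm (q (c *\<^sub>C x)) \<le> K" by (intro K) auto
    then have "inverse (norm (p x)) * norm (q x) \<le> K"
      by (simp add: c_def clinear_scale[OF q] norm_scaleC norm_inverse)
    then show ?thesis using False by (simp add: field_simps)
  qed
  then show thesis by (rule that)
qed

context based_trace_form_preserver
begin

text \<open>The trace form gives \<open>S f (T x) = f x\<close>, which makes \<open>S\<close> the
  inverse adjoint of \<open>T\<close>. Since \<open>S\<close> is onto the dual of the target, the
  functionals \<open>S f\<close> separate points, and every identity for \<open>T\<close> can be
  checked through them.\<close>

lemma straight_imp_similarity:
  assumes straight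
  obtains T where "invertible_op T" "\<And>A x. A \<in> \<A> \<Longrightarrow> \<Psi> A (T x) = T (A x)"
proof -
  \<comment> \<open>As \<open>g0 y0 = 1\<close>, evaluating a column at \<open>y0\<close> recovers
    its vector, and applying \<open>g0\<close> to a row recovers its functional.\<close>
  define T where "T x = image_rank_one x f0 y0" for x
  define S where "S f v = g0 (image_rank_one x0 f v)" for f v
  have eT: "image_rank_one x f0 = rank_one (T x) g0" for x
  proof -
    obtain z where "image_rank_one x f0 = rank_one z g0" using assms unfolding straight_def by blast
    then show ?thesis using g0_y0 by (simp add: T_def rank_one_def scaleC_one)
  qed
  have "\<exists>h. bounded_clinear h \<and> image_rank_one x0 f = rank_one y0 h \<and> S f = h" if f: "bounded_clinear f" for f
  proof -
    obtain h where "bounded_clinear h" "image_rank_one x0 f = rank_one y0 h"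
      using assms f unfolding straight_def by blast
    then show ?thesis
      using g0_y0 by (auto simp: S_def fun_eq_iff rank_one_def bounded_clinear_scale[OF g0] scaleC_complex)
  qed
  then have S: "bounded_clinear (S f)" and eS: "image_rank_one x0 f = rank_one y0 (S f)" if "bounded_clinear f" for f
    using that by blast+
  have Tx0: "T x0 = y0" and Sf0: "S f0 = g0"
    using g0_y0 by (simp_all add: T_def S_def fun_eq_iff base rank_one_def scaleC_one
        bounded_clinear_scale[OF g0] scaleC_complex)
  have T: "clinear T"
    by (simp add: clinear_def T_def image_rank_one_add_left image_rank_one_scale_left f0)
  have pairing: "S f (T x) = f x" if f: "bounded_clinear f" for f x
    using trace_image_rank_one[OF f f0(1), of x0 x] f0(2) g0_y0
    by (simp add: eS f eT Y.trace_rank_one_comp_rank_one S g0)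
  have T_onto: "\<exists>x. y = T x" for y
    using column_preimage[of y]
  proof (elim disjE exE conjE)
    fix x assume "rank_one y g0 = image_rank_one x f0"
    from fun_cong[OF this, of y0] show ?thesis
      using g0_y0 by (auto simp: T_def rank_one_def scaleC_one)
  next
    fix f assume f: "bounded_clinear f" "rank_one y g0 = image_rank_one x0 f"
    from fun_cong[OF f(2), of y0] have "y = S f y0 *\<^sub>C T x0"
      using g0_y0 by (simp add: eS f(1) Tx0) (simp add: rank_one_def scaleC_one)
    then show ?thesis using clinear_scale[OF T] by metis
  qed
  have S_onto: "\<exists>f. bounded_clinear f \<and> g = S f" if g: "bounded_clinear g" for g
    using row_preimage[OF g]
  proof (elim disjE exE conjE)
    \<comment> \<open>The preimage of a row may be given as a column. The row is then a multiple of
      the base operator, and \<open>S f0 = g0\<close> supplies the required functional.\<close>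
    fix x assume *: "rank_one y0 g = image_rank_one x f0"
    have "g v = g0 (T x) * g0 v" for v
      using arg_cong[OF fun_cong[OF *, of v], of g0] g0_y0
      by (simp add: eT rank_one_def bounded_clinear_scale[OF g0] scaleC_complex)
    moreover have "S (\<lambda>v. g0 (T x) * f0 v) v = g0 (T x) * g0 v" for v
      using fun_cong[OF Sf0, of v] unfolding S_def
      by (simp add: image_rank_one_scale_right f0 bounded_clinear_scale[OF g0] scaleC_complex)
    ultimately show ?thesis
      using bounded_clinear_mult[OF f0(1), of "g0 (T x)"] by (auto simp: fun_eq_iff)
  next
    fix f assume f: "bounded_clinear f" "rank_one y0 g = image_rank_one x0 f"
    have "g v = S f v" for v
      using arg_cong[OF fun_cong[OF f(2), of v], of g0] g0_y0
      by (simp add: S_def) (simp add: rank_one_def bounded_clinear_scale[OF g0] scaleC_complex)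
    with f(1) show ?thesis by blast
  qed
  have separate: "u = w" if "\<And>f. bounded_clinear f \<Longrightarrow> S f u = S f w" for u w
    using S_onto that functionals_separate by metis
  have rep: "image_rank_one x f = rank_one (T x) (S f)" if f: "bounded_clinear f" for x f
  proof (rule image_rank_one_eqI[OF _ _ _ f])
    fix x and f :: "'a \<Rightarrow> complex" assume f: "bounded_clinear f" and nz: "f x0 \<noteq> 0" "f0 x \<noteq> 0"
    obtain u h where h: "bounded_clinear h" "image_rank_one x f = rank_one u h" using rank_one_op_image_rank_one[OF f] by (rule rank_one_opE)
    \<comment> \<open>Pairing with images of rows determines the vector factor up to a scalar,
      pairing with images of columns the functional factor. Multiplying the results leaves the
      scalar \<open>f x0 * f0 x\<close>, nonzero in general position.\<close>
    have "h y0 *\<^sub>C u = f x0 *\<^sub>C T x"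
    proof (rule separate)
      fix f' :: "'a \<Rightarrow> complex" assume f': "bounded_clinear f'"
      show "S f' (h y0 *\<^sub>C u) = S f' (f x0 *\<^sub>C T x)"
        using trace_image_rank_one[OF f f', of x x0]
        by (simp add: h eS f' Y.trace_rank_one_comp_rank_one S bounded_clinear_scale[OF S[OF f']]
            scaleC_complex pairing)
    qed
    moreover have hS: "h v * g0 u = S f v * f0 x" for v
    proof -
      obtain x' where x': "v = T x'" using T_onto by blast
      show ?thesis
        using trace_image_rank_one[OF f f0(1), of x x']
        by (simp add: h eT x' Y.trace_rank_one_comp_rank_one g0 pairing f)
    qed
    moreover have "h y0 * g0 u = f x0 * f0 x"
      using hS[of y0] pairing[OF f, of x0] by (simp add: Tx0)
    ultimately have eq: "(f x0 * f0 x) *\<^sub>C (S f v *\<^sub>C T x) = (f x0 * f0 x) *\<^sub>C (h v *\<^sub>C u)" for v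
    proof -
      assume hu: "h y0 *\<^sub>C u = f x0 *\<^sub>C T x" and hS: "\<And>v. h v * g0 u = S f v * f0 x"
        and hg: "h y0 * g0 u = f x0 * f0 x"
      have "(f x0 * f0 x) *\<^sub>C (S f v *\<^sub>C T x) = (S f v * f0 x) *\<^sub>C (f x0 *\<^sub>C T x)"
        by (simp add: scaleC_scaleC mult_ac)
      also have "\<dots> = (h v * g0 u) *\<^sub>C (h y0 *\<^sub>C u)" by (simp only: hu hS)
      also have "\<dots> = (h y0 * g0 u) *\<^sub>C (h v *\<^sub>C u)" by (simp add: scaleC_scaleC mult_ac)
      finally show ?thesis by (simp only: hg)
    qed
    have "S f v *\<^sub>C T x = h v *\<^sub>C u" for v
      using eq[of v] nz by (simp del: cvs.scale_scale)
    then show "image_rank_one x f = rank_one (T x) (S f)" by (simp add: h rank_one_def)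
  next
    show "rank_one (T (x + y)) (S f) v = rank_one (T x) (S f) v + rank_one (T y) (S f) v" for x y f v
      by (simp add: rank_one_def clinear_add[OF T] scaleC_add_right)
    show "rank_one (T x) (S (\<lambda>v. f v + g v)) v = rank_one (T x) (S f) v + rank_one (T x) (S g) v"
      if "bounded_clinear f" "bounded_clinear g" for x v and f g :: "'a \<Rightarrow> complex"
      using that
      by (simp add: rank_one_def S_def image_rank_one_add_right bounded_clinear_add[OF g0] scaleC_add_left)
  qed
  have intertwine: "\<Psi> A (T x) = T (A x)" if A: "A \<in> \<A>" for A x
  proof (rule separate)
    fix f :: "'a \<Rightarrow> complex" assume f: "bounded_clinear f"
    show "S f (\<Psi> A (T x)) = S f (T (A x))"
      using trace_image_comp[OF A f, of x] S[OF f] bounded_image[OF A]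
      by (simp add: rep f Y.trace_comp_rank_one pairing)
  qed
  have inj: "x = 0" if "T x = 0" for x
  proof (rule functionals_separate)
    fix f :: "'a \<Rightarrow> complex" assume f: "bounded_clinear f"
    show "f x = f 0"
      using pairing[OF f, of x] that bounded_clinear_zero[OF S[OF f]] bounded_clinear_zero[OF f] by simp
  qed
  \<comment> \<open>A functional \<open>g\<close> on the target is some \<open>S f\<close>, so
    composing it with \<open>T\<close> gives the bounded functional \<open>f\<close>.\<close>
  have "\<exists>C. \<forall>x. cmod (g (T x)) \<le> norm x * C" if g: "bounded_clinear g" for g :: "'b \<Rightarrow> complex"
  proof -
    obtain f where f: "bounded_clinear f" "g = S f" using S_onto[OF g] by blast
    obtain C where "\<And>x. cmod (f x) \<le> norm x * C" using bounded_clinear_bound[OF f(1)] by blast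
    then show ?thesis using pairing[OF f(1)] f(2) by auto
  qed
  then obtain K where K: "\<And>x. norm (T x) \<le> norm x * K"
    using weak_bound[OF bounded_clinear_clinear[OF bounded_clinear_id] T] by blast
  \<comment> \<open>The same pairing read backwards: \<open>f\<close> is \<open>S f\<close> composed
    with \<open>T\<close>, which bounds the inverse.\<close>
  have "\<exists>C. \<forall>x. cmod (f x) \<le> norm (T x) * C" if f: "bounded_clinear f" for f :: "'a \<Rightarrow> complex"
  proof -
    obtain C where "\<And>y. cmod (S f y) \<le> norm y * C" using bounded_clinear_bound[OF S[OF f]] by blast
    from this[of "T _"] show ?thesis by (auto simp: pairing[OF f])
  qed
  then obtain L where L: "\<And>x. norm x \<le> norm (T x) * L"
    using weak_bound[OF T bounded_clinear_clinear[OF bounded_clinear_id] inj] by blast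
  have bij: "bij T"
  proof (rule bijI)
    show "inj T"
    proof (rule injI)
      fix x y assume "T x = T y"
      then have "T (x + (- 1) *\<^sub>C y) = 0"
        by (simp only: clinear_add[OF T] clinear_scale[OF T])
          (simp add: scaleC_minus_left scaleC_one)
      from inj[OF this] show "x = y" by (simp add: scaleC_minus_left scaleC_one)
    qed
    show "surj T" using T_onto by (auto simp: surj_def)
  qed
  have TV: "T (inv T y) = y" for y using bij by (simp add: bij_is_surj surj_f_inv_f)
  have VT: "inv T (T x) = x" for x using bij by (simp add: bij_is_inj)
  have "bounded_clinear (inv T)"
  proof (rule bounded_clinearI)
    show "inv T (x + y) = inv T x + inv T y" for x y
      by (metis TV VT clinear_add[OF T])
    show "inv T (c *\<^sub>C x) = c *\<^sub>C inv T x" for c x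
      by (metis TV VT clinear_scale[OF T])
    show "norm (inv T x) \<le> norm x * L" for x using L[of "inv T x"] by (simp add: TV)
  qed
  moreover have "bounded_clinear T"
    using T K by (auto simp: bounded_clinear_def)
  ultimately have "invertible_op T" using TV VT by (intro invertible_opI[of T "inv T"])
  then show thesis using intertwine by (rule that)
qed

text \<open>The image of \<open>x \<otimes> f\<close> is \<open>S f \<otimes> U x\<close>, with
  \<open>S\<close> from the dual of the source onto the target and \<open>U\<close> from the source
  onto the dual of the target. They are linked by \<open>U x (S f) = f x\<close>; surjectivity and
  boundedness of both give reflexivity.\<close>

lemma twisted_imp_adjoint_similarity:
  assumes twisted
  shows "reflexive_space TYPE('a)" "reflexive_space TYPE('b)"
    "\<exists>S :: ('a \<Rightarrow> complex) \<Rightarrow> 'b. dual_invertible_op TYPE('a) S \<and>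
      (\<forall>A\<in>\<A>. \<forall>f. bounded_clinear f \<longrightarrow> \<Psi> A (S f) = S (f \<circ> A))"
proof -
  define U where "U x v = g0 (image_rank_one x f0 v)" for x v
  define S where "S f = image_rank_one x0 f y0" for f
  have "\<exists>h. bounded_clinear h \<and> image_rank_one x f0 = rank_one y0 h \<and> U x = h" for x
  proof -
    obtain h where "bounded_clinear h" "image_rank_one x f0 = rank_one y0 h"
      using assms unfolding twisted_def by blast
    then show ?thesis
      using g0_y0 by (auto simp: U_def fun_eq_iff rank_one_def bounded_clinear_scale[OF g0] scaleC_complex)
  qed
  then have U: "bounded_clinear (U x)" and eU: "image_rank_one x f0 = rank_one y0 (U x)" for x
    by blast+
  have eS: "image_rank_one x0 f = rank_one (S f) g0" if "bounded_clinear f" for f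
  proof -
    obtain z where "image_rank_one x0 f = rank_one z g0" using assms \<open>bounded_clinear f\<close> unfolding twisted_def by blast
    then show ?thesis using g0_y0 by (simp add: S_def rank_one_def scaleC_one)
  qed
  have Ux0: "U x0 = g0" and Sf0: "S f0 = y0"
    using g0_y0 by (simp_all add: U_def S_def fun_eq_iff base rank_one_def scaleC_one
        bounded_clinear_scale[OF g0] scaleC_complex)
  have U_add: "U (x + y) v = U x v + U y v" for x y v
    by (simp add: U_def image_rank_one_add_left f0 bounded_clinear_add[OF g0])
  have U_scale: "U (c *\<^sub>C x) v = c * U x v" for c x v
    by (simp add: U_def image_rank_one_scale_left f0 bounded_clinear_scale[OF g0] scaleC_complex)
  have S_add: "S (\<lambda>v. f v + g v) = S f + S g" if "bounded_clinear f" "bounded_clinear g" for f g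
    using that by (simp add: S_def image_rank_one_add_right)
  have S_scale: "S (\<lambda>v. c * f v) = c *\<^sub>C S f" if "bounded_clinear f" for c f
    using that by (simp add: S_def image_rank_one_scale_right)
  have pairing: "U x (S f) = f x" if f: "bounded_clinear f" for f x
    using trace_image_rank_one[OF f f0(1), of x0 x] f0(2) g0_y0
    by (simp add: eS f eU Y.trace_rank_one_comp_rank_one U g0)
  have S_onto: "\<exists>f. bounded_clinear f \<and> y = S f" for y
    using column_preimage[of y]
  proof (elim disjE exE conjE)
    fix x assume "rank_one y g0 = image_rank_one x f0"
    from fun_cong[OF this, of y0] have "y = U x y0 *\<^sub>C S f0"
      using g0_y0 by (simp add: eU Sf0) (simp add: rank_one_def scaleC_one)
    then have "y = S (\<lambda>v. U x y0 * f0 v)" by (simp add: S_scale f0)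
    then show ?thesis using bounded_clinear_mult[OF f0(1)] by blast
  next
    fix f assume f: "bounded_clinear f" "rank_one y g0 = image_rank_one x0 f"
    from fun_cong[OF f(2), of y0] f(1) show ?thesis
      using g0_y0 by (auto simp: S_def rank_one_def scaleC_one)
  qed
  have U_onto: "\<exists>x. g = U x" if g: "bounded_clinear g" for g
    using row_preimage[OF g]
  proof (elim disjE exE conjE)
    fix x assume *: "rank_one y0 g = image_rank_one x f0"
    have "g v = U x v" for v
      using arg_cong[OF fun_cong[OF *, of v], of g0] g0_y0
      by (simp add: U_def) (simp add: rank_one_def bounded_clinear_scale[OF g0] scaleC_complex)
    then show ?thesis by blast
  next
    fix f assume f: "bounded_clinear f" "rank_one y0 g = image_rank_one x0 f"
    have "g v = g0 (S f) * U x0 v" for v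
      using arg_cong[OF fun_cong[OF f(2), of v], of g0] g0_y0
      by (simp add: eS f(1) Ux0) (simp add: rank_one_def bounded_clinear_scale[OF g0] scaleC_complex)
    then have "g = U (g0 (S f) *\<^sub>C x0)" by (simp add: fun_eq_iff U_scale)
    then show ?thesis by blast
  qed
  have separate: "u = w" if "\<And>x. U x u = U x w" for u w
    using U_onto that functionals_separate by metis
  have rep: "image_rank_one x f = rank_one (S f) (U x)" if f: "bounded_clinear f" for x f
  proof (rule image_rank_one_eqI[OF _ _ _ f])
    fix x and f :: "'a \<Rightarrow> complex" assume f: "bounded_clinear f" and nz: "f x0 \<noteq> 0" "f0 x \<noteq> 0"
    obtain u h where h: "bounded_clinear h" "image_rank_one x f = rank_one u h" using rank_one_op_image_rank_one[OF f] by (rule rank_one_opE)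
    have hu: "h y0 *\<^sub>C u = f0 x *\<^sub>C S f"
    proof (rule separate)
      fix x'
      show "U x' (h y0 *\<^sub>C u) = U x' (f0 x *\<^sub>C S f)"
        using trace_image_rank_one[OF f f0(1), of x x']
        by (simp add: h eU Y.trace_rank_one_comp_rank_one U bounded_clinear_scale[OF U]
            scaleC_complex pairing f mult.commute)
    qed
    have hU: "h v * g0 u = U x v * f x0" for v
    proof -
      obtain f' where f': "bounded_clinear f'" "v = S f'" using S_onto by blast
      show ?thesis
        using trace_image_rank_one[OF f f'(1), of x x0]
        by (simp add: h eS f' Y.trace_rank_one_comp_rank_one g0 pairing mult.commute)
    qed
    have hg: "h y0 * g0 u = f0 x * f x0"
      using hU[of y0] pairing[OF f0(1), of x] by (simp add: Sf0)
    have "U x v *\<^sub>C S f = h v *\<^sub>C u" for v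
    proof -
      have "(f0 x * f x0) *\<^sub>C (U x v *\<^sub>C S f) = (U x v * f x0) *\<^sub>C (f0 x *\<^sub>C S f)"
        by (simp add: scaleC_scaleC mult_ac)
      also have "\<dots> = (h v * g0 u) *\<^sub>C (h y0 *\<^sub>C u)" by (simp only: hu hU)
      also have "\<dots> = (h y0 * g0 u) *\<^sub>C (h v *\<^sub>C u)" by (simp add: scaleC_scaleC mult_ac)
      finally have "(f0 x * f x0) *\<^sub>C (U x v *\<^sub>C S f) = (f0 x * f x0) *\<^sub>C (h v *\<^sub>C u)"
        by (simp only: hg)
      then show ?thesis using nz by (simp del: cvs.scale_scale)
    qed
    then show "image_rank_one x f = rank_one (S f) (U x)" by (simp add: h rank_one_def)
  next
    show "rank_one (S f) (U (x + y)) v = rank_one (S f) (U x) v + rank_one (S f) (U y) v" for x y f v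
      by (simp add: rank_one_def U_add scaleC_add_left)
    show "rank_one (S (\<lambda>v. f v + g v)) (U x) v = rank_one (S f) (U x) v + rank_one (S g) (U x) v"
      if "bounded_clinear f" "bounded_clinear g" for x v and f g :: "'a \<Rightarrow> complex"
      using that by (simp add: rank_one_def S_add scaleC_add_right)
  qed
  have intertwine: "\<Psi> A (S f) = S (f \<circ> A)" if A: "A \<in> \<A>" and f: "bounded_clinear f" for A f
  proof (rule separate)
    fix x
    have fA: "bounded_clinear (f \<circ> A)" unfolding o_def by (rule bounded_clinear_compose[OF f bounded[OF A]])
    show "U x (\<Psi> A (S f)) = U x (S (f \<circ> A))"
      using trace_image_comp[OF A f, of x] U bounded_image[OF A]
      by (simp add: rep f Y.trace_comp_rank_one pairing fA)
  qed
  obtain K where K: "\<And>f. bounded_clinear f \<Longrightarrow> (\<And>x. cmod (f x) \<le> norm x) \<Longrightarrow> norm (S f) \<le> K"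
  proof -
    \<comment> \<open>The image of the dual unit ball is weakly bounded: a functional on the target
      is some \<open>U x\<close>, and \<open>U x (S f) = f x\<close> is at most
      \<open>norm x\<close> in modulus.\<close>
    define B where "B = {S f |f. bounded_clinear f \<and> (\<forall>x. cmod (f x) \<le> norm x)}"
    have "\<exists>C. \<forall>y\<in>B. cmod (g y) \<le> C" if g: "bounded_clinear g" for g :: "'b \<Rightarrow> complex"
    proof -
      obtain x where "g = U x" using U_onto[OF g] by blast
      then have "\<forall>y\<in>B. cmod (g y) \<le> norm x" by (auto simp: B_def pairing)
      then show ?thesis by blast
    qed
    then obtain K where "\<And>y. y \<in> B \<Longrightarrow> norm y \<le> K" using weakly_bounded_imp_bounded by metis
    then show thesis by (intro that[of K]) (auto simp: B_def)
  qed
  have S_bound: "norm (S f) \<le> onorm f * K" if f: "bounded_clinear f" for f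
  proof (cases "onorm f = 0")
    case True
    then have "f = (\<lambda>v. 0 * f v)" using onorm_eq_0[OF bounded_clinear_bounded_linear[OF f]] by auto
    then have "S f = 0" using S_scale[OF f, of 0] by simp
    with True show ?thesis by simp
  next
    case False
    then have pos: "onorm f > 0" using onorm_pos_le[OF bounded_clinear_bounded_linear[OF f]] by simp
    define c where "c = complex_of_real (inverse (onorm f))"
    have "norm (S (\<lambda>v. c * f v)) \<le> K"
    proof (rule K[OF bounded_clinear_mult[OF f]])
      show "cmod (c * f x) \<le> norm x" for x
      proof -
        have "cmod (c * f x) = inverse (onorm f) * cmod (f x)"
          using pos by (simp add: c_def norm_mult norm_inverse)
        then have "onorm f * cmod (c * f x) = cmod (f x)" using pos by simp
        then have "onorm f * cmod (c * f x) \<le> onorm f * norm x"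
          using onorm[OF bounded_clinear_bounded_linear[OF f], of x] by simp
        then show ?thesis using pos by (rule mult_left_le_imp_le)
      qed
    qed
    then have "inverse (onorm f) * norm (S f) \<le> K"
      using pos by (simp add: S_scale f norm_scaleC c_def norm_inverse)
    then show ?thesis using pos by (simp add: field_simps)
  qed
  obtain L where L0: "L \<ge> 0" and L: "\<And>x y. cmod (U x y) \<le> norm x * norm y * L"
  proof -
    \<comment> \<open>\<open>U\<close> is bounded in \<open>x\<close> because \<open>y\<close> is
      some \<open>S f\<close>, and bounded in \<open>y\<close> because each \<open>U x\<close> is.
      Uniform boundedness turns this into a joint bound, which controls both \<open>U\<close> and
      the inverse of \<open>S\<close>.\<close>
    define F where "F = {\<lambda>x. U x y |y. norm y \<le> 1}"
    have "bounded_linear (\<lambda>x. U x y)" for y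
    proof -
      obtain f where "bounded_clinear f" "y = S f" using S_onto by blast
      then show ?thesis by (simp add: pairing bounded_clinear_bounded_linear)
    qed
    moreover have "\<exists>C. \<forall>y. norm y \<le> 1 \<longrightarrow> cmod (U x y) \<le> C" for x
    proof -
      obtain C where C: "C > 0" "\<And>y. cmod (U x y) \<le> norm y * C" using bounded_clinear_bound[OF U] by blast
      have "cmod (U x y) \<le> C" if "norm y \<le> 1" for y
        using order_trans[OF C(2)[of y] mult_right_mono[OF that, of C]] C(1) by simp
      then show ?thesis by blast
    qed
    ultimately obtain L where L: "L \<ge> 0" "\<And>f x. f \<in> F \<Longrightarrow> norm (f x) \<le> L * norm x"
      using uniform_boundedness[of F] unfolding F_def by (smt (verit) mem_Collect_eq)
    have "cmod (U x y) \<le> norm x * norm y * L" for x y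
    proof (cases "y = 0")
      case True
      then show ?thesis by (simp add: bounded_clinear_zero[OF U])
    next
      case False
      define c where "c = complex_of_real (inverse (norm y))"
      have "norm (c *\<^sub>C y) \<le> 1" using False by (simp add: c_def norm_scaleC norm_inverse)
      then have "cmod (U x (c *\<^sub>C y)) \<le> L * norm x" by (intro L(2)) (auto simp: F_def)
      then have "inverse (norm y) * cmod (U x y) \<le> L * norm x"
        by (simp add: bounded_clinear_scale[OF U] scaleC_complex norm_mult c_def norm_inverse)
      then show ?thesis using False by (simp add: field_simps)
    qed
    with L(1) show thesis by (intro that[of L])
  qed
  have S_inj: "f = g" if "bounded_clinear f" "bounded_clinear g" "S f = S g" for f g
    using pairing[OF that(1)] pairing[OF that(2)] that(3) by (simp add: fun_eq_iff)
  have bij: "bij_betw S (dual_space TYPE('a)) UNIV"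
    unfolding bij_betw_def inj_on_def dual_space_def using S_inj S_onto by fast
  have inv_S: "inv_into (dual_space TYPE('a)) S y = (\<lambda>x. U x y)" for y
  proof -
    obtain f where f: "bounded_clinear f" "y = S f" using S_onto by blast
    then have "inv_into (dual_space TYPE('a)) S y = f"
      using bij by (simp add: bij_betw_def inv_into_f_f dual_space_def)
    then show ?thesis using f by (simp add: pairing)
  qed
  have onorm_U1: "onorm (\<lambda>x. U x y) \<le> norm y * L" for y
    using L[of _ y] L0 by (intro onorm_bound) (auto simp: mult_ac)
  have onorm_U2: "onorm (U x) \<le> norm x * L" for x
    using L[of x] L0 by (intro onorm_bound) (auto simp: mult_ac)
  have U_dual: "bounded_clinear (\<lambda>x. U x y)" for y
  proof -
    obtain f where "bounded_clinear f" "y = S f" using S_onto by blast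
    then show ?thesis by (simp add: pairing)
  qed
  have "dual_invertible_op TYPE('a) S"
    unfolding dual_invertible_op_def dual_bounded_clinear_def inv_S
    using bij onorm_U1 S_bound by (auto simp: dual_space_def S_add S_scale)
  with intertwine show "\<exists>S :: ('a \<Rightarrow> complex) \<Rightarrow> 'b. dual_invertible_op TYPE('a) S \<and>
      (\<forall>A\<in>\<A>. \<forall>f. bounded_clinear f \<longrightarrow> \<Psi> A (S f) = S (f \<circ> A))" by blast
  show "reflexive_space TYPE('a)"
    unfolding reflexive_space_def
  proof (intro allI impI)
    fix \<phi> :: "('a \<Rightarrow> complex) \<Rightarrow> complex" assume "dual_bounded_clinear TYPE('a) \<phi>"
    then have add: "\<And>f g. bounded_clinear f \<Longrightarrow> bounded_clinear g \<Longrightarrow> \<phi> (\<lambda>x. f x + g x) = \<phi> f + \<phi> g"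
      and scale: "\<And>c f. bounded_clinear f \<Longrightarrow> \<phi> (\<lambda>x. c * f x) = c * \<phi> f"
      and "\<exists>M. \<forall>f. bounded_clinear f \<longrightarrow> cmod (\<phi> f) \<le> onorm f * M"
      by (auto simp: dual_bounded_clinear_def dual_space_def scaleC_complex)
    then obtain M where M: "\<And>f. bounded_clinear f \<Longrightarrow> cmod (\<phi> f) \<le> onorm f * M" by blast
    \<comment> \<open>Since \<open>\<lambda>x. U x y\<close> is the preimage of \<open>y\<close>
      under \<open>S\<close>, this transports \<open>\<phi>\<close> to a functional on the target.
      Being some \<open>U x\<close>, it exhibits \<open>\<phi>\<close> as evaluation at
      \<open>x\<close>.\<close>
    have "bounded_clinear (\<lambda>y. \<phi> (\<lambda>x. U x y))"
    proof (rule bounded_clinearI[where K = "L * \<bar>M\<bar>"])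
      show "\<phi> (\<lambda>x. U x (y + z)) = \<phi> (\<lambda>x. U x y) + \<phi> (\<lambda>x. U x z)" for y z
        by (simp add: bounded_clinear_add[OF U] add U_dual)
      show "\<phi> (\<lambda>x. U x (c *\<^sub>C y)) = c *\<^sub>C \<phi> (\<lambda>x. U x y)" for c y
        by (simp add: bounded_clinear_scale[OF U] scaleC_complex scale U_dual)
      show "cmod (\<phi> (\<lambda>x. U x y)) \<le> norm y * (L * \<bar>M\<bar>)" for y
      proof -
        have "cmod (\<phi> (\<lambda>x. U x y)) \<le> onorm (\<lambda>x. U x y) * M" by (rule M[OF U_dual])
        also have "\<dots> \<le> onorm (\<lambda>x. U x y) * \<bar>M\<bar>"
          by (intro mult_left_mono onorm_pos_le bounded_clinear_bounded_linear U_dual) auto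
        also have "\<dots> \<le> norm y * L * \<bar>M\<bar>" by (intro mult_right_mono onorm_U1) auto
        finally show ?thesis by (simp add: mult.assoc)
      qed
    qed
    from U_onto[OF this] obtain x where x: "(\<lambda>y. \<phi> (\<lambda>x. U x y)) = U x" by blast
    have "\<phi> f = f x" if f: "bounded_clinear f" for f
      using fun_cong[OF x, of "S f"] by (simp add: pairing f)
    then show "\<exists>x. \<forall>f\<in>dual_space TYPE('a). \<phi> f = f x" by (auto simp: dual_space_def)
  qed
  show "reflexive_space TYPE('b)"
    unfolding reflexive_space_def
  proof (intro allI impI)
    fix \<phi> :: "('b \<Rightarrow> complex) \<Rightarrow> complex" assume "dual_bounded_clinear TYPE('b) \<phi>"
    then have add: "\<And>f g. bounded_clinear f \<Longrightarrow> bounded_clinear g \<Longrightarrow> \<phi> (\<lambda>x. f x + g x) = \<phi> f + \<phi> g"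
      and scale: "\<And>c f. bounded_clinear f \<Longrightarrow> \<phi> (\<lambda>x. c * f x) = c * \<phi> f"
      and "\<exists>M. \<forall>f. bounded_clinear f \<longrightarrow> cmod (\<phi> f) \<le> onorm f * M"
      by (auto simp: dual_bounded_clinear_def dual_space_def scaleC_complex)
    then obtain M where M: "\<And>f. bounded_clinear f \<Longrightarrow> cmod (\<phi> f) \<le> onorm f * M" by blast
    have U_add': "U (x + y) = (\<lambda>v. U x v + U y v)" and U_scale': "U (c *\<^sub>C x) = (\<lambda>v. c * U x v)" for x y c
      by (simp_all add: fun_eq_iff U_add U_scale)
    \<comment> \<open>Pulled back along \<open>U\<close>, \<open>\<phi>\<close> becomes a functional
      \<open>f\<close> on the source, and the pairing makes \<open>S f\<close> the representing
      vector.\<close>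
    have "bounded_clinear (\<lambda>x. \<phi> (U x))"
    proof (rule bounded_clinearI[where K = "L * \<bar>M\<bar>"])
      show "\<phi> (U (x + y)) = \<phi> (U x) + \<phi> (U y)" for x y
        by (simp add: U_add' add U)
      show "\<phi> (U (c *\<^sub>C x)) = c *\<^sub>C \<phi> (U x)" for c x
        by (simp add: U_scale' scaleC_complex scale U)
      show "cmod (\<phi> (U x)) \<le> norm x * (L * \<bar>M\<bar>)" for x
      proof -
        have "cmod (\<phi> (U x)) \<le> onorm (U x) * M" by (rule M[OF U])
        also have "\<dots> \<le> onorm (U x) * \<bar>M\<bar>"
          by (intro mult_left_mono onorm_pos_le bounded_clinear_bounded_linear U) auto
        also have "\<dots> \<le> norm x * L * \<bar>M\<bar>" by (intro mult_right_mono onorm_U2) auto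
        finally show ?thesis by (simp add: mult.assoc)
      qed
    qed
    then obtain y where y: "\<And>x. \<phi> (U x) = U x y" using pairing by metis
    have "\<phi> g = g y" if "bounded_clinear g" for g
      using U_onto[OF that] y by auto
    then show "\<exists>y. \<forall>g\<in>dual_space TYPE('b). \<phi> g = g y" by (auto simp: dual_space_def)
  qed
qed

end

section \<open>Similarity invariance and the main theorem\<close>

lemma spectrum_similarity_subset:
  fixes C :: "'a::complex_normed_vector \<Rightarrow> 'a" and T :: "'a \<Rightarrow> 'b::complex_normed_vector"
  assumes C: "bounded_clinear C" and T: "bounded_clinear T" and V: "bounded_clinear V"
    and VT: "\<And>x. V (T x) = x" and TV: "\<And>y. T (V y) = y"
  shows "op_spectrum (\<lambda>y. T (C (V y))) \<subseteq> op_spectrum C"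
proof (rule subsetI, rule ccontr)
  fix z assume z: "z \<in> op_spectrum (\<lambda>y. T (C (V y)))" "z \<notin> op_spectrum C"
  obtain Q where Q: "bounded_clinear Q" "\<And>x. Q (C x - z *\<^sub>C x) = x" "\<And>x. C (Q x) - z *\<^sub>C Q x = x"
    using z(2) by (rule not_in_spectrumE) blast
  have "z \<notin> op_spectrum (\<lambda>y. T (C (V y)))"
  proof (rule not_in_spectrumI)
    show "bounded_clinear (\<lambda>y. T (C (V y)))" "bounded_clinear (\<lambda>y. T (Q (V y)))"
      by (intro bounded_clinear_compose[OF T] bounded_clinear_compose[OF C] bounded_clinear_compose[OF Q(1)] V)+
    fix y
    show "T (Q (V (T (C (V y)) - z *\<^sub>C y))) = y"
      by (simp add: bounded_clinear_diff[OF V] bounded_clinear_scale[OF V] VT Q(2) TV)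
    show "T (C (V (T (Q (V y))))) - z *\<^sub>C T (Q (V y)) = y"
      by (simp add: VT TV Q(3) flip: bounded_clinear_diff[OF T] bounded_clinear_scale[OF T])
  qed
  with z(1) show False by blast
qed

lemma spectrum_similarity:
  fixes C :: "'a::complex_normed_vector \<Rightarrow> 'a" and T :: "'a \<Rightarrow> 'b::complex_normed_vector"
  assumes C: "bounded_clinear C" and T: "bounded_clinear T" and V: "bounded_clinear V"
    and VT: "\<And>x. V (T x) = x" and TV: "\<And>y. T (V y) = y"
  shows "op_spectrum (\<lambda>y. T (C (V y))) = op_spectrum C"
proof
  have "bounded_clinear (\<lambda>y. T (C (V y)))"
    by (intro bounded_clinear_compose[OF T] bounded_clinear_compose[OF C] V)
  from spectrum_similarity_subset[OF this V T TV VT]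
  show "op_spectrum C \<subseteq> op_spectrum (\<lambda>y. T (C (V y)))" by (simp add: VT)
qed (rule spectrum_similarity_subset[OF assms])

lemma invertible_opE:
  assumes "invertible_op T"
  shows "bounded_clinear T" "bounded_clinear (inv T)" "inv T (T x) = x" "T (inv T y) = y"
proof -
  obtain S where S: "bounded_clinear T" "bounded_clinear S" "\<And>x. S (T x) = x" "\<And>y. T (S y) = y"
    using assms by (auto simp: invertible_op_def)
  have "inv T = S" using S by (intro inv_equality) auto
  with S show "bounded_clinear T" "bounded_clinear (inv T)" "inv T (T x) = x" "T (inv T y) = y"
    by simp_all
qed

text \<open>The constants are made nonnegative by absolute values, so that later chains of estimates
  may multiply by them.\<close>

lemma dual_invertible_opE:
  fixes S :: "('a::complex_normed_vector \<Rightarrow> complex) \<Rightarrow> 'b::complex_normed_vector"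
  assumes "dual_invertible_op TYPE('a) S"
  obtains V K L where "K \<ge> 0" "L \<ge> 0"
    "\<And>y. bounded_clinear (V y)" "\<And>f. bounded_clinear f \<Longrightarrow> V (S f) = f" "\<And>y. S (V y) = y"
    "\<And>y. inv_into (dual_space TYPE('a)) S y = V y"
    "\<And>f g. bounded_clinear f \<Longrightarrow> bounded_clinear g \<Longrightarrow> S (\<lambda>x. f x + g x) = S f + S g"
    "\<And>c f. bounded_clinear f \<Longrightarrow> S (\<lambda>x. c * f x) = c *\<^sub>C S f"
    "\<And>f. bounded_clinear f \<Longrightarrow> norm (S f) \<le> onorm f * K" "\<And>y. onorm (V y) \<le> norm y * L"
proof -
  have bd: "dual_bounded_clinear TYPE('a) S" and bij': "bij_betw S (dual_space TYPE('a)) UNIV"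
    and inv: "\<exists>L. \<forall>y. onorm (inv_into (dual_space TYPE('a)) S y) \<le> norm y * L"
    using assms unfolding dual_invertible_op_def by blast+
  have mem: "f \<in> dual_space TYPE('a) \<longleftrightarrow> bounded_clinear f" for f by (simp add: dual_space_def)
  note bd = bd[unfolded dual_bounded_clinear_def]
  have bij: "bij_betw S {f. bounded_clinear f} UNIV" using bij' by (simp only: dual_space_def)
  have add: "S (\<lambda>x. f x + g x) = S f + S g" if "bounded_clinear f" "bounded_clinear g" for f g
    using bd[THEN conjunct1, rule_format, of f g] that by (simp only: mem)
  have scale: "S (\<lambda>x. c * f x) = c *\<^sub>C S f" if "bounded_clinear f" for c f
    using bd[THEN conjunct2, THEN conjunct1, rule_format, of f c] that by (simp only: mem)
  obtain K where K: "\<And>f. bounded_clinear f \<Longrightarrow> norm (S f) \<le> onorm f * K"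
    using bd[THEN conjunct2, THEN conjunct2] unfolding Ball_def mem by blast
  obtain L where L: "\<And>y. onorm (inv_into {f. bounded_clinear f} S y) \<le> norm y * L"
    using inv unfolding dual_space_def by blast
  define V where "V = inv_into {f. bounded_clinear f} S"
  have V: "bounded_clinear (V y)" "S (V y) = y" for y
    using bij inv_into_into[of y S "{f. bounded_clinear f}"] f_inv_into_f[of y S "{f. bounded_clinear f}"]
    by (auto simp: V_def bij_betw_def)
  have "norm (S f) \<le> onorm f * \<bar>K\<bar>" if f: "bounded_clinear f" for f
    using K[OF f] mult_left_mono[OF abs_ge_self[of K] onorm_pos_le[OF bounded_clinear_bounded_linear[OF f]]]
    by linarith
  moreover have "onorm (V y) \<le> norm y * \<bar>L\<bar>" for y
    using L[of y] mult_left_mono[OF abs_ge_self[of L] norm_ge_zero[of y]] unfolding V_def by linarith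
  moreover have "V (S f) = f" if "bounded_clinear f" for f
    using bij that by (simp add: V_def bij_betw_def inv_into_f_f)
  ultimately show thesis
    by (intro that[of "\<bar>K\<bar>" "\<bar>L\<bar>" V]) (simp_all add: V add scale, simp add: V_def dual_space_def)
qed

text \<open>Reflexivity turns the inverse of the adjoint of \<open>C - z\<close> into an inverse of \<open>C - z\<close> itself.\<close>

lemma spectrum_adjoint_similarity:
  fixes C :: "'a::complex_normed_vector \<Rightarrow> 'a" and D :: "'b::complex_normed_vector \<Rightarrow> 'b"
  assumes refl: "reflexive_space TYPE('a)" and S: "dual_invertible_op TYPE('a) S"
    and C: "bounded_clinear C" and D: "bounded_clinear D"
    and eq: "\<And>f. bounded_clinear f \<Longrightarrow> D (S f) = S (f \<circ> C)"
  shows "op_spectrum D = op_spectrum C"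
proof -
  obtain V K L where K: "K \<ge> 0" and L: "L \<ge> 0"
    and V: "\<And>y. bounded_clinear (V y)" and VS: "\<And>f. bounded_clinear f \<Longrightarrow> V (S f) = f"
    and SV: "\<And>y. S (V y) = y"
    and S_add: "\<And>f g. bounded_clinear f \<Longrightarrow> bounded_clinear g \<Longrightarrow> S (\<lambda>x. f x + g x) = S f + S g"
    and S_scale: "\<And>c f. bounded_clinear f \<Longrightarrow> S (\<lambda>x. c * f x) = c *\<^sub>C S f"
    and S_bd: "\<And>f. bounded_clinear f \<Longrightarrow> norm (S f) \<le> onorm f * K"
    and V_bd: "\<And>y. onorm (V y) \<le> norm y * L"
    by (rule dual_invertible_opE[OF S]) blast
  have V_add: "V (y + z) = (\<lambda>x. V y x + V z x)" for y z
    by (metis S_add SV V VS bounded_clinear_plus)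
  have V_scale: "V (c *\<^sub>C y) = (\<lambda>x. c * V y x)" for c y
    by (metis S_scale SV V VS bounded_clinear_mult)
  have compose: "bounded_clinear (\<lambda>x. f (B x))" if "bounded_clinear f" "bounded_clinear B"
    for f :: "'a \<Rightarrow> complex" and B :: "'a \<Rightarrow> 'a"
    by (rule bounded_clinear_compose[OF that])
  have DS: "D (S f) - z *\<^sub>C S f = S (\<lambda>x. f (C x - z *\<^sub>C x))" if f: "bounded_clinear f" for z f
  proof -
    have "D (S f) - z *\<^sub>C S f = S (\<lambda>x. f (C x)) + S (\<lambda>x. (- z) * f x)"
      unfolding S_scale[OF f] by (simp add: eq[OF f] o_def scaleC_minus_left)
    also have "\<dots> = S (\<lambda>x. f (C x) + (- z) * f x)"
      by (rule S_add[symmetric, OF compose[OF f C] bounded_clinear_mult[OF f]])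
    finally show ?thesis
      by (simp add: bounded_clinear_diff[OF f] bounded_clinear_scale[OF f] scaleC_complex)
  qed
  have "z \<notin> op_spectrum D" if "z \<notin> op_spectrum C" for z
  proof -
    obtain Q where Q: "bounded_clinear Q" and q1: "\<And>x. Q (C x - z *\<^sub>C x) = x"
      and q2: "\<And>x. C (Q x) - z *\<^sub>C Q x = x"
      using \<open>z \<notin> op_spectrum C\<close> by (rule not_in_spectrumE) blast
    \<comment> \<open>The adjoint of the inverse \<open>Q\<close>, transported to the target by
      \<open>S\<close>.\<close>
    define R where "R y = S (\<lambda>x. V y (Q x))" for y
    have R: "bounded_clinear R"
    proof (rule bounded_clinearI)
      show "R (y + w) = R y + R w" for y w
        by (simp add: R_def V_add S_add compose V Q)
      show "R (c *\<^sub>C y) = c *\<^sub>C R y" for c y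
        by (simp add: R_def V_scale S_scale compose V Q)
      show "norm (R y) \<le> norm y * (L * onorm Q * K)" for y
      proof -
        have "norm (R y) \<le> onorm (\<lambda>x. V y (Q x)) * K"
          unfolding R_def by (rule S_bd[OF compose[OF V Q]])
        also have "\<dots> \<le> (onorm (V y) * onorm Q) * K"
          using onorm_compose[OF bounded_clinear_bounded_linear[OF V] bounded_clinear_bounded_linear[OF Q]] K
          by (intro mult_right_mono) (simp_all add: o_def)
        also have "\<dots> \<le> (norm y * L * onorm Q) * K"
          using V_bd K by (intro mult_right_mono onorm_pos_le bounded_clinear_bounded_linear Q) auto
        finally show ?thesis by (simp add: mult.assoc)
      qed
    qed
    show ?thesis
    proof (rule not_in_spectrumI[OF D R])
      fix y
      define f where "f = V y"
      have f: "bounded_clinear f" "y = S f" by (simp_all add: f_def V SV)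
      have Cz: "bounded_clinear (\<lambda>x. C x - z *\<^sub>C x)"
        by (intro bounded_clinear_sub C bounded_clinear_scaleC)
      show "R (D y - z *\<^sub>C y) = y"
        by (simp add: f(2) DS[OF f(1)] R_def VS compose[OF f(1) Cz] q2)
      have "R y = S (\<lambda>x. f (Q x))" by (simp add: R_def f_def)
      then show "D (R y) - z *\<^sub>C R y = y"
        by (simp add: DS compose f Q q1)
    qed
  qed
  moreover have "z \<notin> op_spectrum C" if "z \<notin> op_spectrum D" for z
  proof -
    obtain Q where Q: "bounded_clinear Q" and q1: "\<And>y. Q (D y - z *\<^sub>C y) = y"
      and q2: "\<And>y. D (Q y) - z *\<^sub>C Q y = y"
      using \<open>z \<notin> op_spectrum D\<close> by (rule not_in_spectrumE) blast
    \<comment> \<open>The inverse on the target, pulled back to the dual of the source. It has to be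
      recognized as the adjoint of an operator on the source.\<close>
    define W where "W f = V (Q (S f))" for f
    define M where "M = K * onorm Q * L"
    have M: "onorm (W f) \<le> onorm f * M" if f: "bounded_clinear f" for f
    proof -
      have "onorm (W f) \<le> norm (Q (S f)) * L" unfolding W_def by (rule V_bd)
      also have "\<dots> \<le> onorm Q * norm (S f) * L"
        using onorm[OF bounded_clinear_bounded_linear[OF Q]] L by (intro mult_right_mono) auto
      also have "\<dots> \<le> onorm Q * (onorm f * K) * L"
        using S_bd[OF f] L
        by (intro mult_right_mono mult_left_mono onorm_pos_le bounded_clinear_bounded_linear Q) auto
      finally show ?thesis by (simp add: M_def mult_ac)
    qed
    have W: "bounded_clinear (W f)" for f by (simp add: W_def V)
    have W_bd: "cmod (W f x) \<le> onorm f * M * norm x" if f: "bounded_clinear f" for f x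
      using onorm[OF bounded_clinear_bounded_linear[OF W], of f x] mult_right_mono[OF M[OF f] norm_ge_zero[of x]]
      by linarith
    \<comment> \<open>For fixed \<open>x\<close> the map sending \<open>f\<close> to
      \<open>W f x\<close> is a bounded functional on the dual, hence evaluation at a vector by
      reflexivity; that vector is \<open>R x\<close>.\<close>
    have "\<exists>w. \<forall>f. bounded_clinear f \<longrightarrow> W f x = f w" for x
    proof -
      have "dual_bounded_clinear TYPE('a) (\<lambda>f. W f x)"
        unfolding dual_bounded_clinear_def dual_space_def
        using W_bd[of _ x]
        by (auto simp: W_def S_add S_scale bounded_clinear_add[OF Q] bounded_clinear_scale[OF Q] V_add V_scale
            scaleC_complex mult.assoc intro!: exI[of _ "M * norm x"])
      then show ?thesis using refl unfolding reflexive_space_def dual_space_def by blast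
    qed
    then obtain R where R: "\<And>f x. bounded_clinear f \<Longrightarrow> f (R x) = W f x" by metis
    have "bounded_clinear R"
    proof (rule bounded_clinearI)
      show "R (x + y) = R x + R y" for x y
        by (rule functionals_separate) (simp add: R bounded_clinear_add[OF W] bounded_clinear_add[of _ "R x" "R y"])
      show "R (c *\<^sub>C x) = c *\<^sub>C R x" for c x
        by (rule functionals_separate) (simp add: R bounded_clinear_scale[OF W] bounded_clinear_scale[of _ c "R x"])
      show "norm (R x) \<le> norm x * M" for x
      proof -
        \<comment> \<open>\<open>R x\<close> is known only through functionals, so its norm is
          measured by one that attains it.\<close>
        obtain f :: "'a \<Rightarrow> complex" where f: "bounded_clinear f" "\<And>x. cmod (f x) \<le> norm x"
          "f (R x) = complex_of_real (norm (R x))"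
          using norming_functional by blast
        have "0 \<le> M" unfolding M_def
          using K L onorm_pos_le[OF bounded_clinear_bounded_linear[OF Q]] by simp
        moreover have "onorm f \<le> 1" using f(2) by (intro onorm_bound) auto
        ultimately have "onorm f * M * norm x \<le> 1 * M * norm x" by (intro mult_right_mono) auto
        moreover have "norm (R x) \<le> onorm f * M * norm x"
          using W_bd[OF f(1), of x] f(3) R[OF f(1), of x] by (metis norm_of_real abs_norm_cancel)
        ultimately show ?thesis by (simp add: mult.commute)
      qed
    qed
    then show ?thesis
    proof (rule not_in_spectrumI[OF C])
      fix x
      have Cz: "bounded_clinear (\<lambda>x. C x - z *\<^sub>C x)"
        by (intro bounded_clinear_sub C bounded_clinear_scaleC)
      show "R (C x - z *\<^sub>C x) = x"
      proof (rule functionals_separate)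
        fix f :: "'a \<Rightarrow> complex" assume f: "bounded_clinear f"
        have "S (\<lambda>x. W f (C x - z *\<^sub>C x)) = S f"
          using DS[OF W, of f z] q2[of "S f"] by (simp add: W_def SV)
        then have "(\<lambda>x. W f (C x - z *\<^sub>C x)) = f"
          by (metis VS compose[OF W Cz] f)
        then show "f (R (C x - z *\<^sub>C x)) = f x" by (simp add: R f fun_eq_iff)
      qed
      show "C (R x) - z *\<^sub>C R x = x"
      proof (rule functionals_separate)
        fix f :: "'a \<Rightarrow> complex" assume f: "bounded_clinear f"
        have "W (\<lambda>x. f (C x - z *\<^sub>C x)) = f"
          using DS[OF f, of z] q1[of "S f"] by (simp add: W_def VS f)
        then show "f (C (R x) - z *\<^sub>C R x) = f x"
          using R[OF compose[OF f Cz], of x] by simp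
      qed
    qed
  qed
  ultimately show ?thesis by blast
qed

section \<open>Normalization and the structure of a preserver\<close>

context peripheral_preserver
begin

text \<open>Inserting \<open>g y = c * f x\<close> into the trace identity and cancelling
  \<open>f(x)^(n-1)\<close> leaves \<open>f (A x) = c^(n-1) * g (\<Phi> A y)\<close>; multiplication
  by \<open>c^2\<close> completes the power to \<open>c^(n+1) = 1\<close>.\<close>

lemma trace_form_image:
  assumes c: "c ^ (n + 1) = 1" "\<And>R. rank_one_op R \<Longrightarrow> trace_one (\<Phi> R) = c * trace_one R"
    and A: "A \<in> \<A>" and R: "rank_one_op R"
  shows "trace_one (\<Phi> A \<circ> \<Phi> R) = c\<^sup>2 * trace_one (A \<circ> R)"
proof -
  have generic: "trace_one (\<Phi> A \<circ> \<Phi> (rank_one x f)) = c\<^sup>2 * f (A x)"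
    if f: "bounded_clinear f" and nz: "f x \<noteq> 0" for x f
  proof -
    note R = rank_one_opI[OF f, of x]
    obtain y g where g: "bounded_clinear g" "\<Phi> (rank_one x f) = rank_one y g"
      using image_rank_one_op[OF R] by (rule rank_one_opE)
    obtain k where k: "n = Suc k" using n by (cases n) auto
    have gy: "g y = c * f x" using c(2)[OF R] by (simp add: g Y.trace_rank_one X.trace_rank_one f)
    have "f x ^ k * f (A x) = f x ^ k * (c ^ k * g (\<Phi> A y))"
      using trace_identity[OF A f g] by (simp add: k gy power_mult_distrib mult_ac)
    then have "f (A x) = c ^ k * g (\<Phi> A y)" using nz by simp
    then have "c\<^sup>2 * f (A x) = c ^ (n + 1) * g (\<Phi> A y)" by (simp add: k power2_eq_square mult_ac)
    then show ?thesis
      using c(1) by (simp add: g Y.trace_comp_rank_one bounded_image A)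
  qed
  obtain x f where f: "bounded_clinear f" "R = rank_one x f" using R by (rule rank_one_opE)
  have "trace_one (\<Phi> A \<circ> \<Phi> (rank_one x f)) = c\<^sup>2 * f (A x)"
  proof (cases "x = 0")
    case True
    then have "rank_one x f = (\<lambda>v. 0 *\<^sub>C rank_one x f v)" by (simp add: rank_one_def)
    then have "\<Phi> (rank_one x f) = rank_one 0 (\<lambda>v. 0)"
      using image_scale[OF rank_one_op_in[OF rank_one_opI[OF f(1), of x]], of 0]
      by (simp add: rank_one_def)
    then have "trace_one (\<Phi> A \<circ> \<Phi> (rank_one x f)) = 0"
      by (simp only: Y.trace_comp_rank_one[OF bounded_image[OF A] bounded_clinear_0])
    then show ?thesis using True by (simp add: bounded_clinear_zero[OF bounded[OF A]] bounded_clinear_zero[OF f(1)])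
  next
    case False
    show ?thesis
    proof (cases "f x = 0")
      case True
      \<comment> \<open>Both \<open>h\<close> and \<open>f + h\<close> are nonzero at
        \<open>x\<close>, so the generic case applies to them and \<open>f\<close> is recovered as
        their difference.\<close>
      obtain h :: "'a \<Rightarrow> complex" where h: "bounded_clinear h" "h x = 1"
        using separating_functional[OF False] by blast
      note fh = bounded_clinear_plus[OF f(1) h(1)]
      note R = rank_one_opI[OF f(1), of x] rank_one_opI[OF h(1), of x] rank_one_opI[OF fh, of x]
      have eq: "\<Phi> A \<circ> \<Phi> (rank_one x (\<lambda>v. f v + h v)) =
          (\<lambda>v. (\<Phi> A \<circ> \<Phi> (rank_one x f)) v + (\<Phi> A \<circ> \<Phi> (rank_one x h)) v)"
        using image_add[OF R(1,2)[THEN rank_one_op_in]]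
        by (simp add: add_rank_one' o_def bounded_clinear_add[OF bounded_image[OF A]])
      have rk: "rank_one_op (\<Phi> A \<circ> \<Phi> R')" if "rank_one_op R'" for R'
        using image_rank_one_op[OF that]
        by (elim rank_one_opE) (simp add: comp_rank_one bounded_image A rank_one_opI)
      have "trace_one (\<Phi> A \<circ> \<Phi> (rank_one x (\<lambda>v. f v + h v))) =
          trace_one (\<Phi> A \<circ> \<Phi> (rank_one x f)) + trace_one (\<Phi> A \<circ> \<Phi> (rank_one x h))"
        unfolding eq using rk[OF R(3)] by (intro Y.trace_add rk R) (simp add: eq)
      moreover have "trace_one (\<Phi> A \<circ> \<Phi> (rank_one x h)) = c\<^sup>2 * h (A x)"
        using h by (intro generic) auto
      moreover have "trace_one (\<Phi> A \<circ> \<Phi> (rank_one x (\<lambda>v. f v + h v))) = c\<^sup>2 * (f (A x) + h (A x))"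
        using generic[OF fh, of x] True h(2) by simp
      ultimately show ?thesis by (simp add: algebra_simps)
    qed (use generic f in blast)
  qed
  then show ?thesis by (simp add: f X.trace_comp_rank_one bounded A)
qed

lemma preserver_structure:
  obtains c where "c ^ (n + 1) = 1"
    "(\<exists>T. invertible_op T \<and> (\<forall>A\<in>\<A>. \<forall>x. \<Phi> A (T x) = c *\<^sub>C T (A x))) \<or>
     (reflexive_space TYPE('a) \<and> reflexive_space TYPE('b) \<and>
      (\<exists>S :: ('a \<Rightarrow> complex) \<Rightarrow> 'b. dual_invertible_op TYPE('a) S \<and>
        (\<forall>A\<in>\<A>. \<forall>f. bounded_clinear f \<longrightarrow> \<Phi> A (S f) = c *\<^sub>C S (f \<circ> A))))"
proof -
  obtain c where c: "c ^ (n + 1) = 1" "\<And>R. rank_one_op R \<Longrightarrow> trace_one (\<Phi> R) = c * trace_one R"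
    using trace_factor by blast
  then have c0: "c \<noteq> 0" by auto
  \<comment> \<open>Dividing by \<open>c\<close> makes the trace factor one and, with one division
    in each factor, also removes \<open>c\<^sup>2\<close> from the trace form.\<close>
  define \<Psi> where "\<Psi> A = (\<lambda>y. inverse c *\<^sub>C \<Phi> A y)" for A
  have \<Phi>\<Psi>: "\<Phi> A y = c *\<^sub>C \<Psi> A y" for A y using c0 by (simp add: \<Psi>_def scaleC_scaleC scaleC_one)
  have scaled: "rank_one_op (\<lambda>v. a *\<^sub>C R v)" if "rank_one_op R" for a and R :: "'b \<Rightarrow> 'b"
    using that by (elim rank_one_opE) (simp add: scaled_rank_one rank_one_opI)
  have comp: "rank_one_op (\<Phi> A \<circ> \<Phi> R)" if "A \<in> \<A>" "rank_one_op R" for A R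
    using image_rank_one_op[OF that(2)]
    by (elim rank_one_opE) (simp add: comp_rank_one bounded_image that rank_one_opI)
  interpret tfp: trace_form_preserver X Y \<A> \<Psi>
  proof
    show "standard_operator_algebra \<A>" by (rule alg)
    show "bounded_clinear (\<Psi> A)" if "A \<in> \<A>" for A
      unfolding \<Psi>_def by (intro bounded_clinear_scaled bounded_image that)
    show "\<Psi> (\<lambda>x. A x + B x) = (\<lambda>y. \<Psi> A y + \<Psi> B y)" if "A \<in> \<A>" "B \<in> \<A>" for A B
      by (simp add: \<Psi>_def image_add that scaleC_add_right)
    show "\<Psi> (\<lambda>x. a *\<^sub>C A x) = (\<lambda>y. a *\<^sub>C \<Psi> A y)" if "A \<in> \<A>" for a A
      by (simp add: \<Psi>_def image_scale that scaleC_scaleC mult.commute)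
    show "rank_one_op (\<Psi> R)" if "rank_one_op R" for R
      unfolding \<Psi>_def by (intro scaled image_rank_one_op that)
    show "\<exists>R. rank_one_op R \<and> \<Psi> R = S" if S: "rank_one_op S" for S
    proof -
      have cS: "rank_one_op (\<lambda>v. c *\<^sub>C S v)" by (rule scaled[OF S])
      then obtain R where R: "R \<in> \<A>" "(\<lambda>v. c *\<^sub>C S v) = \<Phi> R"
        using range rank_one_op_bounded rank_one_op_rank_le by blast
      moreover have "rank_one_op R" using cS R rank_one_op_iff by simp
      moreover have "\<Psi> R = S" unfolding \<Psi>_def R(2)[symmetric] using c0 by (simp add: scaleC_scaleC scaleC_one)
      ultimately show ?thesis by blast
    qed
    show "trace_one (\<Psi> R) = trace_one R" if "rank_one_op R" for R
      unfolding \<Psi>_def using c0 that by (simp add: Y.trace_scale image_rank_one_op c(2))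
    show "trace_one (\<Psi> A \<circ> \<Psi> R) = trace_one (A \<circ> R)" if A: "A \<in> \<A>" and R: "rank_one_op R" for A R
    proof -
      have "\<Psi> A \<circ> \<Psi> R = (\<lambda>v. (inverse c * inverse c) *\<^sub>C (\<Phi> A \<circ> \<Phi> R) v)"
        by (simp add: \<Psi>_def fun_eq_iff bounded_clinear_scale[OF bounded_image[OF A]] scaleC_scaleC)
      then have "trace_one (\<Psi> A \<circ> \<Psi> R) = (inverse c * inverse c) * trace_one (\<Phi> A \<circ> \<Phi> R)"
        by (simp only: Y.trace_scale[OF comp[OF A R]])
      then show ?thesis using c0
        by (simp add: trace_form_image[OF c A R] power2_eq_square field_simps)
    qed
  qed
  obtain x0 :: 'a where x0: "x0 \<noteq> 0" using X.nontrivial by blast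
  then obtain f0 :: "'a \<Rightarrow> complex" where f0: "bounded_clinear f0" "f0 x0 = 1" by (rule separating_functional)
  obtain y0 g0 where g0: "bounded_clinear g0" "tfp.image_rank_one x0 f0 = rank_one y0 g0"
    using tfp.rank_one_op_image_rank_one[OF f0(1)] by (rule rank_one_opE)
  interpret based_trace_form_preserver X Y \<A> \<Psi> x0 f0 y0 g0
    by unfold_locales (use f0 g0 in auto)
  from straight_or_twisted show thesis
  proof
    assume straight
    then obtain T where "invertible_op T" "\<And>A x. A \<in> \<A> \<Longrightarrow> \<Psi> A (T x) = T (A x)"
      using straight_imp_similarity by blast
    then show thesis by (intro that[OF c(1)] disjI1) (auto simp: \<Phi>\<Psi>)
  next
    assume tw: twisted
    from twisted_imp_adjoint_similarity(3)[OF tw] obtain S :: "('a \<Rightarrow> complex) \<Rightarrow> 'b" where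
      "dual_invertible_op TYPE('a) S" "\<forall>A\<in>\<A>. \<forall>f. bounded_clinear f \<longrightarrow> \<Psi> A (S f) = S (f \<circ> A)"
      by blast
    with twisted_imp_adjoint_similarity(1,2)[OF tw] show thesis
      by (intro that[OF c(1)] disjI2) (auto simp: \<Phi>\<Psi>)
  qed
qed

end

section \<open>Sufficiency of the two forms and the zero space\<close>

lemma scaled_similarity_funpow:
  fixes B :: "'a::complex_normed_vector \<Rightarrow> 'a" and F :: "'b::complex_normed_vector \<Rightarrow> 'b"
  assumes F: "bounded_clinear F" and T: "\<And>x. F (T x) = c *\<^sub>C T (B x)"
  shows "(F ^^ k) (T x) = c ^ k *\<^sub>C T ((B ^^ k) x)"
  by (induction k) (simp_all add: scaleC_one bounded_clinear_scale[OF F] T scaleC_scaleC)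

lemma scaled_adjoint_funpow:
  fixes B :: "'a::complex_normed_vector \<Rightarrow> 'a" and F :: "'b::complex_normed_vector \<Rightarrow> 'b"
  assumes F: "bounded_clinear F" and B: "bounded_clinear B"
    and S: "\<And>f. bounded_clinear f \<Longrightarrow> F (S f) = c *\<^sub>C S (f \<circ> B)" and f: "bounded_clinear (f :: 'a \<Rightarrow> complex)"
  shows "(F ^^ k) (S f) = c ^ k *\<^sub>C S (f \<circ> (B ^^ k))"
proof (induction k)
  case (Suc k)
  have "bounded_clinear (f \<circ> (B ^^ k))"
    unfolding o_def by (rule bounded_clinear_compose[OF f bounded_clinear_funpow[OF B]])
  then have "F (S (f \<circ> (B ^^ k))) = c *\<^sub>C S (f \<circ> (B ^^ Suc k))"
    by (simp only: S funpow_Suc_right comp_assoc)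
  moreover have "(F ^^ Suc k) (S f) = F ((F ^^ k) (S f))" by simp
  ultimately show ?case
    by (simp only: Suc bounded_clinear_scale[OF F] scaleC_scaleC power_Suc2)
qed (simp add: scaleC_one id_def)

lemma similarity_preserves:
  fixes A B :: "'a::{complex_normed_vector, banach} \<Rightarrow> 'a"
    and F G :: "'b::{complex_normed_vector, banach} \<Rightarrow> 'b"
  assumes c: "c ^ (k + 1) = 1" and T: "invertible_op T"
    and A: "bounded_clinear A" and B: "bounded_clinear B" and F: "bounded_clinear F" and G: "bounded_clinear G"
    and FT: "\<And>x. F (T x) = c *\<^sub>C T (A x)" and GT: "\<And>x. G (T x) = c *\<^sub>C T (B x)"
  shows "peripheral_spectrum (A \<circ> (B ^^ k)) = peripheral_spectrum (F \<circ> (G ^^ k))"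
proof -
  note T' = invertible_opE[OF T]
  have "(F \<circ> (G ^^ k)) y = T ((A \<circ> (B ^^ k)) (inv T y))" for y
  proof -
    obtain x where x: "y = T x" using T'(4) by metis
    have "F ((G ^^ k) (T x)) = (c ^ k * c) *\<^sub>C T (A ((B ^^ k) x))"
      by (simp add: scaled_similarity_funpow[where T = T, OF G GT] bounded_clinear_scale[OF F] FT scaleC_scaleC)
    also have "c ^ k * c = 1" using c by (simp add: mult.commute)
    finally show ?thesis by (simp add: x T'(3) scaleC_one)
  qed
  then have "F \<circ> (G ^^ k) = (\<lambda>y. T ((A \<circ> (B ^^ k)) (inv T y)))" by (rule ext)
  moreover have "bounded_clinear (A \<circ> (B ^^ k))"
    unfolding o_def by (rule bounded_clinear_compose[OF A bounded_clinear_funpow[OF B]])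
  ultimately have "op_spectrum (F \<circ> (G ^^ k)) = op_spectrum (A \<circ> (B ^^ k))"
    using spectrum_similarity[of "A \<circ> (B ^^ k)" T "inv T"] T' by metis
  then show ?thesis by (simp add: peripheral_spectrum_def op_spectral_radius_def)
qed

text \<open>Passing to adjoints reverses products, so \<open>F \<circ> (G ^^ k)\<close> corresponds
  to \<open>(B ^^ k) \<circ> A\<close>; commuting the two factors restores the order. The scalars
  combine to \<open>c ^ (k + 1) = 1\<close>.\<close>

lemma adjoint_similarity_preserves:
  fixes A B :: "'a::{complex_normed_vector, banach} \<Rightarrow> 'a"
    and F G :: "'b::{complex_normed_vector, banach} \<Rightarrow> 'b"
  assumes c: "c ^ (k + 1) = 1" and refl: "reflexive_space TYPE('a)" and S: "dual_invertible_op TYPE('a) S"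
    and A: "bounded_clinear A" and B: "bounded_clinear B" and F: "bounded_clinear F" and G: "bounded_clinear G"
    and FS: "\<And>f. bounded_clinear f \<Longrightarrow> F (S f) = c *\<^sub>C S (f \<circ> A)"
    and GS: "\<And>f. bounded_clinear f \<Longrightarrow> G (S f) = c *\<^sub>C S (f \<circ> B)"
  shows "peripheral_spectrum (A \<circ> (B ^^ k)) = peripheral_spectrum (F \<circ> (G ^^ k))"
proof -
  have "op_spectrum (F \<circ> (G ^^ k)) = op_spectrum ((B ^^ k) \<circ> A)"
  proof (rule spectrum_adjoint_similarity[OF refl S])
    show "bounded_clinear ((B ^^ k) \<circ> A)"
      unfolding o_def by (rule bounded_clinear_compose[OF bounded_clinear_funpow[OF B] A])
    show "bounded_clinear (F \<circ> (G ^^ k))"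
      unfolding o_def by (rule bounded_clinear_compose[OF F bounded_clinear_funpow[OF G]])
    fix f :: "'a \<Rightarrow> complex" assume f: "bounded_clinear f"
    have fB: "bounded_clinear (f \<circ> (B ^^ k))"
      unfolding o_def by (rule bounded_clinear_compose[OF f bounded_clinear_funpow[OF B]])
    have "F ((G ^^ k) (S f)) = (c ^ k * c) *\<^sub>C S (f \<circ> (B ^^ k) \<circ> A)"
      by (simp add: scaled_adjoint_funpow[where S = S, OF G B GS f] bounded_clinear_scale[OF F] FS[OF fB] scaleC_scaleC)
    also have "c ^ k * c = 1" using c by (simp add: mult.commute)
    finally show "(F \<circ> (G ^^ k)) (S f) = S (f \<circ> ((B ^^ k) \<circ> A))"
      by (simp add: scaleC_one o_def)
  qed
  then have "peripheral_spectrum (F \<circ> (G ^^ k)) = peripheral_spectrum ((B ^^ k) \<circ> A)"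
    by (simp add: peripheral_spectrum_def op_spectral_radius_def)
  also have "\<dots> = peripheral_spectrum (A \<circ> (B ^^ k))"
    by (rule peripheral_spectrum_commute[OF bounded_clinear_funpow[OF B] A])
  finally show ?thesis by simp
qed

text \<open>On the zero space every spectrum is empty, so that case has to be treated separately.\<close>

lemma preserver_zero_space:
  fixes \<A> :: "('a::{complex_normed_vector, banach} \<Rightarrow> 'a) set"
    and \<Phi> :: "('a \<Rightarrow> 'a) \<Rightarrow> ('b::{complex_normed_vector, banach} \<Rightarrow> 'b)"
  assumes alg: "standard_operator_algebra \<A>"
    and bounded_image: "\<And>A. A \<in> \<A> \<Longrightarrow> bounded_clinear (\<Phi> A)"
    and range: "\<And>F. bounded_clinear F \<Longrightarrow> rank_le F 2 \<Longrightarrow> F \<in> \<Phi> ` \<A>"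
    and preserves: "\<And>A B. A \<in> \<A> \<Longrightarrow> B \<in> \<A> \<Longrightarrow>
      peripheral_spectrum (A \<circ> (B ^^ n)) = peripheral_spectrum (\<Phi> A \<circ> (\<Phi> B ^^ n))"
    and n: "n \<ge> 1"
    and zero: "(\<nexists>x::'a. x \<noteq> 0) \<or> (\<nexists>y::'b. y \<noteq> 0)"
  shows "(\<nexists>x::'a. x \<noteq> 0) \<and> (\<nexists>y::'b. y \<noteq> 0)"
proof -
  have ab: "\<nexists>y::'b. y \<noteq> 0" if z: "\<nexists>x::'a. x \<noteq> 0"
  proof
    assume "\<exists>y::'b. y \<noteq> 0"
    then obtain y :: 'b where "y \<noteq> 0" by blast
    then obtain g :: "'b \<Rightarrow> complex" where g: "bounded_clinear g" "g y = 1" using separating_functional by blast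
    have "\<exists>A\<in>\<A>. rank_one w g = \<Phi> A" for w
      using range[OF bounded_clinear_rank_one[OF g(1)] rank_one_op_rank_le[OF rank_one_opI[OF g(1)]]] by blast
    \<comment> \<open>The zero space carries a single operator, whereas the range would have to
      contain both a nonzero operator and the zero operator.\<close>
    moreover have "A = B" for A B :: "'a \<Rightarrow> 'a" using z by (metis ext)
    ultimately have "rank_one y g = rank_one 0 g" by metis
    from fun_cong[OF this, of y] show False using g \<open>y \<noteq> 0\<close> by (simp add: rank_one_def scaleC_one)
  qed
  have ba: "\<nexists>x::'a. x \<noteq> 0" if z: "\<nexists>y::'b. y \<noteq> 0"
  proof
    assume nt: "\<exists>x::'a. x \<noteq> 0"
    interpret X: nontrivial_space "TYPE('a)" by unfold_locales (rule nt)
    obtain x :: 'a where "x \<noteq> 0" using nt by blast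
    then obtain f :: "'a \<Rightarrow> complex" where f: "bounded_clinear f" "f x = 1" using separating_functional by blast
    define P where "P = rank_one x f"
    have P: "bounded_clinear P" "P \<in> \<A>"
      using standard_operator_algebraD(4)[OF alg] rank_le_imp_finite_rank rank_one_op_rank_le
        rank_one_opI[OF f(1)] bounded_clinear_rank_one[OF f(1)] unfolding P_def by blast+
    \<comment> \<open>An idempotent of rank one puts \<open>1\<close> into the spectrum, which an
      image acting on the zero space cannot match.\<close>
    have "peripheral_spectrum (P \<circ> (P ^^ n)) = {1}"
      using X.peripheral_spectrum_comp_rank_one_power[OF P(1) f(1) n, of x] f(2)
      by (simp add: P_def rank_one_def scaleC_one)
    then have "1 \<in> op_spectrum (\<Phi> P \<circ> (\<Phi> P ^^ n))"
      using preserves[OF P(2) P(2)] by (auto simp: peripheral_spectrum_def)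
    moreover have "1 \<notin> op_spectrum (\<Phi> P \<circ> (\<Phi> P ^^ n))"
    proof (rule not_in_spectrumI[OF _ bounded_clinear_0])
      show "bounded_clinear (\<Phi> P \<circ> (\<Phi> P ^^ n))"
        unfolding o_def
        by (rule bounded_clinear_compose[OF bounded_image[OF P(2)] bounded_clinear_funpow[OF bounded_image[OF P(2)]]])
      have eq: "v = w" for v w :: 'b
      proof -
        have "v = 0" "w = 0" using z by auto
        then show ?thesis by simp
      qed
      show "0 = x" "(\<Phi> P \<circ> (\<Phi> P ^^ n)) 0 - 1 *\<^sub>C 0 = x" for x by (rule eq)+
    qed
    ultimately show False by simp
  qed
  from zero show ?thesis
  proof
    assume z: "\<nexists>x::'a. x \<noteq> 0"
    then show ?thesis using ab[OF z] by (rule conjI)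
  next
    assume z: "\<nexists>y::'b. y \<noteq> 0"
    show ?thesis using ba[OF z] z by (rule conjI)
  qed
qed

theorem theorem2p2:
  fixes \<A>\<^sub>1 :: "('a::{complex_normed_vector, banach} \<Rightarrow> 'a) set"
    and \<A>\<^sub>2 :: "('b::{complex_normed_vector, banach} \<Rightarrow> 'b) set"
    and \<Phi> :: "('a \<Rightarrow> 'a) \<Rightarrow> ('b \<Rightarrow> 'b)"
    and r s m :: nat
  assumes "standard_operator_algebra \<A>\<^sub>1"
    and "standard_operator_algebra \<A>\<^sub>2"
    and "r + s \<ge> 1"
    and "m = r + s + 1"
    and "\<forall>A\<in>\<A>\<^sub>1. \<Phi> A \<in> \<A>\<^sub>2"
    and "\<forall>F. bounded_clinear F \<and> rank_le F 2 \<longrightarrow> F \<in> \<Phi> ` \<A>\<^sub>1"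
  shows "(\<forall>A\<in>\<A>\<^sub>1. \<forall>B\<in>\<A>\<^sub>1.
            peripheral_spectrum ((B ^^ r) \<circ> A \<circ> (B ^^ s)) =
            peripheral_spectrum ((\<Phi> B ^^ r) \<circ> \<Phi> A \<circ> (\<Phi> B ^^ s)))
    \<longleftrightarrow>
    (\<exists>(c::complex) (T::'a \<Rightarrow> 'b). c ^ m = 1 \<and> invertible_op T \<and>
        (\<forall>A\<in>\<A>\<^sub>1. \<Phi> A = (\<lambda>y. c *\<^sub>C T (A (inv T y)))))
    \<or>
    (reflexive_space TYPE('a) \<and> reflexive_space TYPE('b) \<and>
      (\<exists>(c::complex) (T::('a \<Rightarrow> complex) \<Rightarrow> 'b). c ^ m = 1 \<and>
        dual_invertible_op TYPE('a) T \<and>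
        (\<forall>A\<in>\<A>\<^sub>1. \<Phi> A = (\<lambda>y. c *\<^sub>C T (adjoint_op A (inv_into (dual_space TYPE('a)) T y))))))"
proof -
  let ?n = "r + s"
  have bd1: "bounded_clinear A" if "A \<in> \<A>\<^sub>1" for A
    using standard_operator_algebraD(1)[OF assms(1) that] .
  have bd2: "bounded_clinear (\<Phi> A)" if "A \<in> \<A>\<^sub>1" for A
    using standard_operator_algebraD(1)[OF assms(2)] assms(5) that by blast
  have n: "?n \<ge> 1" and m: "m = ?n + 1" using assms(3,4) by simp_all
  have range: "F \<in> \<Phi> ` \<A>\<^sub>1" if "bounded_clinear F" "rank_le F 2" for F
    using assms(6) that by blast
  have reduce: "peripheral_spectrum ((B ^^ r) \<circ> A \<circ> (B ^^ s)) =
            peripheral_spectrum ((\<Phi> B ^^ r) \<circ> \<Phi> A \<circ> (\<Phi> B ^^ s)) \<longleftrightarrow>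
        peripheral_spectrum (A \<circ> (B ^^ ?n)) = peripheral_spectrum (\<Phi> A \<circ> (\<Phi> B ^^ ?n))"
    if "A \<in> \<A>\<^sub>1" "B \<in> \<A>\<^sub>1" for A B
    by (simp only: peripheral_spectrum_product[OF bd1 bd1, OF that] peripheral_spectrum_product[OF bd2 bd2, OF that])
  show ?thesis (is "?L \<longleftrightarrow> ?R1 \<or> ?R2")
  proof
    assume ?L
    then have preserves: "peripheral_spectrum (A \<circ> (B ^^ ?n)) = peripheral_spectrum (\<Phi> A \<circ> (\<Phi> B ^^ ?n))"
      if "A \<in> \<A>\<^sub>1" "B \<in> \<A>\<^sub>1" for A B
      using reduce that by blast
    show "?R1 \<or> ?R2"
    proof (cases "(\<exists>x::'a. x \<noteq> 0) \<and> (\<exists>y::'b. y \<noteq> 0)")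
      case False
      then have z: "(\<nexists>x::'a. x \<noteq> 0) \<and> (\<nexists>y::'b. y \<noteq> 0)"
        by (intro preserver_zero_space[OF assms(1) bd2 range preserves n]) auto
      \<comment> \<open>Between zero spaces the zero map is invertible and all operators coincide,
        so the first form holds with scalar one.\<close>
      have "invertible_op (\<lambda>x::'a. 0 :: 'b)"
        by (rule invertible_opI[where S = "\<lambda>y. 0"]) (use z bounded_clinear_0 in auto)
      moreover have "\<Phi> A = (\<lambda>y. 1 *\<^sub>C 0)" for A using z by (metis ext)
      ultimately have ?R1 by (intro exI[of _ 1] exI[of _ "\<lambda>x. 0"]) auto
      then show ?thesis ..
    next
      case True
      interpret peripheral_preserver "TYPE('a)" "TYPE('b)" \<A>\<^sub>1 \<Phi> ?n
        by unfold_locales (use True assms(1) n bd2 range preserves in auto)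
      obtain c where c: "c ^ (?n + 1) = 1" and alt:
        "(\<exists>T. invertible_op T \<and> (\<forall>A\<in>\<A>\<^sub>1. \<forall>x. \<Phi> A (T x) = c *\<^sub>C T (A x))) \<or>
         (reflexive_space TYPE('a) \<and> reflexive_space TYPE('b) \<and>
          (\<exists>S :: ('a \<Rightarrow> complex) \<Rightarrow> 'b. dual_invertible_op TYPE('a) S \<and>
            (\<forall>A\<in>\<A>\<^sub>1. \<forall>f. bounded_clinear f \<longrightarrow> \<Phi> A (S f) = c *\<^sub>C S (f \<circ> A))))"
        by (rule preserver_structure)
      from alt show ?thesis
      proof (elim disjE exE conjE)
        fix T assume T: "invertible_op T" "\<forall>A\<in>\<A>\<^sub>1. \<forall>x. \<Phi> A (T x) = c *\<^sub>C T (A x)"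
        have "\<Phi> A = (\<lambda>y. c *\<^sub>C T (A (inv T y)))" if "A \<in> \<A>\<^sub>1" for A
          using T(2) that invertible_opE(4)[OF T(1)] by (metis ext)
        with c T(1) have ?R1 unfolding m by blast
        then show ?thesis ..
      next
        fix S :: "('a \<Rightarrow> complex) \<Rightarrow> 'b"
        assume refl: "reflexive_space TYPE('a)" "reflexive_space TYPE('b)" and S: "dual_invertible_op TYPE('a) S"
          and eq: "\<forall>A\<in>\<A>\<^sub>1. \<forall>f. bounded_clinear f \<longrightarrow> \<Phi> A (S f) = c *\<^sub>C S (f \<circ> A)"
        obtain V where V: "\<And>y. bounded_clinear (V y)" "\<And>y. S (V y) = y"
          "\<And>y. inv_into (dual_space TYPE('a)) S y = V y"
          by (rule dual_invertible_opE[OF S]) blast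
        have "\<Phi> A = (\<lambda>y. c *\<^sub>C S (adjoint_op A (inv_into (dual_space TYPE('a)) S y)))" if "A \<in> \<A>\<^sub>1" for A
        proof
          fix y
          show "\<Phi> A y = c *\<^sub>C S (adjoint_op A (inv_into (dual_space TYPE('a)) S y))"
            using eq that V(1)[of y] V(2)[of y] by (simp add: V(3) adjoint_op_def) metis
        qed
        with c refl S have ?R2 unfolding m by blast
        then show ?thesis ..
      qed
    qed
  next
    assume "?R1 \<or> ?R2"
    then have "peripheral_spectrum (A \<circ> (B ^^ ?n)) = peripheral_spectrum (\<Phi> A \<circ> (\<Phi> B ^^ ?n))"
      if A: "A \<in> \<A>\<^sub>1" and B: "B \<in> \<A>\<^sub>1" for A B
    proof (elim disjE exE conjE)
      fix c and T :: "'a \<Rightarrow> 'b" assume c: "c ^ m = 1" and T: "invertible_op T"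
        and eq: "\<forall>A\<in>\<A>\<^sub>1. \<Phi> A = (\<lambda>y. c *\<^sub>C T (A (inv T y)))"
      show ?thesis
        using eq A B invertible_opE(3)[OF T]
        by (intro similarity_preserves[OF c[unfolded m] T] bd1 bd2) auto
    next
      fix c and S :: "('a \<Rightarrow> complex) \<Rightarrow> 'b"
      assume refl: "reflexive_space TYPE('a)" and c: "c ^ m = 1" and S: "dual_invertible_op TYPE('a) S"
        and eq: "\<forall>A\<in>\<A>\<^sub>1. \<Phi> A = (\<lambda>y. c *\<^sub>C S (adjoint_op A (inv_into (dual_space TYPE('a)) S y)))"
      obtain V where V: "\<And>f. bounded_clinear f \<Longrightarrow> V (S f) = f"
        "\<And>y. inv_into (dual_space TYPE('a)) S y = V y"
        by (rule dual_invertible_opE[OF S]) blast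
      show ?thesis
        using eq A B V
        by (intro adjoint_similarity_preserves[OF c[unfolded m] refl S] bd1 bd2) (auto simp: adjoint_op_def)
    qed
    then show ?L using reduce by blast
  qed
qed

end
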